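(* (Higher-level Bailey lemma.) Fix integers $N\ge 1$ and $\ell\ge 0$, and fix a partition $\lambda$ whose largest part does not exceed $N-1$. Choose $\sigma\in\{0,1\}$ such that $\ell+|\lambda|+\sigma N$ is even. Let $(\alpha,\beta)$ form a Bailey pair relative to $a=q^{\ell}$. Then the following identity holds: $$\frac{1}{(aq)_\infty}\sum_{L=0}^\infty a^{L/N}q^{L^2/N}\,\alpha_L\sum_{\boldsymbol\eta\in\mathbb Z^{N-1}}^{(\sigma,L)}\frac{q^{\boldsymbol\eta\,C^{-1}(\boldsymbol\eta-\boldsymbol e_\lambda)}}{(q)_{\eta_1}\cdots(q)_{\eta_{N-1}}}=\sum_{L=0}^\infty a^{L/N}q^{L^2/N}\,\beta_L\sum_{\boldsymbol n\in\mathbb Z^{N-1}}^{(\sigma,L)}q^{\boldsymbol n\,C^{-1}(\boldsymbol n-\boldsymbol e_\lambda)}\prod_{j=1}^{N-1}\left[{m_j+n_j\atop n_j}\right],$$ where $\boldsymbol m=(m_1,\dots,m_{N-1})$ is determined by $L$ and $\boldsymbol n$ through $$\boldsymbol m=C^{-1}\bigl((2L+\ell)\,\boldsymbol e_{N-1}+\boldsymbol e_\lambda-2\boldsymbol n\bigr).$$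
   Context: $(x)_\infty=\prod_{n\ge0}(1-xq^n)$ (with $|q|<1$) and $(x)_n=(x)_\infty/(xq^n)_\infty$ for $n\in\mathbb Z$; so $1/(q)_n=0$ for integers $n<0$. Since $a=q^\ell$, $a^{s}$ means $q^{\ell s}$. For integers $m,n$: $\left[{m+n\atop n}\right]=\frac{(q)_{m+n}}{(q)_m(q)_n}$ if $m,n\ge0$, and $0$ otherwise. A pair of sequences $\alpha=\{\alpha_L\}_{L\ge0}$, $\beta=\{\beta_L\}_{L\ge0}$ is a Bailey pair relative to $a$ if $\beta_L=\sum_{r=0}^L\frac{\alpha_r}{(q)_{L-r}(aq)_{L+r}}$ for all $L\ge0$. Vectors are $\boldsymbol v=(v_1,\dots,v_{N-1})$; $\boldsymbol e_j$ is the $j$-th unit vector, and $\boldsymbol e_0=\boldsymbol e_N=\boldsymbol 0$. $C$ is the Cartan matrix of the Lie algebra $A_{N-1}$: $C_{j,k}=2\delta_{j,k}-\delta_{j,k-1}-\delta_{j,k+1}$, $1\le j,k\le N-1$. For vectors, $\boldsymbol v\, C^{-1}\boldsymbol w=\sum_{j,k=1}^{N-1}v_j\,C^{-1}_{j,k}\,w_k$. For a partition $\lambda=(\lambda_1,\lambda_2,\dots)$ with all parts $\le N-1$, $\boldsymbol e_\lambda=\boldsymbol e_{\lambda_1}+\boldsymbol e_{\lambda_2}+\cdots$ and $|\lambda|=\sum_i\lambda_i$. Restricted sums: $\sum^{(\sigma,L)}_{\boldsymbol n\in\mathbb Z^{N-1}}$ denotes the sum over those $\boldsymbol n\in\mathbb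 Z^{N-1}$ satisfying $\frac{L+(\ell-|\lambda|)/2}{N}-(C^{-1}\boldsymbol n)_1\in\mathbb Z+\frac{\sigma}{2}$ (this ensures that $\boldsymbol m$ has integer entries); the sum over $\boldsymbol\eta$ is restricted in the same way, with $\boldsymbol\eta$ in place of $\boldsymbol n$. For $N=1$, $\mathbb Z^{0}$ is a single point, all vector expressions are $0$, and empty products equal $1$.
   Formalization: Since the outer series can diverge for arbitrary α, it is additionally assumed that a^{L/N}q^{L²/N}α_L is bounded in L and that at least one of the two outer series converges; q is nonzero with a fixed logarithm defining its fractional powers. *)

theory Defs
  imports "HOL-Analysis.Analysis" "HOL-Library.Multiset"
begin

section \<open>Shifted factorials and Bailey pairs\<close>

definition qpoch_inf :: "complex \<Rightarrow> complex \<Rightarrow> complex" where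
  "qpoch_inf q x = (\<Prod>n. 1 - x * q ^ n)"

text \<open>
  For negative \<open>n\<close> the symbol \<open>(q)\<^sub>n\<close> has a pole, the denominator below being \<open>0\<close>.
  As division by \<open>0\<close> gives \<open>0\<close>, \<open>qpoch q q n = 0\<close> in this case, and then
  \<open>1 / qpoch q q n = 0\<close>, which is the usual convention \<open>1/(q)\<^sub>n = 0\<close>.
\<close>

definition qpoch :: "complex \<Rightarrow> complex \<Rightarrow> int \<Rightarrow> complex" where
  "qpoch q x n = qpoch_inf q x / qpoch_inf q (x * q powi n)"

text \<open>\<open>qbinom q m n\<close> is the Gaussian binomial with upper entry \<open>m + n\<close> and lower entry \<open>n\<close>.\<close>

definition qbinom :: "complex \<Rightarrow> int \<Rightarrow> int \<Rightarrow> complex" where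
  "qbinom q m n =
     (if m \<ge> 0 \<and> n \<ge> 0 then qpoch q q (m + n) / (qpoch q q m * qpoch q q n) else 0)"

definition bailey_pair ::
    "complex \<Rightarrow> complex \<Rightarrow> (nat \<Rightarrow> complex) \<Rightarrow> (nat \<Rightarrow> complex) \<Rightarrow> bool" where
  "bailey_pair q a \<alpha> \<beta> \<longleftrightarrow>
     (\<forall>L. \<beta> L = (\<Sum>r=0..L. \<alpha> r / (qpoch q q (int L - int r) * qpoch q (a * q) (int L + int r))))"

text \<open>
  The power \<open>q\<^sup>s\<close> for real \<open>s\<close>, where \<open>w\<close> is a logarithm of \<open>q\<close>, that is \<open>exp w = q\<close>.
\<close>

definition qpow :: "complex \<Rightarrow> real \<Rightarrow> complex" where
  "qpow w s = exp (of_real s * w)"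


section \<open>Vectors of length \<open>N - 1\<close> and the Cartan matrix of type \<open>A\<close>\<close>

text \<open>
  Since \<open>N\<close> is a variable and \<open>N = 1\<close> is allowed, vectors of length \<open>N - 1\<close> are functions
  on \<open>nat\<close> with support in \<open>{1..<N}\<close>.
\<close>

definition int_vectors :: "nat \<Rightarrow> (nat \<Rightarrow> int) set" where
  "int_vectors N = {v. \<forall>j. j \<notin> {1..<N} \<longrightarrow> v j = 0}"

definition unit_vector :: "nat \<Rightarrow> nat \<Rightarrow> nat \<Rightarrow> int" where
  "unit_vector N i = (\<lambda>k. if i \<in> {1..<N} \<and> k = i then 1 else 0)"

definition part_vector :: "nat \<Rightarrow> nat multiset \<Rightarrow> nat \<Rightarrow> int" where
  "part_vector N lam = (\<lambda>k. \<Sum>i\<in>#lam. unit_vector N i k)"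

definition cartan :: "nat \<Rightarrow> nat \<Rightarrow> real" where
  "cartan j k = 2 * of_bool (j = k) - of_bool (j + 1 = k) - of_bool (j = k + 1)"

definition cartan_inv :: "nat \<Rightarrow> nat \<Rightarrow> nat \<Rightarrow> real" where
  "cartan_inv N = (THE B.
     (\<forall>j k. j \<notin> {1..<N} \<or> k \<notin> {1..<N} \<longrightarrow> B j k = 0) \<and>
     (\<forall>j\<in>{1..<N}. \<forall>k\<in>{1..<N}. (\<Sum>i=1..<N. cartan j i * B i k) = of_bool (j = k)) \<and>
     (\<forall>j\<in>{1..<N}. \<forall>k\<in>{1..<N}. (\<Sum>i=1..<N. B j i * cartan i k) = of_bool (j = k)))"

definition cartan_inv_mult :: "nat \<Rightarrow> (nat \<Rightarrow> int) \<Rightarrow> nat \<Rightarrow> real" where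
  "cartan_inv_mult N v j = (\<Sum>k=1..<N. cartan_inv N j k * of_int (v k))"

definition cartan_inv_form :: "nat \<Rightarrow> (nat \<Rightarrow> int) \<Rightarrow> (nat \<Rightarrow> int) \<Rightarrow> real" where
  "cartan_inv_form N v u = (\<Sum>j=1..<N. \<Sum>k=1..<N. of_int (v j) * cartan_inv N j k * of_int (u k))"

text \<open>
  The inverse exists, so the definite description above denotes it.
\<close>

lemma sum_cartan:
  assumes "j \<in> {1..<N}"
  shows "(\<Sum>i=1..<N. cartan j i * f i) =
    2 * f j - (if j + 1 < N then f (j + 1) else 0) - (if 1 < j then f (j - 1) else 0)"
proof -
  have "(\<Sum>i=1..<N. cartan j i * f i) =
      (\<Sum>i=1..<N. (if i = j then 2 * f i else 0) - (if i = j + 1 then f i else 0)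
         - (if i = j - 1 \<and> 1 < j then f i else 0))"
    by (rule sum.cong) (use assms in \<open>auto simp: cartan_def\<close>)
  also have "\<dots> = (\<Sum>i=1..<N. if i = j then 2 * f i else 0) - (\<Sum>i=1..<N. if i = j + 1 then f i else 0)
         - (\<Sum>i=1..<N. if i = j - 1 then (if 1 < j then f i else 0) else 0)"
    by (simp add: sum_subtractf if_if_eq_conj)
  also have "\<dots> = 2 * f j - (if j + 1 < N then f (j + 1) else 0) - (if 1 < j then f (j - 1) else 0)"
    using assms by (subst (1 2 3) sum.delta) auto
  finally show ?thesis .
qed

lemma cartan_sym: "cartan j k = cartan k j"
  by (auto simp: cartan_def)

lemma cartan_inv_eq:
  "cartan_inv N j k =
     (if j \<in> {1..<N} \<and> k \<in> {1..<N} then min (real j) (real k) - real j * real k / real N else 0)"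
proof -
  define G :: "nat \<Rightarrow> nat \<Rightarrow> real" where "G = (\<lambda>j k. if j \<in> {1..<N} \<and> k \<in> {1..<N}
     then min (real j) (real k) - real j * real k / real N else 0)"
  have G_sym: "G j k = G k j" for j k
    by (auto simp: G_def min_def)
  have G1: "(\<Sum>i=1..<N. cartan j i * G i k) = of_bool (j = k)"
    if "j \<in> {1..<N}" "k \<in> {1..<N}" for j k
  proof -
    define H where "H = (\<lambda>i. min (real i) (real k) - real i * real k / real N)"
    have G_H: "G i k = H i" if "i \<in> {1..<N}" for i
      using that \<open>k \<in> {1..<N}\<close> by (simp add: G_def H_def)
    have "(\<Sum>i=1..<N. cartan j i * G i k) =
        2 * G j k - (if j + 1 < N then G (j + 1) k else 0) - (if 1 < j then G (j - 1) k else 0)"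
      by (rule sum_cartan[OF that(1)])
    also have "(if j + 1 < N then G (j + 1) k else 0) = H (j + 1)"
    proof (cases "j + 1 < N")
      case False
      hence "j + 1 = N" using that by auto
      thus ?thesis using that by (simp add: H_def)
    qed (simp add: G_H)
    also have "(if 1 < j then G (j - 1) k else 0) = H (j - 1)"
    proof (cases "1 < j")
      case False
      hence "j - 1 = 0" by auto
      thus ?thesis using False by (simp add: H_def)
    next
      case True
      hence "j - 1 \<in> {1..<N}" using that by auto
      thus ?thesis using True by (simp add: G_H)
    qed
    also have "2 * G j k - H (j + 1) - H (j - 1) =
        2 * min (real j) (real k) - min (real j + 1) (real k) - min (real j - 1) (real k)"
      unfolding G_H[OF that(1)] using that by (simp add: H_def of_nat_diff field_simps)
    also have "\<dots> = of_bool (j = k)"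
    proof -
      consider "real j + 1 \<le> real k" "j < k" | "j = k" | "real k + 1 \<le> real j" "k < j" by linarith
      thus ?thesis by cases auto
    qed
    finally show ?thesis .
  qed
  have G2: "(\<Sum>i=1..<N. G j i * cartan i k) = of_bool (j = k)"
    if "j \<in> {1..<N}" "k \<in> {1..<N}" for j k
    using G1[OF that(2,1)] by (simp add: G_sym[of j] cartan_sym[of _ k] mult.commute eq_commute)
  have "cartan_inv N = G"
    unfolding cartan_inv_def
  proof (rule the_equality, intro conjI)
    fix B :: "nat \<Rightarrow> nat \<Rightarrow> real"
    assume B: "(\<forall>j k. j \<notin> {1..<N} \<or> k \<notin> {1..<N} \<longrightarrow> B j k = 0) \<and>
     (\<forall>j\<in>{1..<N}. \<forall>k\<in>{1..<N}. (\<Sum>i=1..<N. cartan j i * B i k) = of_bool (j = k)) \<and>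
     (\<forall>j\<in>{1..<N}. \<forall>k\<in>{1..<N}. (\<Sum>i=1..<N. B j i * cartan i k) = of_bool (j = k))"
    have "B j k = G j k" if jk: "j \<in> {1..<N}" "k \<in> {1..<N}" for j k
    proof -
      have "B j k = (\<Sum>h=1..<N. of_bool (j = h) * B h k)"
        using jk by (simp add: of_bool_def if_distrib[of "\<lambda>x. x * _"] sum.delta cong: if_cong)
      also have "\<dots> = (\<Sum>h=1..<N. (\<Sum>i=1..<N. G j i * cartan i h) * B h k)"
        by (rule sum.cong) (use G2 jk in auto)
      also have "\<dots> = (\<Sum>h=1..<N. \<Sum>i=1..<N. G j i * (cartan i h * B h k))"
        by (simp add: sum_distrib_right mult.assoc)
      also have "\<dots> = (\<Sum>i=1..<N. G j i * (\<Sum>h=1..<N. cartan i h * B h k))"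
        by (subst sum.swap) (simp add: sum_distrib_left)
      also have "\<dots> = (\<Sum>i=1..<N. G j i * of_bool (i = k))"
        by (rule sum.cong) (use B jk in auto)
      also have "\<dots> = G j k"
        using jk by (simp add: of_bool_def if_distrib[of "\<lambda>x. _ * x"] sum.delta' cong: if_cong)
      finally show ?thesis .
    qed
    moreover have "B j k = G j k" if "\<not> (j \<in> {1..<N} \<and> k \<in> {1..<N})" for j k
      using B that unfolding G_def by auto
    ultimately show "B = G" by blast
  qed (use G1 G2 in \<open>auto simp: G_def\<close>)
  thus ?thesis by (simp add: G_def)
qed


section \<open>The two inner sums\<close>

text \<open>The domain of summation of the restricted sums.\<close>

definition restricted ::
    "nat \<Rightarrow> nat \<Rightarrow> nat multiset \<Rightarrow> nat \<Rightarrow> nat \<Rightarrow> (nat \<Rightarrow> int) set" where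
  "restricted N l lam \<sigma> L = {n \<in> int_vectors N. \<exists>z::int.
     (real L + (real l - real (\<Sum>\<^sub># lam)) / 2) / real N - cartan_inv_mult N n 1
       = of_int z + real \<sigma> / 2}"

text \<open>
  The vector \<open>m\<close> determined by \<open>L\<close> and \<open>n\<close>. Its entries are integers when \<open>n\<close> satisfies the
  restriction (lemma \<open>m_vector_eq\<close>), so that rounding does nothing there.
\<close>

definition m_vector ::
    "nat \<Rightarrow> nat \<Rightarrow> nat multiset \<Rightarrow> nat \<Rightarrow> (nat \<Rightarrow> int) \<Rightarrow> nat \<Rightarrow> int" where
  "m_vector N l lam L n j = \<lfloor>cartan_inv_mult N
     (\<lambda>k. (2 * int L + int l) * unit_vector N (N - 1) k + part_vector N lam k - 2 * n k) j\<rfloor>"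

lemma sum_part_vector:
  assumes "\<forall>p\<in>#lam. 1 \<le> p \<and> p \<le> N - 1"
  shows "(\<Sum>k=1..<N. int k * part_vector N lam k) = int (\<Sum>\<^sub># lam)"
  using assms
proof (induction lam)
  case (add p lam)
  have "(\<Sum>k=1..<N. int k * part_vector N (add_mset p lam) k) =
      (\<Sum>k=1..<N. int k * unit_vector N p k) + (\<Sum>k=1..<N. int k * part_vector N lam k)"
    by (simp add: part_vector_def distrib_left sum.distrib)
  also have "(\<Sum>k=1..<N. int k * unit_vector N p k) = (\<Sum>k=1..<N. if k = p then int k else 0)"
    by (rule sum.cong) (use add.prems in \<open>auto simp: unit_vector_def\<close>)
  also have "\<dots> = int p"
    using add.prems by (subst sum.delta) auto
  finally show ?case using add by simp
qed (simp add: part_vector_def)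

lemma m_vector_eq:
  assumes lam: "\<forall>p\<in>#lam. 1 \<le> p \<and> p \<le> N - 1"
    and n: "n \<in> restricted N l lam \<sigma> L" and j: "j \<in> {1..<N}"
  shows "of_int (m_vector N l lam L n j) = cartan_inv_mult N
     (\<lambda>k. (2 * int L + int l) * unit_vector N (N - 1) k + part_vector N lam k - 2 * n k) j"
proof -
  have N: "2 \<le> N" using j by auto
  define p where "p = (\<Sum>\<^sub># lam)"
  define s where "s = (\<Sum>k=1..<N. int k * n k)"
  define t where "t = (\<Sum>k=1..<N. n k)"
  define v where
    "v = (\<lambda>k. (2 * int L + int l) * unit_vector N (N - 1) k + part_vector N lam k - 2 * n k)"
  have mult: "cartan_inv_mult N u i = of_int (\<Sum>k=1..<N. min (int i) (int k) * u k)
      - real i / real N * of_int (\<Sum>k=1..<N. int k * u k)" if "i \<in> {1..<N}" for u i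
  proof -
    have "cartan_inv_mult N u i = (\<Sum>k=1..<N. of_int (min (int i) (int k) * u k)
        - real i / real N * of_int (int k * u k))"
      unfolding cartan_inv_mult_def
      by (rule sum.cong) (use that in \<open>auto simp: cartan_inv_eq min_def algebra_simps\<close>)
    thus ?thesis by (simp add: sum_subtractf sum_distrib_left)
  qed
  obtain z :: int where z: "(real L + (real l - real p) / 2) / real N
      - cartan_inv_mult N n 1 = of_int z + real \<sigma> / 2"
    using n by (auto simp: restricted_def p_def)
  have "cartan_inv_mult N n 1 = of_int t - of_int s / real N"
  proof -
    have "(\<Sum>k=1..<N. min (int 1) (int k) * n k) = t"
      unfolding t_def by (rule sum.cong) auto
    thus ?thesis using N by (simp add: mult s_def)
  qed
  with z have "2 * real L + real l - real p + 2 * of_int s =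
      real N * (2 * of_int t + 2 * of_int z + real \<sigma>)"
    using N by (simp add: field_simps)
  hence "real_of_int (2 * int L + int l - int p + 2 * s) =
      real_of_int (int N * (2 * t + 2 * z + int \<sigma>))"
    by simp
  hence key: "2 * int L + int l - int p + 2 * s = int N * (2 * t + 2 * z + int \<sigma>)"
    by (simp only: of_int_eq_iff)
  have "(\<Sum>k=1..<N. int k * unit_vector N (N - 1) k) =
      (\<Sum>k=1..<N. if k = N - 1 then int k else 0)"
    by (rule sum.cong) (use N in \<open>auto simp: unit_vector_def\<close>)
  also have "\<dots> = int N - 1"
    using N by (subst sum.delta) auto
  finally have unit: "(\<Sum>k=1..<N. int k * unit_vector N (N - 1) k) = int N - 1" .
  have "(\<Sum>k=1..<N. int k * v k) =
      (2 * int L + int l) * (\<Sum>k=1..<N. int k * unit_vector N (N - 1) k)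
        + (\<Sum>k=1..<N. int k * part_vector N lam k) - 2 * s"
    by (simp add: v_def s_def sum_distrib_left sum.distrib sum_subtractf algebra_simps)
  also have "\<dots> = int N * (2 * int L + int l - (2 * t + 2 * z + int \<sigma>))"
    unfolding unit sum_part_vector[OF lam] p_def[symmetric] using key by (simp add: algebra_simps)
  finally have "cartan_inv_mult N v j = of_int ((\<Sum>k=1..<N. min (int j) (int k) * v k)
      - int j * (2 * int L + int l - (2 * t + 2 * z + int \<sigma>)))"
    using N by (simp add: mult[OF j])
  thus ?thesis
    unfolding m_vector_def v_def[symmetric] by (simp only: floor_of_int)
qed

definition eta_sum ::
    "nat \<Rightarrow> nat \<Rightarrow> nat multiset \<Rightarrow> nat \<Rightarrow> complex \<Rightarrow> complex \<Rightarrow> nat \<Rightarrow> complex" where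
  "eta_sum N l lam \<sigma> q w L = (\<Sum>\<^sub>\<infinity>\<eta>\<in>restricted N l lam \<sigma> L.
     qpow w (cartan_inv_form N \<eta> (\<lambda>k. \<eta> k - part_vector N lam k)) /
     (\<Prod>j=1..<N. qpoch q q (\<eta> j)))"

definition n_sum ::
    "nat \<Rightarrow> nat \<Rightarrow> nat multiset \<Rightarrow> nat \<Rightarrow> complex \<Rightarrow> complex \<Rightarrow> nat \<Rightarrow> complex" where
  "n_sum N l lam \<sigma> q w L = (\<Sum>\<^sub>\<infinity>n\<in>restricted N l lam \<sigma> L.
     qpow w (cartan_inv_form N n (\<lambda>k. n k - part_vector N lam k)) *
     (\<Prod>j=1..<N. qbinom q (m_vector N l lam L n j) (n j)))"

end

(* Write n and eta through a vector y of N integers whose sum is 2 L + l (resp. 2 r + l): the quadratic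
   form becomes a sum of squares, m_j becomes a partial sum of y, and n_j is half a difference of
   consecutive entries of y plus half a gap of a fixed weakly decreasing vector b. The core is the
   conjugate Bailey pair identity
     sum_L delta_L / ((q)_{L-r} (aq)_{L+r}) = gamma_r,
   proved for all b with nonnegative gaps. By the q-Pascal rule both sides satisfy the same recurrence
   in the gaps, and its solutions are determined by their limit when all gaps tend to infinity. In the
   limit the identity splits into N one-variable identities, which follow from the Durfee rectangle
   identity. The sums over L and r are exchanged by estimating the difference of the partial sums, as
   the double series need not converge absolutely. *)

theory Submission
  imports Defs
begin

section \<open>Shifted factorials\<close>

text \<open>The Bailey kernel \<open>1/((q)_(L-r) (aq)_(L+r))\<close> is, up to the constant factor
  \<open>(q)_l\<close>, equal to \<open>hermite (2 L + l) (2 r + l)\<close>. It depends on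
  \<open>y\<close> only through the total, so it can stand beside the binomials as one more factor
  of the summand. The recurrence alters \<open>b\<close>, so the identity for a single partition is
  not accessible alone, and every estimate has to be uniform in \<open>b\<close>. Two obstacles
  shape the proof. First, the q-Pascal rule fails when both entries are 0. At such a point one of
  the adjacent partial sums of \<open>y\<close> is negative, and the neighbouring binomial, or the
  kernel at the end of the chain, vanishes. Second, the recurrence links a vector only to vectors
  none of whose gaps are smaller, so no induction can start at small gaps. The solution is
  controlled from infinity instead: a contraction argument handles large gaps, and a descent then
  brings the bound on the gaps down to 0. Completing the square puts a 4 in the denominator of the
  exponents, hence the base \<open>p\<close> with \<open>p^4 = q\<close>.\<close>

lemma convergent_qpoch_inf:
  fixes q x :: complex
  assumes "norm q < 1"
  shows "convergent_prod (\<lambda>n. 1 - x * q ^ n)"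
proof -
  have "summable (\<lambda>n. norm (- (x * q ^ n)))"
    using assms by (simp add: norm_mult norm_power summable_mult)
  hence "abs_convergent_prod (\<lambda>n. 1 + - (x * q ^ n))"
    by (intro summable_imp_abs_convergent_prod) simp
  thus ?thesis by (simp add: abs_convergent_prod_imp_convergent_prod)
qed

lemma qpoch_inf_rec:
  assumes "norm q < 1"
  shows "qpoch_inf q x = (1 - x) * qpoch_inf q (x * q)"
proof -
  have "(\<lambda>n. 1 - x * q ^ n) has_prod ((\<Prod>k<1. 1 - x * q ^ k) * (\<Prod>k. 1 - x * q ^ (k + 1)))"
    by (rule has_prod_ignore_initial_segment'[OF convergent_qpoch_inf[OF assms]])
  thus ?thesis
    by (auto simp: qpoch_inf_def has_prod_iff mult.assoc)
qed

lemma qpoch_inf_nonzero: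
  assumes "norm q < 1" and "\<And>n. x * q ^ n \<noteq> 1"
  shows "qpoch_inf q x \<noteq> 0"
  unfolding qpoch_inf_def
  by (rule prodinf_nonzero[OF convergent_qpoch_inf[OF assms(1)]]) (simp add: assms(2) eq_commute[of 1])

lemma power_Suc_neq_1:
  fixes q :: complex
  assumes "norm q < 1"
  shows "q ^ Suc n \<noteq> 1"
proof
  assume *: "q ^ Suc n = 1"
  hence "q \<noteq> 0" by auto
  from * have "norm q ^ Suc n = 1" by (metis norm_one norm_power)
  moreover have "norm q ^ Suc n < 1" using assms \<open>q \<noteq> 0\<close> by (intro power_Suc_less_one) auto
  ultimately show False by simp
qed

text \<open>The base \<open>p\<close> is a fourth root of \<open>q\<close>. In the variables
  \<open>y\<close> the exponent of \<open>q\<close> is \<open>sqnorm N y / 4\<close> plus a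
  constant, so the summands carry integer powers of \<open>p\<close> and no branch of a root has to
  be chosen.\<close>

locale theta_base =
  fixes p :: complex
  assumes p_nonzero [simp]: "p \<noteq> 0" and norm_p_less: "norm p < 1"
begin

definition q :: complex where "q = p ^ 4"

lemma q_nonzero [simp]: "q \<noteq> 0" and norm_q_less: "norm q < 1"
  using norm_p_less power_Suc_less_one[of "norm p" 3] by (simp_all add: q_def norm_power numeral_eq_Suc norm_mult)

lemma q_powi: "q powi n = p powi (4 * n)"
  by (simp add: q_def power_int_mult)

text \<open>\<open>rq n\<close> is \<open>1/(q)\<^sub>n\<close>, and vanishes for \<open>n < 0\<close> because division by \<open>0\<close> gives \<open>0\<close>.\<close>

definition rq :: "int \<Rightarrow> complex" where "rq n = 1 / qpoch q q n"

definition rq_lim :: complex where "rq_lim = 1 / qpoch_inf q q"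

lemma qpoch_inf_q_nonzero: "qpoch_inf q (q ^ Suc n) \<noteq> 0"
proof (rule qpoch_inf_nonzero[OF norm_q_less])
  fix k show "q ^ Suc n * q ^ k \<noteq> 1"
    using power_Suc_neq_1[OF norm_q_less, of "n + k"] by (simp add: power_add mult.assoc)
qed

lemma rq_lim_nonzero: "rq_lim \<noteq> 0"
  using qpoch_inf_q_nonzero[of 0] by (simp add: rq_lim_def)

lemma rq_eq: "rq n = qpoch_inf q (q powi (n + 1)) * rq_lim"
proof -
  have "q * q powi n = q powi (n + 1)"
    by (simp add: power_int_add)
  thus ?thesis
    by (simp add: rq_def qpoch_def rq_lim_def)
qed

text \<open>For \<open>n < 0\<close> the infinite product of \<open>q^(n+1)\<close> contains the
  factor \<open>1 - q^0\<close>.\<close>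

lemma rq_neg: "rq n = 0" if "n < 0"
proof -
  have "qpoch_inf q (q powi (- int k)) = 0" for k
  proof (induction k)
    case 0
    show ?case using qpoch_inf_rec[OF norm_q_less, of 1] by simp
  next
    case (Suc k)
    have "q powi (- int (Suc k)) * q = q powi (- int k)"
      using power_int_add_1[of q "- int (Suc k)"] by simp
    thus ?case
      using qpoch_inf_rec[OF norm_q_less, of "q powi (- int (Suc k))"] Suc by simp
  qed
  from this[of "nat (- n - 1)"] that show ?thesis by (simp add: rq_eq add.commute)
qed

lemma rq_0 [simp]: "rq 0 = 1"
  using qpoch_inf_q_nonzero[of 0] by (simp add: rq_eq rq_lim_def)

text \<open>Valid for every integer: for \<open>n <= 0\<close> both sides are 0. The later
  recurrences can therefore run over all integers without boundary terms.\<close>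

lemma rq_rec: "rq (n - 1) = (1 - q powi n) * rq n"
proof -
  have "q powi n * q = q powi (n + 1)"
    by (simp add: power_int_add)
  thus ?thesis
    using qpoch_inf_rec[OF norm_q_less, of "q powi n"] by (simp add: rq_eq)
qed

lemma rq_nonzero: "rq n \<noteq> 0" if "n \<ge> 0"
  using qpoch_inf_q_nonzero[of "nat n"] rq_lim_nonzero that
  by (simp add: rq_eq power_int_def nat_add_distrib)

lemma rq_inverse_nat: "1 / rq (int n) = (\<Prod>k<n. 1 - q * q ^ k)"
proof (induction n)
  case (Suc n)
  have "rq (int n) = (1 - q ^ Suc n) * rq (int (Suc n))"
    using rq_rec[of "int (Suc n)"] power_int_of_nat[of q "Suc n"] by (simp del: power_int_of_nat)
  moreover have "1 - q ^ Suc n \<noteq> 0" using power_Suc_neq_1[OF norm_q_less, of n] by simp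
  ultimately have "1 / rq (int (Suc n)) = 1 / rq (int n) * (1 - q ^ Suc n)"
    using rq_nonzero[of "int (Suc n)"] by simp
  thus ?case using Suc by simp
qed simp

lemma rq_inverse_tendsto: "(\<lambda>n. 1 / rq (int n)) \<longlonglongrightarrow> 1 / rq_lim"
proof -
  have "(\<lambda>n. \<Prod>k\<in>{..<n}. 1 - q * q ^ k) \<longlonglongrightarrow> (\<Prod>k. 1 - q * q ^ k)"
    by (rule LIMSEQ_lessThan_iff_atMost[where f = "prod (\<lambda>k. 1 - q * q ^ k)", THEN iffD2,
          OF convergent_prod_LIMSEQ[OF convergent_qpoch_inf[OF norm_q_less]]])
  thus ?thesis by (simp only: rq_inverse_nat rq_lim_def qpoch_inf_def divide_divide_eq_right mult_1 div_by_1)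
qed

lemma rq_tendsto_nat: "(\<lambda>n. rq (int n)) \<longlonglongrightarrow> rq_lim"
proof -
  have "(\<lambda>n. inverse (1 / rq (int n))) \<longlonglongrightarrow> inverse (1 / rq_lim)"
    by (rule tendsto_inverse[OF rq_inverse_tendsto]) (simp add: rq_lim_nonzero)
  thus ?thesis by (simp only: inverse_divide div_by_1)
qed

lemma rq_tendsto:
  assumes "filterlim f at_top F"
  shows "((\<lambda>x. rq (f x)) \<longlongrightarrow> rq_lim) F"
proof -
  have "((\<lambda>x. rq (int (nat (f x)))) \<longlongrightarrow> rq_lim) F"
    by (rule filterlim_compose[OF rq_tendsto_nat filterlim_compose[OF filterlim_nat_sequentially assms]])
  moreover have "\<forall>\<^sub>F x in F. f x \<ge> 0"
    using assms unfolding filterlim_at_top by blast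
  hence "\<forall>\<^sub>F x in F. rq (int (nat (f x))) = rq (f x)"
    by eventually_elim simp
  ultimately show ?thesis by (rule Lim_transform_eventually)
qed

lemma rq_bounded: obtains C where "C \<ge> 1" "\<And>n. norm (rq n) \<le> C" "\<And>n. norm (1 / rq n) \<le> C"
proof -
  from convergent_imp_Bseq[OF convergentI[OF rq_tendsto_nat]]
  obtain C1 where C1: "\<And>n. norm (rq (int n)) \<le> C1" by (auto simp: Bseq_def)
  from convergent_imp_Bseq[OF convergentI[OF rq_inverse_tendsto]]
  obtain C2 where C2: "\<And>n. norm (1 / rq (int n)) \<le> C2" by (auto simp: Bseq_def)
  show thesis
  proof (rule that[of "max 1 (max C1 C2)"])
    fix n
    show "norm (rq n) \<le> max 1 (max C1 C2)"
      using C1[of "nat n"] by (cases "n \<ge> 0") (auto simp: rq_neg)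
    show "norm (1 / rq n) \<le> max 1 (max C1 C2)"
      using C2[of "nat n"] by (cases "n \<ge> 0") (auto simp: rq_neg)
  qed auto
qed

definition qb :: "int \<Rightarrow> int \<Rightarrow> complex" where "qb m n = rq m * rq n / rq (m + n)"

lemma qbinom_eq: "qbinom q m n = qb m n"
  by (cases "m \<ge> 0"; cases "n \<ge> 0") (auto simp: qbinom_def qb_def rq_neg, auto simp: rq_def)

lemma qb_neg: "qb m n = 0" if "m < 0 \<or> n < 0"
  using that by (auto simp: qb_def rq_neg)

text \<open>The excluded point is a genuine exception: there the left side is 1 and the right side
  0. For a negative entry all terms vanish.\<close>

lemma qb_pascal:
  assumes "(m, n) \<noteq> (0, 0)"
  shows "qb m n = q powi n * qb (m - 1) n + qb m (n - 1)"
proof (cases "m \<ge> 0 \<and> n \<ge> 0")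
  case True
  with assms have pos: "m + n > 0" by auto
  define a where "a = q powi m"
  define c where "c = q powi n"
  have ac: "q powi (m + n) = a * c" by (simp add: a_def c_def power_int_add)
  have sh: "m - 1 + n = m + n - 1" "m + (n - 1) = m + n - 1" by auto
  have "rq (m + n - 1) \<noteq> 0" "rq (m + n) \<noteq> 0" using pos rq_nonzero[of "m + n - 1"] rq_nonzero[of "m + n"] by simp_all
  moreover from this have "1 - a * c \<noteq> 0"
    using rq_rec[of "m + n"] by (auto simp: ac)
  ultimately show ?thesis
    unfolding qb_def sh rq_rec a_def[symmetric] c_def[symmetric] ac
    by (simp add: divide_simps) (simp add: algebra_simps)
next
  case False
  thus ?thesis by (auto simp: qb_neg)
qed

lemma qb_tendsto: "filterlim f at_top F \<Longrightarrow> ((\<lambda>x. qb m (f x)) \<longlongrightarrow> rq m) F"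
proof -
  assume f: "filterlim f at_top F"
  have "filterlim (\<lambda>x. m + f x) at_top F"
    unfolding filterlim_at_top
  proof
    fix Z
    have "\<forall>\<^sub>F x in F. Z - m \<le> f x" using f by (simp add: filterlim_at_top)
    thus "\<forall>\<^sub>F x in F. Z \<le> m + f x" by eventually_elim simp
  qed
  from tendsto_divide[OF tendsto_mult[OF tendsto_const[of "rq m"] rq_tendsto[OF f]] rq_tendsto[OF this]]
  show ?thesis using rq_lim_nonzero by (simp add: qb_def)
qed

end

section \<open>Dominated convergence and summability of theta series\<close>

lemma
  fixes f g :: "'a \<Rightarrow> complex"
  assumes "f summable_on A" "g summable_on A"
  shows summable_on_diff: "(\<lambda>x. f x - g x) summable_on A"
    and infsum_diff: "infsum (\<lambda>x. f x - g x) A = infsum f A - infsum g A"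
  using summable_on_add[of f A "\<lambda>x. - g x"] infsum_add[of f A "\<lambda>x. - g x"] assms
  by (simp_all add: infsum_uminus summable_on_uminus)

text \<open>Outside a suitable finite set the majorant bounds every sum by \<open>e / 8\<close>; on
  the finite set the convergence is termwise.\<close>

lemma infsum_dominated_tendsto:
  fixes f :: "nat \<Rightarrow> 'a \<Rightarrow> complex"
  assumes lim: "\<And>y. y \<in> A \<Longrightarrow> (\<lambda>k. f k y) \<longlonglongrightarrow> g y"
    and bound: "\<And>k y. y \<in> A \<Longrightarrow> norm (f k y) \<le> M y"
    and M: "M summable_on A"
  shows "(\<lambda>k. infsum (f k) A) \<longlonglongrightarrow> infsum g A"
proof (rule LIMSEQ_I)
  have g_bound: "norm (g y) \<le> M y" if "y \<in> A" for y
    by (rule LIMSEQ_le_const2[OF tendsto_norm[OF lim[OF that]]]) (use bound[OF that] in auto)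
  have M0: "M y \<ge> 0" if "y \<in> A" for y
    using g_bound[OF that] norm_ge_zero order_trans by blast
  have abs: "(\<lambda>y. norm (h y)) summable_on A" if "\<And>y. y \<in> A \<Longrightarrow> norm (h y) \<le> M y" for h :: "'a \<Rightarrow> complex"
    by (rule summable_on_comparison_test[OF M]) (use that in auto)
  have sum: "h summable_on A" if "\<And>y. y \<in> A \<Longrightarrow> norm (h y) \<le> M y" for h :: "'a \<Rightarrow> complex"
    by (rule abs_summable_summable[OF abs[OF that]])
  fix e :: real assume e: "e > 0"
  obtain F where F: "finite F" "F \<subseteq> A" "dist (sum M F) (infsum M A) \<le> e / 8"
    using infsum_finite_approximation[OF M, of "e / 8"] e by auto
  have MF: "M summable_on (A - F)" "M summable_on F"
    using summable_on_subset[OF M] F by auto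
  have "infsum M A = sum M F + infsum M (A - F)"
    using infsum_Un_disjoint[OF MF(2,1)] F by (simp add: Un_absorb1)
  hence tail: "infsum M (A - F) \<le> e / 8"
    using F(3) by (auto simp: dist_real_def)
  have split: "infsum h A = sum h F + infsum h (A - F)" and small: "norm (infsum h (A - F)) \<le> e / 8"
    if h: "\<And>y. y \<in> A \<Longrightarrow> norm (h y) \<le> M y" for h :: "'a \<Rightarrow> complex"
  proof -
    have 1: "h summable_on A" by (rule sum[OF h])
    show "infsum h A = sum h F + infsum h (A - F)"
      using infsum_Un_disjoint[of h F "A - F"] summable_on_subset[OF 1] F by (simp add: Un_absorb1)
    have "norm (infsum h (A - F)) \<le> infsum (\<lambda>y. norm (h y)) (A - F)"
      by (rule norm_infsum_bound, rule summable_on_subset[OF abs[OF h]]) auto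
    also have "\<dots> \<le> infsum M (A - F)"
      by (rule infsum_mono) (use summable_on_subset[OF abs[OF h], of "A - F"] MF h in auto)
    finally show "norm (infsum h (A - F)) \<le> e / 8" using tail by simp
  qed
  have "(\<lambda>k. sum (f k) F) \<longlonglongrightarrow> sum g F"
    by (rule tendsto_sum) (use F lim in auto)
  from LIMSEQ_D[OF this, of "e / 2"] e obtain k0 where
    k0: "\<And>k. k \<ge> k0 \<Longrightarrow> norm (sum (f k) F - sum g F) < e / 2" by auto
  show "\<exists>k0. \<forall>k\<ge>k0. norm (infsum (f k) A - infsum g A) < e"
  proof (intro exI allI impI)
    fix k assume "k \<ge> k0"
    have "infsum (f k) A - infsum g A =
        (sum (f k) F - sum g F) + (infsum (f k) (A - F) - infsum g (A - F))"
      using split[of "f k", OF bound] split[of g, OF g_bound] by simp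
    also have "norm \<dots> \<le> norm (sum (f k) F - sum g F)
        + (norm (infsum (f k) (A - F)) + norm (infsum g (A - F)))"
      by (intro order_trans[OF norm_triangle_ineq] add_mono norm_triangle_ineq4 order_refl)
    also have "\<dots> < e / 2 + (e / 8 + e / 8)"
      by (intro add_less_le_mono add_mono k0 small \<open>k \<ge> k0\<close> bound g_bound)
    finally show "norm (infsum (f k) A - infsum g A) < e" using e by simp
  qed
qed

lemma summable_on_powi_square:
  fixes r :: real
  assumes "0 \<le> r" "r < 1"
  shows "(\<lambda>k::int. r powi (k\<^sup>2)) summable_on UNIV"
proof -
  have nat: "(\<lambda>n::nat. r ^ n) summable_on UNIV"
    using assms by (intro summable_nonneg_imp_summable_on) auto
  have "(\<lambda>k. r powi \<bar>k\<bar>) summable_on range int"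
    by (subst summable_on_reindex) (use nat in \<open>auto simp: o_def\<close>)
  moreover have "(\<lambda>k. r powi \<bar>k\<bar>) summable_on range (\<lambda>n. - int n)"
    by (subst summable_on_reindex) (use nat in \<open>auto simp: o_def inj_def\<close>)
  ultimately have "(\<lambda>k. r powi \<bar>k\<bar>) summable_on (range int \<union> range (\<lambda>n. - int n))"
    by (rule summable_on_union)
  moreover have "range int \<union> range (\<lambda>n. - int n) = UNIV"
  proof (intro set_eqI iffI UNIV_I)
    fix k :: int show "k \<in> range int \<union> range (\<lambda>n. - int n)"
      by (cases k rule: int_cases2) auto
  qed
  ultimately have "(\<lambda>k. r powi \<bar>k\<bar>) summable_on UNIV" by simp
  thus ?thesis
  proof (rule summable_on_comparison_test)
    fix k :: int
    have "\<bar>k\<bar> \<le> k\<^sup>2"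
    proof (cases "k = 0")
      case False
      hence "\<bar>k\<bar> * 1 \<le> \<bar>k\<bar> * \<bar>k\<bar>" by (intro mult_left_mono) simp_all
      thus ?thesis by (simp only: mult_1_right power2_eq_square abs_mult_self)
    qed simp
    hence "r ^ nat (k\<^sup>2) \<le> r ^ nat \<bar>k\<bar>" using assms by (intro power_decreasing) auto
    thus "r powi (k\<^sup>2) \<le> r powi \<bar>k\<bar>" by (simp add: power_int_def)
  qed (use assms in auto)
qed

context theta_base
begin

abbreviation \<rho> :: real where "\<rho> \<equiv> norm p"

lemma summable_on_theta: "(\<lambda>k::int. \<rho> powi ((k - c)\<^sup>2)) summable_on A"
proof -
  have "(\<lambda>k::int. \<rho> powi (k\<^sup>2)) summable_on UNIV"
    using norm_p_less by (intro summable_on_powi_square) auto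
  hence "(\<lambda>k::int. \<rho> powi ((k - c)\<^sup>2)) summable_on UNIV"
    by (subst summable_on_reindex_bij_witness[where j = "\<lambda>k. k - c" and i = "\<lambda>k. k + c" and T = UNIV
          and h = "\<lambda>k. \<rho> powi (k\<^sup>2)"]) auto
  thus ?thesis by (rule summable_on_subset) auto
qed

lemma abs_summable_on_theta:
  assumes "\<And>k. norm (f k :: complex) \<le> C"
  shows "(\<lambda>k::int. norm (p powi ((k - c)\<^sup>2) * f k)) summable_on A"
proof (rule summable_on_comparison_test)
  show "(\<lambda>k. \<rho> powi ((k - c)\<^sup>2) * C) summable_on A"
    by (rule summable_on_cmult_left[OF summable_on_theta])
  fix k show "norm (p powi ((k - c)\<^sup>2) * f k) \<le> \<rho> powi ((k - c)\<^sup>2) * C"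
    using assms[of k] by (simp add: norm_mult norm_power_int mult_left_mono)
qed auto

lemmas summable_on_theta_mult = abs_summable_summable[OF abs_summable_on_theta]

text \<open>Up to the factor \<open>(q)\<^sub>m\<close> these are the coefficients of the continuous \<open>q\<close>-Hermite polynomials; the
  recurrence below is their three-term recurrence.\<close>

definition hermite :: "int \<Rightarrow> int \<Rightarrow> complex" where
  "hermite m s = (if even (m - s) then rq ((m - s) div 2) * rq ((m + s) div 2) else 0)"

text \<open>With \<open>k + 1 - s = 2 A\<close>, \<open>B = A + s\<close>, \<open>u = q^A\<close>
  and \<open>v = q^B\<close>, all four terms are multiples of \<open>rq A * rq B\<close>, and the
  identity is \<open>1 - u v = (1 - v) + (1 - u) - (1 - u) (1 - v)\<close>.\<close>

lemma hermite_rec: "(1 - q powi (k + 1)) * hermite (k + 1) s = hermite k (s - 1) + hermite k (s + 1) - hermite (k - 1) s"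
proof (cases "even (k + 1 - s)")
  case True
  then obtain A where "k + 1 - s = 2 * A" by (elim evenE)
  moreover define B where "B = A + s"
  ultimately have k: "k = A + B - 1" "s = B - A" by auto
  have *: "hermite (a + b) (b - a) = rq a * rq b" for a b
  proof -
    have "a + b - (b - a) = 2 * a" "a + b + (b - a) = 2 * b" by auto
    thus ?thesis by (simp add: hermite_def)
  qed
  have "hermite (k + 1) s = rq A * rq B" "hermite k (s - 1) = rq A * rq (B - 1)"
    "hermite k (s + 1) = rq (A - 1) * rq B" "hermite (k - 1) s = rq (A - 1) * rq (B - 1)"
    using *[of A B] *[of A "B - 1"] *[of "A - 1" B] *[of "A - 1" "B - 1"]
    by (simp_all add: k algebra_simps)
  moreover have "q powi (k + 1) = q powi A * q powi B" by (simp add: k power_int_add)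
  ultimately show ?thesis by (simp only: rq_rec) (simp add: algebra_simps)
next
  case False
  hence "odd (k + 1 - s)" "odd (k - (s - 1))" "odd (k - (s + 1))" "odd (k - 1 - s)" by auto
  thus ?thesis by (simp add: hermite_def)
qed

lemma hermite_neg: "hermite m s = 0" if "m < 0"
proof (cases "even (m - s)")
  case True
  then obtain a where "m - s = 2 * a" by (elim evenE)
  hence m: "m = s + 2 * a" by simp
  hence "a < 0 \<or> a + s < 0" using that by auto
  thus ?thesis using rq_neg[of a] rq_neg[of "a + s"] by (auto simp: hermite_def m add.commute)
qed (simp add: hermite_def)

lemma hermite_0: "hermite 0 s = of_bool (s = 0)"
proof (cases "s = 0")
  case False
  hence "s < 0 \<or> s > 0" by auto
  thus ?thesis by (auto simp: hermite_def rq_neg)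
qed (simp add: hermite_def)

lemma hermite_sym: "hermite m (- s) = hermite m s"
  by (auto simp: hermite_def)

lemma hermite_bounded: obtains C where "C \<ge> 1" "\<And>m s. norm (hermite m s) \<le> C"
proof -
  obtain C where C: "C \<ge> 1" "\<And>n. norm (rq n) \<le> C" by (rule rq_bounded) (rule that)
  show thesis
  proof (rule that[of "C * C"])
    fix m s show "norm (hermite m s) \<le> C * C"
      using C by (auto simp: hermite_def norm_mult intro!: mult_mono)
  next
    show "C * C \<ge> 1" using mult_mono[OF C(1) C(1)] C(1) by simp
  qed
qed

text \<open>Combinatorially this sorts partitions by their largest \<open>j\<close> by
  \<open>j + s\<close> rectangle. The proof is analytic: the sum \<open>W s\<close> satisfies a
  recurrence which forces it to be constant in \<open>s\<close>, and its limit for large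
  \<open>s\<close> is read off from the term \<open>j = 0\<close>. Negative \<open>j\<close>
  contribute nothing, because \<open>rq j = 0\<close>.\<close>

lemma durfee_rectangle:
  defines "a \<equiv> \<lambda>s j. q powi (j\<^sup>2 + j * s) * (rq j * rq (j + s))"
  assumes "s \<ge> 0"
  shows "((\<lambda>j. a s j) has_sum rq_lim) UNIV"
proof -
  obtain C where C: "C \<ge> 1" "\<And>n. norm (rq n) \<le> C" by (rule rq_bounded) (rule that)
  have bound: "norm (q powi (j\<^sup>2 + j * s) * (rq j * rq n)) \<le> C * C * \<rho> powi (j\<^sup>2)" if s: "s \<ge> 0" for s j n
  proof (cases "j \<ge> 0")
    case True
    have "0 \<le> j * s" "0 \<le> j\<^sup>2" using True s by auto
    hence "j\<^sup>2 \<le> 4 * (j\<^sup>2 + j * s)" by (simp only: distrib_left)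
    hence "\<rho> ^ nat (4 * (j\<^sup>2 + j * s)) \<le> \<rho> ^ nat (j\<^sup>2)"
      using norm_p_less by (intro power_decreasing nat_mono) auto
    hence "\<rho> powi (4 * (j\<^sup>2 + j * s)) \<le> \<rho> powi (j\<^sup>2)"
      using True s by (simp add: power_int_def)
    moreover have "norm (rq j) * norm (rq n) \<le> C * C"
      using C by (intro mult_mono) auto
    ultimately have "\<rho> powi (4 * (j\<^sup>2 + j * s)) * (norm (rq j) * norm (rq n)) \<le> \<rho> powi (j\<^sup>2) * (C * C)"
      by (rule mult_mono) simp_all
    thus ?thesis by (simp add: norm_mult q_powi norm_power_int mult.commute)
  qed (use C in \<open>simp add: rq_neg\<close>)
  have M: "(\<lambda>j. C * C * \<rho> powi (j\<^sup>2)) summable_on UNIV"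
    using summable_on_cmult_right[OF summable_on_theta[of 0]] by simp
  have summ: "(\<lambda>j. q powi (j\<^sup>2 + j * s) * (rq j * rq (n j))) summable_on UNIV" if "s \<ge> 0" for s n
    by (rule abs_summable_summable, rule summable_on_comparison_test[OF M]) (use bound[OF that] in auto)
  define W where "W s = infsum (a s) UNIV" for s
  have sumW: "a s summable_on UNIV" if "s \<ge> 0" for s
    unfolding a_def by (rule summ[OF that])
  have rec: "W s - W (s + 1) = q powi (s + 1) * (W (s + 2) - W (s + 1))" if s: "s \<ge> 0" for s
  proof -
    \<comment> \<open>The difference of \<open>a s j\<close> and \<open>a (s + 1) j\<close> splits
      into \<open>b j\<close> and a multiple of \<open>a (s + 1) j\<close>; shifting
      \<open>j\<close> by one turns \<open>b\<close> into a multiple of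
      \<open>a (s + 2)\<close>.\<close>
    define b where "b j = q powi (j\<^sup>2 + j * s) * (rq (j - 1) * rq (j + s + 1))" for j
    have b: "b summable_on UNIV" and b_shift: "infsum b UNIV = infsum (\<lambda>j. q powi (s + 1) * a (s + 2) j) UNIV"
    proof -
      have eq: "b (j + 1) = q powi (s + 1) * a (s + 2) j" for j
      proof -
        have "(j + 1)\<^sup>2 + (j + 1) * s = (s + 1) + (j\<^sup>2 + j * (s + 2))"
          by (simp add: power2_eq_square algebra_simps)
        hence "q powi ((j + 1)\<^sup>2 + (j + 1) * s) = q powi (s + 1) * q powi (j\<^sup>2 + j * (s + 2))"
          by (simp add: power_int_add)
        thus ?thesis by (simp add: b_def a_def ac_simps)
      qed
      have "(\<lambda>j. b (j + 1)) summable_on UNIV"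
        unfolding eq using s by (intro summable_on_cmult_right sumW) auto
      moreover have bij: "bij (\<lambda>j::int. j + 1)" by (rule bij_betwI[of _ _ _ "\<lambda>j. j - 1"]) auto
      ultimately show "b summable_on UNIV" by (simp only: summable_on_reindex_bij_betw[OF bij, of b])
      have "infsum b UNIV = infsum (\<lambda>j. b (j + 1)) UNIV"
        by (rule infsum_reindex_bij_betw[OF bij, symmetric])
      thus "infsum b UNIV = infsum (\<lambda>j. q powi (s + 1) * a (s + 2) j) UNIV" by (simp only: eq)
    qed
    have "a s j - a (s + 1) j = b j - q powi (s + 1) * a (s + 1) j" for j
    proof -
      define cx where "cx = q powi (j\<^sup>2 + j * s)"
      define cy where "cy = q powi j"
      define cz where "cz = q powi (s + 1)"
      have 1: "q powi (j\<^sup>2 + j * (s + 1)) = cx * cy"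
        by (simp add: cx_def cy_def power_int_add distrib_left mult.assoc)
      have 2: "j + (s + 1) = j + s + 1" by simp
      have "q powi (j + s + 1) = cy * cz"
        by (simp add: cy_def cz_def power_int_add)
      with rq_rec[of "j + s + 1"] have 3: "rq (j + s) = (1 - cy * cz) * rq (j + s + 1)"
        by (simp only: add_diff_cancel_right')
      show ?thesis
        unfolding a_def b_def 1 2 3 rq_rec[of j] cx_def[symmetric] cy_def[symmetric] cz_def[symmetric]
        by (simp only: algebra_simps)
    qed
    hence "infsum (\<lambda>j. a s j - a (s + 1) j) UNIV = infsum (\<lambda>j. b j - q powi (s + 1) * a (s + 1) j) UNIV"
      by simp
    also have "infsum (\<lambda>j. a s j - a (s + 1) j) UNIV = W s - W (s + 1)"
      unfolding W_def using s by (intro infsum_diff sumW) auto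
    also have "infsum (\<lambda>j. b j - q powi (s + 1) * a (s + 1) j) UNIV
        = q powi (s + 1) * W (s + 2) - q powi (s + 1) * W (s + 1)"
      using s by (subst infsum_diff)
        (auto intro!: summable_on_cmult_right sumW b simp: b_shift infsum_cmult_right' W_def)
    finally show ?thesis by (simp add: algebra_simps)
  qed
  define B where "B = 2 * infsum (\<lambda>j. C * C * \<rho> powi (j\<^sup>2)) UNIV"
  have W_bound: "norm (W s) \<le> B / 2" if "s \<ge> 0" for s
    unfolding W_def B_def a_def
    by (simp, rule norm_infsum_le[OF has_sum_infsum[OF summ[OF that]] has_sum_infsum[OF M]])
      (rule bound[OF that])
  \<comment> \<open>Each use of \<open>rec\<close> passes to the next difference and gains a factor
    of norm at most \<open>norm q\<close>. The exponent \<open>k\<close> is arbitrary, so the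
    difference is 0.\<close>
  have diff: "norm (W s - W (s + 1)) \<le> norm q ^ k * B" if "s \<ge> 0" for s k
    using that
  proof (induction k arbitrary: s)
    case 0
    have "norm (W s - W (s + 1)) \<le> B / 2 + B / 2"
      using 0 by (intro order_trans[OF norm_triangle_ineq4] add_mono W_bound) auto
    thus ?case by simp
  next
    case (Suc k)
    have "B \<ge> 0" using W_bound[of 0] norm_ge_zero[of "W 0"] by linarith
    have "norm (W s - W (s + 1)) = norm q powi (s + 1) * norm (W (s + 1) - W (s + 1 + 1))"
      using Suc.prems by (simp add: rec norm_mult norm_power_int norm_minus_commute add.assoc)
    also have "\<dots> \<le> norm q * (norm q ^ k * B)"
    proof (rule mult_mono)
      have "norm q ^ nat (s + 1) \<le> norm q ^ 1"
        using Suc.prems norm_q_less by (intro power_decreasing) auto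
      thus "norm q powi (s + 1) \<le> norm q" using Suc.prems by (simp add: power_int_def)
    qed (use Suc.IH[of "s + 1"] Suc.prems in \<open>auto simp: ac_simps\<close>)
    finally show ?case by (simp add: mult.assoc)
  qed
  have const: "W (s + 1) = W s" if "s \<ge> 0" for s
  proof -
    have "(\<lambda>k. norm q ^ k * B) \<longlonglongrightarrow> 0 * B"
      using norm_q_less by (intro tendsto_mult LIMSEQ_realpow_zero) auto
    hence "norm (W s - W (s + 1)) \<le> 0 * B"
      by (rule LIMSEQ_le_const) (use diff[OF that] in auto)
    thus ?thesis by simp
  qed
  have W_nat: "W (int k) = W 0" for k
    by (induction k) (use const in \<open>auto simp: add.commute[of 1]\<close>)
  \<comment> \<open>For \<open>j > 0\<close> the factor \<open>q^(j k)\<close> kills the term as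
    \<open>k\<close> grows; only \<open>rq 0 * rq k\<close> survives.\<close>
  have "(\<lambda>k. infsum (a (int k)) UNIV) \<longlonglongrightarrow> infsum (\<lambda>j::int. if j = 0 then rq_lim else 0) UNIV"
  proof (rule infsum_dominated_tendsto[OF _ _ M])
    fix j :: int
    show "(\<lambda>k. a (int k) j) \<longlonglongrightarrow> (if j = 0 then rq_lim else 0)"
    proof (cases "j \<le> 0")
      case True
      thus ?thesis using rq_tendsto_nat by (auto simp: a_def rq_neg)
    next
      case False
      have "(\<lambda>k. C * C * norm q ^ k) \<longlonglongrightarrow> C * C * 0"
        using norm_q_less by (intro tendsto_mult tendsto_const LIMSEQ_realpow_zero) auto
      hence "(\<lambda>k. C * C * norm q ^ k) \<longlonglongrightarrow> 0" by simp
      moreover have "\<forall>k. norm (a (int k) j) \<le> C * C * norm q ^ k"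
      proof
        fix k :: nat
        have "int k \<le> j * int k" using False by (simp add: mult_le_cancel_right1)
        moreover have "j\<^sup>2 \<ge> 0" by simp
        ultimately have "k \<le> nat (j\<^sup>2 + j * int k)" by linarith
        hence "norm q ^ nat (j\<^sup>2 + j * int k) \<le> norm q ^ k"
          using norm_q_less by (intro power_decreasing) auto
        hence "norm q powi (j\<^sup>2 + j * int k) \<le> norm q ^ k"
          using False by (simp add: power_int_def)
        moreover have "norm (rq j) * norm (rq (j + int k)) \<le> C * C"
          using C by (intro mult_mono) auto
        ultimately have "norm q powi (j\<^sup>2 + j * int k) * (norm (rq j) * norm (rq (j + int k))) \<le> norm q ^ k * (C * C)"
          by (rule mult_mono) simp_all
        thus "norm (a (int k) j) \<le> C * C * norm q ^ k"
          by (simp add: a_def norm_mult norm_power_int mult.commute)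
      qed
      ultimately have "(\<lambda>k. a (int k) j) \<longlonglongrightarrow> 0"
        by (rule Lim_null_comparison[OF always_eventually, rotated])
      thus ?thesis using False by simp
    qed
    show "norm (a (int k) j) \<le> C * C * \<rho> powi (j\<^sup>2)" for k
      unfolding a_def by (rule bound) simp
  qed
  moreover have "infsum (\<lambda>j::int. if j = 0 then rq_lim else 0) UNIV = rq_lim"
    by (subst infsum_cong_neutral[where T = "{0}" and g = "\<lambda>_. rq_lim"]) auto
  ultimately have "(\<lambda>k. W 0) \<longlonglongrightarrow> rq_lim" by (simp add: W_nat flip: W_def)
  hence "W 0 = rq_lim" by (simp add: LIMSEQ_const_iff)
  hence "W s = rq_lim" using W_nat[of "nat s"] \<open>s \<ge> 0\<close> by simp
  thus ?thesis using has_sum_infsum[OF sumW[OF \<open>s \<ge> 0\<close>]] by (simp add: W_def)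
qed


section \<open>The identity for infinite gaps\<close>

text \<open>Putting \<open>k = s + 2 j\<close> gives \<open>k^2 = s^2 + 4 (j^2 + j s)\<close>, so
  the sum is a Durfee rectangle sum times \<open>p^(s^2)\<close>. The symmetry in \<open>s\<close>
  covers negative \<open>s\<close>.\<close>

lemma infsum_hermite_theta: "(\<Sum>\<^sub>\<infinity>k. p powi (k\<^sup>2) * hermite k s) = rq_lim * p powi (s\<^sup>2)"
proof -
  have *: "(\<Sum>\<^sub>\<infinity>k. p powi (k\<^sup>2) * hermite k s) = rq_lim * p powi (s\<^sup>2)" if s: "s \<ge> 0" for s
  proof -
    have bij: "bij_betw (\<lambda>j. s + 2 * j) UNIV {k. even (k - s)}"
      by (rule bij_betwI[of _ _ _ "\<lambda>k. (k - s) div 2"]) auto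
    have "(\<Sum>\<^sub>\<infinity>k. p powi (k\<^sup>2) * hermite k s) = (\<Sum>\<^sub>\<infinity>k\<in>{k. even (k - s)}. p powi (k\<^sup>2) * hermite k s)"
      by (rule infsum_cong_neutral) (auto simp: hermite_def)
    also have "\<dots> = (\<Sum>\<^sub>\<infinity>j. p powi ((s + 2 * j)\<^sup>2) * hermite (s + 2 * j) s)"
      by (rule infsum_reindex_bij_betw[OF bij, symmetric])
    also have "\<dots> = (\<Sum>\<^sub>\<infinity>j. p powi (s\<^sup>2) * (q powi (j\<^sup>2 + j * s) * (rq j * rq (j + s))))"
    proof (rule infsum_cong)
      fix j :: int
      have "(s + 2 * j)\<^sup>2 = s\<^sup>2 + 4 * (j\<^sup>2 + j * s)"
        by (simp add: power2_eq_square algebra_simps)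
      hence "p powi ((s + 2 * j)\<^sup>2) = p powi (s\<^sup>2) * q powi (j\<^sup>2 + j * s)"
        by (simp only: q_powi) (simp add: power_int_add)
      moreover have "hermite (s + 2 * j) s = rq j * rq (j + s)"
      proof -
        have "s + 2 * j - s = 2 * j" "s + 2 * j + s = 2 * (j + s)" by auto
        thus ?thesis by (simp add: hermite_def add.commute)
      qed
      ultimately show "p powi ((s + 2 * j)\<^sup>2) * hermite (s + 2 * j) s
          = p powi (s\<^sup>2) * (q powi (j\<^sup>2 + j * s) * (rq j * rq (j + s)))"
        by (simp only: mult.assoc)
    qed
    also have "\<dots> = p powi (s\<^sup>2) * rq_lim"
      by (rule infsumI, rule has_sum_cmult_right, rule durfee_rectangle[OF s])
    finally show ?thesis by (simp add: mult.commute)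
  qed
  show ?thesis
    using *[of s] *[of "- s"] by (cases "s \<ge> 0") (auto simp: hermite_sym)
qed

text \<open>The three-term recurrence of \<open>hermite\<close>, used in the summation index for
  \<open>U\<close> and in \<open>m\<close> for \<open>V\<close>, gives recurrences in
  \<open>m\<close> that coincide once \<open>U\<close> is multiplied by \<open>rq m\<close> and
  \<open>V\<close> by \<open>rq_lim\<close>. They are of second order, so two consecutive values are
  carried along. At \<open>m = -1\<close> both sides are 0; at \<open>m = 0\<close> the claim is
  \<open>infsum_hermite_theta\<close>.\<close>

lemma hermite_step_aux:
  fixes m :: int
  defines "U \<equiv> \<lambda>m s. \<Sum>\<^sub>\<infinity>k. p powi ((k - m)\<^sup>2) * hermite k s"
    and "V \<equiv> \<lambda>m s. \<Sum>\<^sub>\<infinity>k. p powi (k\<^sup>2) * hermite m (s - k)"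
  shows "rq (int n - 1) * U (int n - 1) s = rq_lim * V (int n - 1) s \<and>
         rq (int n) * U (int n) s = rq_lim * V (int n) s"
proof (induction n arbitrary: s)
  case 0
  have "V 0 s = (\<Sum>\<^sub>\<infinity>k\<in>{s}. p powi (k\<^sup>2))"
    unfolding V_def by (rule infsum_cong_neutral) (auto simp: hermite_0)
  hence "rq 0 * U 0 s = rq_lim * V 0 s"
    using infsum_hermite_theta[of s] by (simp add: U_def)
  thus ?case by (simp add: rq_neg V_def hermite_neg)
next
  case (Suc n)
  obtain C where C: "C \<ge> 1" "\<And>m s. norm (hermite m s) \<le> C" by (rule hermite_bounded) (rule that)
  have sumU: "(\<lambda>k. p powi ((k - c)\<^sup>2) * hermite (k + d) s) summable_on UNIV" for c d s
    by (rule summable_on_theta_mult[of _ C]) (rule C)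
  have sumV: "(\<lambda>k. p powi (k\<^sup>2) * hermite m (s - k)) summable_on UNIV" for m s
    using summable_on_theta_mult[of "\<lambda>k. hermite m (s - k)" C 0] C by simp
  have Hrec: "hermite k (s - 1) + hermite k (s + 1) = (1 - q powi (k + 1)) * hermite (k + 1) s + hermite (k - 1) s" for k s
    by (simp add: hermite_rec)
  have shift: "infsum f UNIV = (\<Sum>\<^sub>\<infinity>k. f (k + c))" for f :: "int \<Rightarrow> complex" and c
    by (rule infsum_reindex_bij_witness[of _ "\<lambda>k. k + c" "\<lambda>k. k - c"]) auto
  have U: "U m (s - 1) + U m (s + 1) = U (m + 1) s + (1 - q powi m) * U (m - 1) s" for m s
  proof -
    define f where "f c d k = p powi ((k - c)\<^sup>2) * hermite (k + d) s" for c d k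
    have f: "f c d summable_on UNIV" for c d unfolding f_def by (rule sumU)
    have Uf: "U c s = infsum (f (c - d) d) UNIV" for c d
      unfolding U_def f_def by (subst shift[of _ d]) (simp add: algebra_simps)
    have "U m (s - 1) + U m (s + 1) =
        (\<Sum>\<^sub>\<infinity>k. p powi ((k - m)\<^sup>2) * hermite k (s - 1) + p powi ((k - m)\<^sup>2) * hermite k (s + 1))"
      unfolding U_def using sumU[of m 0] by (intro infsum_add[symmetric]) simp_all
    also have "\<dots> = (\<Sum>\<^sub>\<infinity>k. (f m 1 k - q powi m * f (m - 2) 1 k) + f m (- 1) k)"
    proof (rule infsum_cong)
      fix k
      \<comment> \<open>The factor \<open>q^(k+1)\<close> only moves the centre of the theta weight
        from \<open>m\<close> to \<open>m - 2\<close>, so the sum with this factor is again a value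
        of \<open>U\<close>.\<close>
      have "(k - m)\<^sup>2 + 4 * (k + 1) = (k - (m - 2))\<^sup>2 + 4 * m"
        by (simp add: power2_eq_square algebra_simps)
      hence "p powi ((k - m)\<^sup>2) * q powi (k + 1) = q powi m * p powi ((k - (m - 2))\<^sup>2)"
        unfolding q_powi by (simp add: power_int_add[symmetric] add.commute)
      hence e: "p powi ((k - m)\<^sup>2) * (q powi (k + 1) * X) = q powi m * (p powi ((k - (m - 2))\<^sup>2) * X)" for X
        by (simp only: mult.assoc[symmetric])
      show "p powi ((k - m)\<^sup>2) * hermite k (s - 1) + p powi ((k - m)\<^sup>2) * hermite k (s + 1)
          = (f m 1 k - q powi m * f (m - 2) 1 k) + f m (- 1) k"
        unfolding distrib_left[symmetric] Hrec f_def e[symmetric] by (simp add: algebra_simps)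
    qed
    also have "\<dots> = U (m + 1) s - q powi m * U (m - 1) s + U (m - 1) s"
      using Uf[of "m + 1" 1] Uf[of "m - 1" 1] Uf[of "m - 1" "- 1"]
      by (subst infsum_add, (intro summable_on_diff summable_on_cmult_right f)+, subst infsum_diff)
        (auto intro!: f summable_on_cmult_right simp: infsum_cmult_right')
    finally show ?thesis by (simp add: algebra_simps)
  qed
  have V: "V m (s - 1) + V m (s + 1) = (1 - q powi (m + 1)) * V (m + 1) s + V (m - 1) s" for m s
  proof -
    have "V m (s - 1) + V m (s + 1) =
        (\<Sum>\<^sub>\<infinity>k. p powi (k\<^sup>2) * hermite m (s - 1 - k) + p powi (k\<^sup>2) * hermite m (s + 1 - k))"
      unfolding V_def by (rule infsum_add[symmetric]) (rule sumV)+
    also have "\<dots> = (\<Sum>\<^sub>\<infinity>k. (1 - q powi (m + 1)) * (p powi (k\<^sup>2) * hermite (m + 1) (s - k)) + p powi (k\<^sup>2) * hermite (m - 1) (s - k))"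
    proof (rule infsum_cong)
      fix k
      have e: "s - 1 - k = (s - k) - 1" "s + 1 - k = (s - k) + 1" by auto
      show "p powi (k\<^sup>2) * hermite m (s - 1 - k) + p powi (k\<^sup>2) * hermite m (s + 1 - k) =
          (1 - q powi (m + 1)) * (p powi (k\<^sup>2) * hermite (m + 1) (s - k)) + p powi (k\<^sup>2) * hermite (m - 1) (s - k)"
        unfolding e distrib_left[symmetric] Hrec by (simp only: algebra_simps)
    qed
    also have "\<dots> = (1 - q powi (m + 1)) * V (m + 1) s + V (m - 1) s"
      by (subst infsum_add) (auto intro!: sumV summable_on_cmult_right simp: V_def infsum_cmult_right')
    finally show ?thesis .
  qed
  define m where "m = int n"
  define x where "x = 1 - q powi (m + 1)"
  have x: "x \<noteq> 0" using rq_rec[of "m + 1"] rq_nonzero[of m] by (auto simp: x_def m_def)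
  have rm: "rq m = x * rq (m + 1)" using rq_rec[of "m + 1"] by (simp add: x_def)
  have IH: "rq (m - 1) * U (m - 1) s = rq_lim * V (m - 1) s" "rq m * U m s = rq_lim * V m s" for s
    using Suc[of s] by (auto simp: m_def)
  have Um: "U (m + 1) s = U m (s - 1) + U m (s + 1) - (1 - q powi m) * U (m - 1) s"
    by (simp add: U)
  have "x * (rq (m + 1) * U (m + 1) s)
      = rq m * U m (s - 1) + rq m * U m (s + 1) - (1 - q powi m) * rq m * U (m - 1) s"
    unfolding Um rm by (simp only: algebra_simps)
  also have "\<dots> = rq_lim * (V m (s - 1) + V m (s + 1) - V (m - 1) s)"
    unfolding IH rq_rec[of m, symmetric] by (simp add: algebra_simps)
  also have "\<dots> = x * (rq_lim * V (m + 1) s)"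
    unfolding V x_def by (simp add: algebra_simps)
  finally have "rq (m + 1) * U (m + 1) s = rq_lim * V (m + 1) s" using x by simp
  thus ?case using IH(2)[of s] by (simp add: m_def add.commute)
qed

text \<open>Sums out one coordinate \<open>k\<close>: the factor \<open>rq m\<close> is traded for
  \<open>rq_lim\<close>, and \<open>k\<close> moves from the upper index of \<open>hermite\<close>
  to the lower one. The parity condition on \<open>k\<close> costs nothing, since
  \<open>hermite\<close> vanishes on one parity class: either the condition removes only zero terms
  or it leaves only zero terms.\<close>

lemma hermite_step:
  fixes b :: int
  shows "rq m * (\<Sum>\<^sub>\<infinity>k\<in>{k. even (k - b)}. p powi (k\<^sup>2) * hermite (m + k) s) =
    rq_lim * (\<Sum>\<^sub>\<infinity>k\<in>{k. even (k - b)}. p powi (k\<^sup>2) * hermite m (s - k))"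
proof (cases "m < 0")
  case True
  thus ?thesis by (simp add: rq_neg hermite_neg)
next
  case False
  have "(\<Sum>\<^sub>\<infinity>k. p powi ((k - m)\<^sup>2) * hermite k s) = (\<Sum>\<^sub>\<infinity>k. p powi (k\<^sup>2) * hermite (m + k) s)"
    by (rule infsum_reindex_bij_witness[of _ "\<lambda>k. m + k" "\<lambda>k. k - m"]) auto
  hence eq: "rq m * (\<Sum>\<^sub>\<infinity>k. p powi (k\<^sup>2) * hermite (m + k) s) = rq_lim * (\<Sum>\<^sub>\<infinity>k. p powi (k\<^sup>2) * hermite m (s - k))"
    using hermite_step_aux[of "nat m" s] False by simp
  show ?thesis
  proof (cases "even (m + s + b)")
    case True
    have "(\<Sum>\<^sub>\<infinity>k\<in>{k. even (k - b)}. p powi (k\<^sup>2) * hermite (m + k) s) = (\<Sum>\<^sub>\<infinity>k. p powi (k\<^sup>2) * hermite (m + k) s)"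
      "(\<Sum>\<^sub>\<infinity>k\<in>{k. even (k - b)}. p powi (k\<^sup>2) * hermite m (s - k)) = (\<Sum>\<^sub>\<infinity>k. p powi (k\<^sup>2) * hermite m (s - k))"
      by (rule infsum_cong_neutral; use True in \<open>auto simp: hermite_def\<close>)+
    thus ?thesis by (simp only: eq)
  next
    case False
    have "p powi (k\<^sup>2) * hermite (m + k) s = 0 \<and> p powi (k\<^sup>2) * hermite m (s - k) = 0" if "k \<in> {k. even (k - b)}" for k
      using that False by (auto simp: hermite_def)
    hence "(\<Sum>\<^sub>\<infinity>k\<in>{k. even (k - b)}. p powi (k\<^sup>2) * hermite (m + k) s) = 0"
      "(\<Sum>\<^sub>\<infinity>k\<in>{k. even (k - b)}. p powi (k\<^sup>2) * hermite m (s - k)) = 0"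
      by (intro infsum_0; blast)+
    thus ?thesis by simp
  qed
qed

section \<open>Theta sums over integer vectors with prescribed parities\<close>

definition pvecs :: "nat \<Rightarrow> (nat \<Rightarrow> int) \<Rightarrow> (nat \<Rightarrow> int) set" where
  "pvecs N b = {y. (\<forall>i\<ge>N. y i = 0) \<and> (\<forall>i<N. even (y i - b i))}"

definition sqnorm :: "nat \<Rightarrow> (nat \<Rightarrow> int) \<Rightarrow> int" where
  "sqnorm N y = (\<Sum>i<N. (y i)\<^sup>2)"

lemma pvecs_0: "pvecs 0 b = {\<lambda>_. 0}"
  by (auto simp: pvecs_def)

lemma bij_pvecs_Suc: "bij_betw (\<lambda>(y, k). y(N := k)) (pvecs N b \<times> {k. even (k - b N)}) (pvecs (Suc N) b)"
  by (rule bij_betwI[of _ _ _ "\<lambda>y. (y(N := 0), y N)"]) (auto simp: pvecs_def less_Suc_eq)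

lemma sum_upd: "(\<Sum>i<j. (y(N := k)) i) = (\<Sum>i<j. y i)" if "j \<le> N" for y :: "nat \<Rightarrow> int"
  by (rule sum.cong) (use that in auto)

lemma sq_upd: "sqnorm (Suc N) (y(N := k)) = sqnorm N y + k\<^sup>2"
proof -
  have "(\<Sum>i<N. ((y(N := k)) i)\<^sup>2) = (\<Sum>i<N. (y i)\<^sup>2)"
    by (rule sum.cong) auto
  thus ?thesis by (simp add: sqnorm_def)
qed

lemma summable_on_sq: "(\<lambda>y. \<rho> powi sqnorm N y) summable_on pvecs N b"
proof (induction N)
  case 0
  show ?case by (simp add: pvecs_0)
next
  case (Suc N)
  have th: "(\<lambda>k::int. \<rho> powi (k\<^sup>2)) summable_on {k. even (k - b N)}"
    using summable_on_theta[of 0] by simp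
  let ?P = "{k. even (k - b N)}"
  have "(\<lambda>yk. norm (\<rho> powi sqnorm N (fst yk) * \<rho> powi ((snd yk)\<^sup>2))) summable_on pvecs N b \<times> ?P"
    by (rule Infinite_Sum.abs_summable_on_Sigma_iff[THEN iffD2])
      (use Suc th in \<open>auto simp: abs_mult infsum_cmult_right' intro: summable_on_cmult_right summable_on_cmult_left\<close>)
  hence "(\<lambda>(y, k). \<rho> powi sqnorm N y * \<rho> powi (k\<^sup>2)) summable_on pvecs N b \<times> ?P"
    by (simp add: case_prod_unfold abs_mult)
  also have "?this \<longleftrightarrow> (\<lambda>yk. \<rho> powi sqnorm (Suc N) ((\<lambda>(y, k). y(N := k)) yk)) summable_on pvecs N b \<times> {k. even (k - b N)}"
    by (intro summable_on_cong) (auto simp: sq_upd power_int_add)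
  also have "\<dots> \<longleftrightarrow> (\<lambda>y. \<rho> powi sqnorm (Suc N) y) summable_on pvecs (Suc N) b"
    by (rule summable_on_reindex_bij_betw[OF bij_pvecs_Suc])
  finally show ?case .
qed

lemma abs_summable_on_sq:
  assumes "\<And>y. y \<in> A \<Longrightarrow> norm (f y :: complex) \<le> C" "A \<subseteq> pvecs N b"
  shows "(\<lambda>y. norm (p powi sqnorm N y * f y)) summable_on A"
proof (rule summable_on_comparison_test)
  show "(\<lambda>y. \<rho> powi sqnorm N y * C) summable_on A"
    by (rule summable_on_cmult_left[OF summable_on_subset[OF summable_on_sq assms(2)]])
  fix y assume "y \<in> A"
  thus "norm (p powi sqnorm N y * f y) \<le> \<rho> powi sqnorm N y * C"
    using assms(1)[of y] by (simp add: norm_mult norm_power_int mult_left_mono)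
qed auto

lemmas summable_on_sq_mult = abs_summable_summable[OF abs_summable_on_sq]

text \<open>Fubini for the last coordinate, with absolute convergence supplied by the bound on
  \<open>f\<close>. Both orders are needed: \<open>hermite_step\<close> acts on an inner sum over
  \<open>k\<close>, the induction hypothesis of \<open>limit_identity\<close> on an inner sum over
  the shorter vector.\<close>

lemma infsum_pvecs_Suc:
  fixes N :: nat and f :: "(nat \<Rightarrow> int) \<Rightarrow> complex"
  assumes "\<And>y. norm (f y) \<le> C"
  defines "g \<equiv> \<lambda>y k. p powi sqnorm N y * (p powi (k\<^sup>2) * f (y(N := k)))"
  shows "(\<Sum>\<^sub>\<infinity>y\<in>pvecs (Suc N) b. p powi sqnorm (Suc N) y * f y) =
      (\<Sum>\<^sub>\<infinity>y\<in>pvecs N b. \<Sum>\<^sub>\<infinity>k\<in>{k. even (k - b N)}. g y k)"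
    and "(\<Sum>\<^sub>\<infinity>y\<in>pvecs (Suc N) b. p powi sqnorm (Suc N) y * f y) =
      (\<Sum>\<^sub>\<infinity>k\<in>{k. even (k - b N)}. \<Sum>\<^sub>\<infinity>y\<in>pvecs N b. g y k)"
proof -
  let ?u = "\<lambda>yk. (\<lambda>(y, k). y(N := k)) yk"
  have eq: "p powi sqnorm (Suc N) (?u yk) * f (?u yk) = (case yk of (y, k) \<Rightarrow> g y k)" for yk
    by (cases yk) (simp add: sq_upd power_int_add g_def mult.assoc)
  have "(\<lambda>y. p powi sqnorm (Suc N) y * f y) summable_on pvecs (Suc N) b"
    by (rule summable_on_sq_mult[OF assms(1)]) auto
  hence summ: "(\<lambda>(y, k). g y k) summable_on pvecs N b \<times> {k. even (k - b N)}"
    by (subst (asm) summable_on_reindex_bij_betw[OF bij_pvecs_Suc, symmetric]) (simp only: eq case_prod_eta)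
  have "(\<Sum>\<^sub>\<infinity>y\<in>pvecs (Suc N) b. p powi sqnorm (Suc N) y * f y) = infsum (\<lambda>(y, k). g y k) (pvecs N b \<times> {k. even (k - b N)})"
    by (subst infsum_reindex_bij_betw[OF bij_pvecs_Suc, symmetric]) (simp only: eq case_prod_eta)
  also have "\<dots> = (\<Sum>\<^sub>\<infinity>y\<in>pvecs N b. \<Sum>\<^sub>\<infinity>k\<in>{k. even (k - b N)}. g y k)"
    by (rule infsum_Sigma'_banach[OF summ, symmetric])
  finally show 1: "(\<Sum>\<^sub>\<infinity>y\<in>pvecs (Suc N) b. p powi sqnorm (Suc N) y * f y) =
      (\<Sum>\<^sub>\<infinity>y\<in>pvecs N b. \<Sum>\<^sub>\<infinity>k\<in>{k. even (k - b N)}. g y k)" .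
  show "(\<Sum>\<^sub>\<infinity>y\<in>pvecs (Suc N) b. p powi sqnorm (Suc N) y * f y) =
      (\<Sum>\<^sub>\<infinity>k\<in>{k. even (k - b N)}. \<Sum>\<^sub>\<infinity>y\<in>pvecs N b. g y k)"
    unfolding 1 by (rule infsum_swap_banach[OF summ])
qed

text \<open>Induction on \<open>N\<close>. \<open>hermite_step\<close> sums out the last coordinate
  \<open>k\<close>; what remains is a factor \<open>rq_lim\<close> and the same expression for the
  shorter vector with \<open>s - k\<close> in place of \<open>s\<close>, which is why
  \<open>s\<close> is arbitrary in the induction.\<close>

lemma limit_identity:
  "(\<Sum>\<^sub>\<infinity>y\<in>pvecs N b. p powi sqnorm N y * ((\<Prod>j<N. rq (\<Sum>i<j. y i)) * hermite (\<Sum>i<N. y i) s)) =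
    rq_lim ^ N * (\<Sum>\<^sub>\<infinity>y\<in>pvecs N b. p powi sqnorm N y * of_bool ((\<Sum>i<N. y i) = s))"
proof (induction N arbitrary: s)
  case 0
  show ?case by (auto simp: pvecs_0 hermite_0)
next
  case (Suc N)
  let ?P = "{k. even (k - b N)}"
  obtain C where C: "C \<ge> 1" "\<And>m s. norm (hermite m s) \<le> C" by (rule hermite_bounded) (rule that)
  obtain D where D: "D \<ge> 1" "\<And>n. norm (rq n) \<le> D" by (rule rq_bounded) (rule that)
  define F where "F N y = (\<Prod>j<N. rq (\<Sum>i<j. y i))" for N and y :: "nat \<Rightarrow> int"
  define m where "m y = (\<Sum>i<N. y i)" for y :: "nat \<Rightarrow> int"
  have F_bound: "norm (F N y) \<le> D ^ N" for N y
    unfolding F_def prod_norm[symmetric] using prod_mono[of "{..<N}" "\<lambda>j. norm (rq (\<Sum>i<j. y i))" "\<lambda>_. D"] D(2) by simp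
  have FH_bound: "norm (F N y * hermite x s) \<le> D ^ N * C" for N y x s
    unfolding norm_mult using F_bound C D by (intro mult_mono) auto
  have F_upd: "F (Suc N) (y(N := k)) = F N y * rq (m y)" for y k
  proof -
    have "F N (y(N := k)) = F N y"
      unfolding F_def by (rule prod.cong) (auto simp: sum_upd less_imp_le)
    moreover have "F (Suc N) (y(N := k)) = F N (y(N := k)) * rq (\<Sum>i<N. (y(N := k)) i)"
      by (simp only: F_def prod.lessThan_Suc)
    ultimately show ?thesis by (simp only: sum_upd[OF order_refl] m_def)
  qed
  have m_upd: "(\<Sum>i<Suc N. (y(N := k)) i) = m y + k" for y k
    by (simp only: sum.lessThan_Suc sum_upd[OF order_refl] m_def) simp
  have "(\<Sum>\<^sub>\<infinity>y\<in>pvecs (Suc N) b. p powi sqnorm (Suc N) y * (F (Suc N) y * hermite (\<Sum>i<Suc N. y i) s)) =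
      (\<Sum>\<^sub>\<infinity>y\<in>pvecs N b. \<Sum>\<^sub>\<infinity>k\<in>?P. p powi sqnorm N y * (p powi (k\<^sup>2) * (F N y * rq (m y) * hermite (m y + k) s)))"
    unfolding infsum_pvecs_Suc(1)[of "\<lambda>y. F (Suc N) y * hermite (\<Sum>i<Suc N. y i) s", OF FH_bound] F_upd m_upd ..
  also have "\<dots> = (\<Sum>\<^sub>\<infinity>y\<in>pvecs N b. \<Sum>\<^sub>\<infinity>k\<in>?P. p powi sqnorm N y * (p powi (k\<^sup>2) * (rq_lim * (F N y * hermite (m y) (s - k)))))"
  proof (rule infsum_cong)
    fix y
    have "(\<Sum>\<^sub>\<infinity>k\<in>?P. p powi sqnorm N y * (p powi (k\<^sup>2) * (F N y * rq (m y) * hermite (m y + k) s)))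
        = (\<Sum>\<^sub>\<infinity>k\<in>?P. p powi sqnorm N y * F N y * rq (m y) * (p powi (k\<^sup>2) * hermite (m y + k) s))"
      by (simp add: ac_simps)
    also have "\<dots> = p powi sqnorm N y * F N y * (rq (m y) * (\<Sum>\<^sub>\<infinity>k\<in>?P. p powi (k\<^sup>2) * hermite (m y + k) s))"
      by (simp only: infsum_cmult_right' mult.assoc)
    also have "\<dots> = p powi sqnorm N y * F N y * rq_lim * (\<Sum>\<^sub>\<infinity>k\<in>?P. p powi (k\<^sup>2) * hermite (m y) (s - k))"
      by (simp only: hermite_step mult.assoc)
    also have "\<dots> = (\<Sum>\<^sub>\<infinity>k\<in>?P. p powi sqnorm N y * F N y * rq_lim * (p powi (k\<^sup>2) * hermite (m y) (s - k)))"
      by (simp only: infsum_cmult_right')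
    also have "\<dots> = (\<Sum>\<^sub>\<infinity>k\<in>?P. p powi sqnorm N y * (p powi (k\<^sup>2) * (rq_lim * (F N y * hermite (m y) (s - k)))))"
      by (simp add: ac_simps)
    finally show "(\<Sum>\<^sub>\<infinity>k\<in>?P. p powi sqnorm N y * (p powi (k\<^sup>2) * (F N y * rq (m y) * hermite (m y + k) s)))
        = (\<Sum>\<^sub>\<infinity>k\<in>?P. p powi sqnorm N y * (p powi (k\<^sup>2) * (rq_lim * (F N y * hermite (m y) (s - k)))))" .
  qed
  also have "\<dots> = (\<Sum>\<^sub>\<infinity>k\<in>?P. \<Sum>\<^sub>\<infinity>y\<in>pvecs N b. p powi sqnorm N y * (p powi (k\<^sup>2) * (rq_lim * (F N y * hermite (m y) (s - k)))))"
  proof -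
    \<comment> \<open>The entry \<open>y N\<close> stands for \<open>k\<close>. Thus both orders of
      summation come from a single function on the longer vectors, and comparing them gives the
      swap.\<close>
    define f where "f y = rq_lim * (F N y * hermite (m y) (s - y N))" for y
    have fu: "f (y(N := k)) = rq_lim * (F N y * hermite (m y) (s - k))" for y k
    proof -
      have "F N (y(N := k)) = F N y"
        unfolding F_def by (rule prod.cong) (auto simp: sum_upd less_imp_le)
      thus ?thesis by (simp add: f_def m_def)
    qed
    have "norm (f y) \<le> norm rq_lim * (D ^ N * C)" for y
      unfolding f_def norm_mult[of rq_lim] by (intro mult_left_mono FH_bound) auto
    from infsum_pvecs_Suc[of f, OF this, of N b] show ?thesis unfolding fu by simp
  qed
  also have "\<dots> = (\<Sum>\<^sub>\<infinity>k\<in>?P. rq_lim * p powi (k\<^sup>2) * (\<Sum>\<^sub>\<infinity>y\<in>pvecs N b. p powi sqnorm N y * (F N y * hermite (m y) (s - k))))"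
    by (simp only: infsum_cmult_right'[symmetric]) (simp add: ac_simps)
  also have "\<dots> = (\<Sum>\<^sub>\<infinity>k\<in>?P. rq_lim * p powi (k\<^sup>2) * (rq_lim ^ N * (\<Sum>\<^sub>\<infinity>y\<in>pvecs N b. p powi sqnorm N y * of_bool (m y = s - k))))"
    unfolding F_def m_def Suc ..
  also have "\<dots> = rq_lim ^ Suc N * (\<Sum>\<^sub>\<infinity>k\<in>?P. \<Sum>\<^sub>\<infinity>y\<in>pvecs N b. p powi sqnorm N y * (p powi (k\<^sup>2) * of_bool (m y + k = s)))"
    by (simp only: infsum_cmult_right'[symmetric] power_Suc) (simp add: ac_simps eq_diff_eq)
  also have "(\<Sum>\<^sub>\<infinity>k\<in>?P. \<Sum>\<^sub>\<infinity>y\<in>pvecs N b. p powi sqnorm N y * (p powi (k\<^sup>2) * of_bool (m y + k = s))) =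
      (\<Sum>\<^sub>\<infinity>y\<in>pvecs (Suc N) b. p powi sqnorm (Suc N) y * of_bool ((\<Sum>i<Suc N. y i) = s))"
    by (subst infsum_pvecs_Suc(2)[of _ 1]) (auto simp only: m_upd, auto)
  finally show ?case unfolding F_def .
qed

end

section \<open>A recurrence in the gaps of a vector\<close>

text \<open>Only the gap at \<open>j\<close> changes, by \<open>2 k\<close>. The even amount keeps
  the parities, hence the index set of the sums.\<close>

definition raise_gap :: "nat \<Rightarrow> nat \<Rightarrow> (nat \<Rightarrow> int) \<Rightarrow> nat \<Rightarrow> int" where
  "raise_gap k j b = (\<lambda>i. if i < j then b i + 2 * int k else b i)"

text \<open>Moving a unit across position \<open>j\<close> lowers the partial sum at
  \<open>j\<close> by one and keeps all others: this is the shift of the upper parameter in the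
  q-Pascal rule. Applied after \<open>raise_gap 1 j\<close>, it restores the gap at \<open>j\<close>
  and widens the two adjacent gaps by one.\<close>

definition transfer :: "nat \<Rightarrow> (nat \<Rightarrow> int) \<Rightarrow> nat \<Rightarrow> int" where
  "transfer j y = y(j - 1 := y (j - 1) - 1, j := y j + 1)"

definition gaps_ge :: "nat \<Rightarrow> int \<Rightarrow> (nat \<Rightarrow> int) \<Rightarrow> bool" where
  "gaps_ge N K b \<longleftrightarrow> (\<forall>j\<in>{1..<N}. b (j - 1) - b j \<ge> K)"

lemma raise_gap_gap:
  assumes "i \<ge> 1"
  shows "raise_gap k j b (i - 1) - raise_gap k j b i = b (i - 1) - b i + (if i = j then 2 * int k else 0)"
  using assms by (auto simp: raise_gap_def)

lemma transfer_raise_gap: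
  assumes "i \<ge> 1" "j \<ge> 1"
  shows "transfer j (raise_gap 1 j b) (i - 1) - transfer j (raise_gap 1 j b) i =
    b (i - 1) - b i + (if i + 1 = j \<or> i = j + 1 then 1 else 0)"
proof -
  obtain i' j' where "i = Suc i'" "j = Suc j'" using assms by (cases i; cases j) auto
  thus ?thesis by (simp add: raise_gap_def transfer_def)
qed

lemma gaps_ge_up: "gaps_ge N K b \<Longrightarrow> gaps_ge N K (raise_gap k j b)"
  by (simp add: gaps_ge_def raise_gap_gap add_increasing2 del: One_nat_def)

lemma gaps_ge_transfer: "gaps_ge N K b \<Longrightarrow> j \<ge> 1 \<Longrightarrow> gaps_ge N K (transfer j (raise_gap 1 j b))"
  by (simp add: gaps_ge_def transfer_raise_gap add_increasing2 del: One_nat_def)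

lemma raise_gap_Suc: "raise_gap 1 j (raise_gap k j b) = raise_gap (Suc k) j b"
  by (auto simp: raise_gap_def)

text \<open>Uniqueness for the recurrence, to be applied to the difference of the two sides of the
  identity. No vector in the recurrence has a smaller gap than \<open>b\<close>, so the only
  starting point is the limit at infinity. The power of \<open>p\<close> in front of one term is
  small for large gaps, which permits a contraction; at small gaps it is still less than 1 in norm,
  which drives the descent.\<close>

lemma eq_zero_of_gap_recurrence:
  fixes D :: "(nat \<Rightarrow> int) \<Rightarrow> complex" and p :: complex
  assumes p: "norm p < 1"
    and rec: "\<And>b j. gaps_ge N 0 b \<Longrightarrow> j \<in> {1..<N} \<Longrightarrow>
      D (raise_gap 1 j b) = p powi (2 * (b (j - 1) - b j + 1)) * D (transfer j (raise_gap 1 j b)) + D b"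
    and bound: "\<And>b. norm (D b) \<le> B"
    and lim: "\<And>b. (\<lambda>k. D (\<lambda>i. b i + 2 * int k * int (N - 1 - i))) \<longlonglongrightarrow> 0"
    and b: "gaps_ge N 0 b"
  shows "D b = 0"
proof -
  define \<theta> where "\<theta> = norm p ^ 2"
  have \<theta>: "0 \<le> \<theta>" "\<theta> < 1"
    using p power_strict_mono[of "norm p" 1 2] by (auto simp: \<theta>_def)
  have zeroI: "z = 0" if "\<And>n. norm z \<le> r ^ n * B" "0 \<le> r" "r < 1" for z :: complex and r
  proof -
    have "(\<lambda>n. r ^ n * B) \<longlonglongrightarrow> 0 * B"
      using that by (intro tendsto_mult LIMSEQ_realpow_zero) auto
    hence "norm z \<le> 0 * B" by (rule LIMSEQ_le_const) (use that in auto)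
    thus ?thesis by simp
  qed
  have step: "norm (D b - D (raise_gap 1 j b)) = \<theta> ^ nat (b (j - 1) - b j + 1) * norm (D (transfer j (raise_gap 1 j b)))"
    if "gaps_ge N 0 b" "j \<in> {1..<N}" for b j
  proof -
    have g: "b (j - 1) - b j \<ge> 0" using that by (auto simp: gaps_ge_def)
    have "D b - D (raise_gap 1 j b) = - (p powi (2 * (b (j - 1) - b j + 1)) * D (transfer j (raise_gap 1 j b)))"
      using rec[OF that] by simp
    moreover have "norm p powi (2 * (b (j - 1) - b j + 1)) = \<theta> ^ nat (b (j - 1) - b j + 1)"
      using g by (simp add: \<theta>_def power_int_def nat_mult_distrib power_mult del: distrib_left_numeral)
    ultimately show ?thesis by (simp add: norm_mult norm_power_int)
  qed
  have gaps_mono: "gaps_ge N K b \<Longrightarrow> 0 \<le> K \<Longrightarrow> gaps_ge N 0 b" for K b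
    by (force simp: gaps_ge_def)

  text \<open>For large gaps the second term of the recurrence is negligible, and raising all gaps
    to infinity halves any bound.\<close>
  obtain K :: nat where K: "real N * (\<theta> ^ Suc K / (1 - \<theta>)) \<le> 1 / 2"
  proof -
    have "(\<lambda>K. real N * (\<theta> ^ Suc K / (1 - \<theta>))) \<longlonglongrightarrow> real N * (0 / (1 - \<theta>))"
      using \<theta> by (intro tendsto_intros LIMSEQ_Suc LIMSEQ_realpow_zero) auto
    hence "\<forall>\<^sub>F K in sequentially. real N * (\<theta> ^ Suc K / (1 - \<theta>)) < 1 / 2"
      by (rule order_tendstoD) auto
    thus thesis using that by (auto simp: eventually_sequentially intro: less_imp_le)
  qed
  have halve: "norm (D b) \<le> M / 2" if M: "\<And>b. gaps_ge N (int K) b \<Longrightarrow> norm (D b) \<le> M" and b: "gaps_ge N (int K) b" for M b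
  proof -
    have "M \<ge> 0" using M[OF b] norm_ge_zero order_trans by blast
    \<comment> \<open>After \<open>i\<close> raises the gap at \<open>j\<close> is at least
      \<open>K + i\<close>, so the next raise changes \<open>D\<close> by at most
      \<open>M * \<theta>^(K+1+i)\<close>. A geometric series bounds all raises of one gap, and
      \<open>K\<close> is chosen so that \<open>N\<close> such series add up to at most
      \<open>M / 2\<close>.\<close>
    have up_bound: "norm (D b - D (raise_gap k j b)) \<le> M * (\<theta> ^ Suc K / (1 - \<theta>))"
      if b: "gaps_ge N (int K) b" and j: "j \<in> {1..<N}" for k j b
    proof -
      have "norm (D b - D (raise_gap k j b)) \<le> M * \<theta> ^ Suc K * (\<Sum>i<k. \<theta> ^ i)"
      proof (induction k)
        case 0
        have "raise_gap 0 j b = b" by (auto simp: raise_gap_def)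
        thus ?case by simp
      next
        case (Suc k)
        have g: "gaps_ge N (int K) (raise_gap k j b)" by (rule gaps_ge_up[OF b])
        have gap: "raise_gap k j b (j - 1) - raise_gap k j b j \<ge> int K + int k"
          using b j raise_gap_gap[of j k j b] by (simp add: gaps_ge_def add_mono del: One_nat_def)
        have "norm (D (raise_gap k j b) - D (raise_gap (Suc k) j b)) =
            \<theta> ^ nat (raise_gap k j b (j - 1) - raise_gap k j b j + 1) * norm (D (transfer j (raise_gap 1 j (raise_gap k j b))))"
          using step[OF gaps_mono[OF g] j] by (simp only: raise_gap_Suc of_nat_0_le_iff)
        also have "\<dots> \<le> \<theta> ^ (Suc K + k) * M"
        proof (rule mult_mono)
          show "\<theta> ^ nat (raise_gap k j b (j - 1) - raise_gap k j b j + 1) \<le> \<theta> ^ (Suc K + k)"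
            using gap \<theta> by (intro power_decreasing) auto
          show "norm (D (transfer j (raise_gap 1 j (raise_gap k j b)))) \<le> M"
            using j by (intro M gaps_ge_transfer g) auto
        qed (use \<theta> in auto)
        finally have "norm (D (raise_gap k j b) - D (raise_gap (Suc k) j b)) \<le> M * \<theta> ^ Suc K * \<theta> ^ k"
          by (simp add: power_add mult_ac)
        with Suc have "norm ((D b - D (raise_gap k j b)) + (D (raise_gap k j b) - D (raise_gap (Suc k) j b)))
            \<le> M * \<theta> ^ Suc K * (\<Sum>i<k. \<theta> ^ i) + M * \<theta> ^ Suc K * \<theta> ^ k"
          by (intro order_trans[OF norm_triangle_ineq] add_mono) auto
        thus ?case by (simp add: algebra_simps)
      qed
      also have "\<dots> \<le> M * \<theta> ^ Suc K * (1 / (1 - \<theta>))"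
      proof (rule mult_left_mono)
        have "(\<Sum>i<k. \<theta> ^ i) \<le> suminf (\<lambda>i. \<theta> ^ i)"
          using \<theta> by (intro sum_le_suminf) auto
        thus "(\<Sum>i<k. \<theta> ^ i) \<le> 1 / (1 - \<theta>)" using \<theta> by (simp add: suminf_geometric)
      qed (use \<theta> \<open>M \<ge> 0\<close> in auto)
      finally show ?thesis by simp
    qed
    \<comment> \<open>The subtraction \<open>J - i\<close> is truncated, so this vector is
      \<open>b\<close> with each of the gaps 1 to \<open>J\<close> raised by \<open>2 k\<close>. For
      \<open>J = N - 1\<close> it is the vector of the limit hypothesis.\<close>
    have all: "norm (D b - D (\<lambda>i. b i + 2 * int k * int (J - i))) \<le> real J * (M * (\<theta> ^ Suc K / (1 - \<theta>)))
        \<and> gaps_ge N (int K) (\<lambda>i. b i + 2 * int k * int (J - i))" if "J < N" for k J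
      using that
    proof (induction J)
      case 0
      thus ?case using b by simp
    next
      case (Suc J)
      let ?c = "\<lambda>J i. b i + 2 * int k * int (J - i)"
      have eq: "?c (Suc J) = raise_gap k (Suc J) (?c J)"
        by (auto simp: raise_gap_def Suc_diff_le algebra_simps)
      have IH: "norm (D b - D (?c J)) \<le> real J * (M * (\<theta> ^ Suc K / (1 - \<theta>)))" "gaps_ge N (int K) (?c J)"
        using Suc by auto
      have "norm ((D b - D (?c J)) + (D (?c J) - D (raise_gap k (Suc J) (?c J)))) \<le>
          real J * (M * (\<theta> ^ Suc K / (1 - \<theta>))) + M * (\<theta> ^ Suc K / (1 - \<theta>))"
        using Suc.prems
        by (intro order_trans[OF norm_triangle_ineq] add_mono IH(1) up_bound[OF IH(2)]) auto
      also have "\<dots> = real (Suc J) * (M * (\<theta> ^ Suc K / (1 - \<theta>)))"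
        by (simp add: distrib_right add_divide_distrib)
      also have "(D b - D (?c J)) + (D (?c J) - D (raise_gap k (Suc J) (?c J))) = D b - D (raise_gap k (Suc J) (?c J))"
        by simp
      finally show ?case
        using gaps_ge_up[OF IH(2), of k "Suc J"] unfolding eq by simp
    qed
    have "norm (D b) \<le> M / 2 + norm (D (\<lambda>i. b i + 2 * int k * int (N - 1 - i)))" for k
    proof (cases "N = 0")
      case False
      have "norm (D b - D (\<lambda>i. b i + 2 * int k * int (N - 1 - i))) \<le> real (N - 1) * (M * (\<theta> ^ Suc K / (1 - \<theta>)))"
        using all[of "N - 1" k] False by simp
      also have "\<dots> \<le> real N * (M * (\<theta> ^ Suc K / (1 - \<theta>)))"
        using \<theta> \<open>M \<ge> 0\<close> by (intro mult_right_mono) auto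
      also have "\<dots> = M * (real N * (\<theta> ^ Suc K / (1 - \<theta>)))" by simp
      also have "\<dots> \<le> M * (1 / 2)" by (rule mult_left_mono[OF K \<open>M \<ge> 0\<close>])
      finally show ?thesis
        using norm_triangle_sub[of "D b" "D (\<lambda>i. b i + 2 * int k * int (N - 1 - i))"] by linarith
    qed (use \<open>M \<ge> 0\<close> in auto)
    moreover have "(\<lambda>k. M / 2 + norm (D (\<lambda>i. b i + 2 * int k * int (N - 1 - i)))) \<longlonglongrightarrow> M / 2 + norm (0 :: complex)"
      by (intro tendsto_intros lim)
    ultimately have "norm (D b) \<le> M / 2 + norm (0 :: complex)"
      by (intro LIMSEQ_le_const) auto
    thus ?thesis by simp
  qed
  have large: "D b = 0" if "gaps_ge N (int K) b" for b
  proof (rule zeroI[of _ "1 / 2"])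
    fix n
    have "\<forall>b. gaps_ge N (int K) b \<longrightarrow> norm (D b) \<le> (1 / 2) ^ n * B"
    proof (induction n)
      case (Suc n)
      thus ?case using halve[of "(1 / 2) ^ n * B"] by simp
    qed (use bound in auto)
    thus "norm (D b) \<le> (1 / 2) ^ n * B" using that by blast
  qed auto

  text \<open>Descent from \<open>Suc k\<close> to \<open>k\<close>: at a gap equal to \<open>k\<close> the vector in the second term of the
    recurrence has at most as many gaps equal to \<open>k\<close>, and this term is multiplied by a power of \<open>p\<close>.\<close>
  have "\<forall>b. gaps_ge N (int (K - n)) b \<longrightarrow> D b = 0" for n
  proof (induction n)
    case 0
    thus ?case using large by simp
  next
    case (Suc n)
    show ?case
    proof (cases "K \<le> n")
      case True
      thus ?thesis using Suc by simp
    next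
      case False
      define k where "k = K - Suc n"
      have Suck: "K - n = Suc k" using False by (simp add: k_def)
      define J where "J b = {j\<in>{1..<N}. b (j - 1) - b j = int k}" for b
      have finJ: "finite (J b)" for b by (auto simp: J_def)
      have "\<forall>b. gaps_ge N (int k) b \<longrightarrow> card (J b) = c \<longrightarrow> D b = 0" for c
      proof (induction c rule: less_induct)
        case (less c)
        show ?case
        proof (cases "c = 0")
          case True
          show ?thesis
          proof (intro allI impI)
            fix b assume b: "gaps_ge N (int k) b" and "card (J b) = c"
            hence "J b = {}" using True finJ by simp
            hence "gaps_ge N (int (Suc k)) b" using b unfolding gaps_ge_def J_def by force
            thus "D b = 0" using Suc unfolding Suck by blast
          qed
        next
          case False
          \<comment> \<open>The transferred vector may have exactly as many gaps equal to
            \<open>k\<close>, so the count alone makes no progress. Each such pass gains a factor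
            \<open>\<theta>\<close>, however, and arbitrarily many passes leave only 0.\<close>
          have "\<forall>b. gaps_ge N (int k) b \<longrightarrow> card (J b) = c \<longrightarrow> norm (D b) \<le> \<theta> ^ i * B" for i
          proof (induction i)
            case 0
            thus ?case using bound by simp
          next
            case (Suc i)
            show ?case
            proof (intro allI impI)
              fix b assume b: "gaps_ge N (int k) b" and c: "card (J b) = c"
              with False obtain j where jJ: "j \<in> J b" using card_eq_0_iff by fastforce
              hence j: "j \<in> {1..<N}" and gap: "b (j - 1) - b j = int k" by (auto simp: J_def)
              let ?b1 = "raise_gap 1 j b" and ?b2 = "transfer j (raise_gap 1 j b)"
              have "J ?b1 = J b - {j}"
                using gap by (auto simp: J_def raise_gap_gap simp del: One_nat_def split: if_splits)
              hence "card (J ?b1) < c" using c jJ finJ[of b] card_Diff1_less by metis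
              hence D1: "D ?b1 = 0" using less.IH gaps_ge_up[OF b] by blast
              have b2: "gaps_ge N (int k) ?b2" using gaps_ge_transfer[OF b] j by simp
              have "J ?b2 \<subseteq> J b"
              proof
                fix i assume "i \<in> J ?b2"
                hence i: "i \<in> {1..<N}" "?b2 (i - 1) - ?b2 i = int k" by (auto simp: J_def)
                have "b (i - 1) - b i \<ge> int k" using b i by (auto simp: gaps_ge_def)
                thus "i \<in> J b" using i j transfer_raise_gap[of i j b] by (auto simp: J_def simp del: One_nat_def split: if_splits)
              qed
              hence "card (J ?b2) \<le> c" using card_mono[OF finJ] c by metis
              hence D2: "norm (D ?b2) \<le> \<theta> ^ i * B"
              proof (cases "card (J ?b2) = c")
                case False
                hence "D ?b2 = 0" using less.IH b2 \<open>card (J ?b2) \<le> c\<close> le_neq_implies_less by blast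
                moreover have "B \<ge> 0" using bound[of b] norm_ge_zero order_trans by blast
                ultimately show ?thesis using \<theta> by simp
              qed (use Suc b2 in blast)
              have "norm (D b) = \<theta> ^ Suc k * norm (D ?b2)"
                using step[OF gaps_mono[OF b] j] by (simp add: D1 gap nat_add_distrib del: One_nat_def)
              also have "\<dots> \<le> \<theta> * (\<theta> ^ i * B)"
              proof (rule mult_mono)
                show "\<theta> ^ Suc k \<le> \<theta>"
                  using \<theta> power_decreasing[of 1 "Suc k" \<theta>] by simp
              qed (use D2 \<theta> in auto)
              finally show "norm (D b) \<le> \<theta> ^ Suc i * B" by (simp add: mult.assoc)
            qed
          qed
          thus ?thesis using zeroI[OF _ \<theta>] by blast
        qed
      qed
      thus ?thesis by (auto simp: k_def)
    qed
  qed
  from this[of K] show ?thesis using b by simp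
qed

section \<open>The conjugate Bailey pair\<close>

definition psum :: "(nat \<Rightarrow> int) \<Rightarrow> nat \<Rightarrow> int" where
  "psum y j = (\<Sum>i<j. y i)"

definition steps :: "(nat \<Rightarrow> int) \<Rightarrow> (nat \<Rightarrow> int) \<Rightarrow> nat \<Rightarrow> int" where
  "steps b y j = (y j - y (j - 1) + (b (j - 1) - b j)) div 2"

lemma psum_0 [simp]: "psum y 0 = 0" and psum_Suc: "psum y (Suc j) = psum y j + y j"
  by (simp_all add: psum_def)

lemma psum_transfer:
  assumes "j \<ge> 1"
  shows "psum (transfer j y) i = psum y i - of_bool (i = j)"
proof (induction i)
  case (Suc i)
  obtain j' where j: "j = Suc j'" using assms by (cases j) auto
  show ?case using Suc by (auto simp: psum_Suc transfer_def j)
qed (use assms in simp)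

context theta_base
begin

definition nweight :: "nat \<Rightarrow> (nat \<Rightarrow> int) \<Rightarrow> (nat \<Rightarrow> int) \<Rightarrow> complex" where
  "nweight N b y = (\<Prod>j=1..<N. qb (psum y j) (steps b y j))"

definition eweight :: "nat \<Rightarrow> (nat \<Rightarrow> int) \<Rightarrow> (nat \<Rightarrow> int) \<Rightarrow> complex" where
  "eweight N b y = (\<Prod>j=1..<N. rq (steps b y j))"

text \<open>The two sides of the identity are subtracted before summation, so that the recurrence,
  the bounds and the limit have to be handled only once. The parameter \<open>s\<close> is the value
  \<open>2 r + l\<close> of the Bailey kernel.\<close>

definition defect :: "nat \<Rightarrow> int \<Rightarrow> (nat \<Rightarrow> int) \<Rightarrow> (nat \<Rightarrow> int) \<Rightarrow> complex" where
  "defect N s b y = nweight N b y * hermite (psum y N) s - rq_lim * eweight N b y * of_bool (psum y N = s)"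

text \<open>The parities in \<open>pvecs\<close> are prescribed for this purpose: they make the
  division by 2 in \<open>steps\<close> exact.\<close>

lemma even_steps:
  assumes "y \<in> pvecs N b" "j \<in> {1..<N}"
  shows "2 * steps b y j = y j - y (j - 1) + (b (j - 1) - b j)"
proof -
  have "even (y j - b j)" "even (y (j - 1) - b (j - 1))"
    using assms by (auto simp: pvecs_def)
  hence "even (y j - y (j - 1) + (b (j - 1) - b j))" by auto
  thus ?thesis by (simp add: steps_def)
qed

lemma steps_up:
  assumes "i \<ge> 1"
  shows "steps (raise_gap 1 j b) y i = steps b y i + of_bool (i = j)"
  unfolding steps_def raise_gap_gap[OF assms] by (auto simp: add.assoc[symmetric])

text \<open>\<open>steps\<close> depends only on the difference of \<open>y\<close> and
  \<open>b\<close>, which a simultaneous transfer leaves unchanged.\<close>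

lemma steps_transfer: "steps (transfer j b) (transfer j y) i = steps b y i"
proof -
  have "transfer j y i = y i - b i + transfer j b i" for i
    by (simp add: transfer_def)
  from this[of i] this[of "i - 1"]
  have "transfer j y i - transfer j y (i - 1) + (transfer j b (i - 1) - transfer j b i) =
      y i - y (i - 1) + (b (i - 1) - b i)" by linarith
  thus ?thesis by (simp only: steps_def)
qed

lemma sq_transfer:
  assumes "j \<in> {1..<N}"
  shows "sqnorm N (transfer j y) = sqnorm N y + 2 * (y j - y (j - 1)) + 2"
proof -
  have *: "(\<Sum>i<N. f i) = (\<Sum>i\<in>{..<N} - {j - 1, j}. f i) + (f (j - 1) + f j)" for f :: "nat \<Rightarrow> int"
    using assms by (subst sum.subset_diff[of "{j - 1, j}"]) auto
  have "(\<Sum>i\<in>{..<N} - {j - 1, j}. (transfer j y i)\<^sup>2) = (\<Sum>i\<in>{..<N} - {j - 1, j}. (y i)\<^sup>2)"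
    by (rule sum.cong) (auto simp: transfer_def)
  moreover have "j - 1 \<noteq> j" using assms by auto
  ultimately show ?thesis
    unfolding sqnorm_def * by (simp add: transfer_def power2_eq_square algebra_simps)
qed

lemma bij_transfer:
  assumes "j \<in> {1..<N}"
  shows "bij_betw (transfer j) (pvecs N b) (pvecs N (transfer j b))"
proof (rule bij_betwI[of _ _ _ "\<lambda>y. y(j - 1 := y (j - 1) + 1, j := y j - 1)"])
  show "transfer j \<in> pvecs N b \<rightarrow> pvecs N (transfer j b)"
    using assms by (auto simp: pvecs_def transfer_def)
  show "(\<lambda>y. y(j - 1 := y (j - 1) + 1, j := y j - 1)) \<in> pvecs N (transfer j b) \<rightarrow> pvecs N b"
  proof
    fix y assume "y \<in> pvecs N (transfer j b)"
    hence y: "\<And>i. i \<ge> N \<Longrightarrow> y i = 0" "\<And>i. i < N \<Longrightarrow> even (y i - transfer j b i)"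
      by (auto simp: pvecs_def)
    have "even ((y(j - 1 := y (j - 1) + 1, j := y j - 1)) i - b i)" if "i < N" for i
      using y(2)[OF that] assms by (auto simp: transfer_def split: if_splits)
    thus "y(j - 1 := y (j - 1) + 1, j := y j - 1) \<in> pvecs N b"
      using y(1) assms by (auto simp: pvecs_def)
  qed
next
  have "j - 1 \<noteq> j" using assms by auto
  thus "(transfer j y)(j - 1 := transfer j y (j - 1) + 1, j := transfer j y j - 1) = y"
    "transfer j (y(j - 1 := y (j - 1) + 1, j := y j - 1)) = y" for y
    by (simp_all add: transfer_def fun_upd_twist)
qed

lemma pvecs_up: "pvecs N (raise_gap k j b) = pvecs N b"
  by (auto simp: pvecs_def raise_gap_def)

text \<open>The q-Pascal rule in the factor at \<open>j\<close>, term by term. Raising the gap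
  raises \<open>n\<close> by one; lowering \<open>m\<close> is the transfer of \<open>y\<close>, and
  the transfer of \<open>b\<close> compensates so that all \<open>steps\<close> stay the same. The
  powers of \<open>p\<close> match because the transfer changes the sum of squares by
  \<open>2 (y j - y (j - 1)) + 2\<close>, which is \<open>4 n\<close> minus twice the gap of
  \<open>b\<close> plus one.\<close>

lemma defect_rec:
  assumes y: "y \<in> pvecs N b" and j: "j \<in> {1..<N}" and gap: "b (j - 1) - b j \<ge> - 1"
  shows "p powi sqnorm N y * defect N s (raise_gap 1 j b) y =
    p powi (2 * (b (j - 1) - b j + 1)) *
      (p powi sqnorm N (transfer j y) * defect N s (transfer j (raise_gap 1 j b)) (transfer j y))
    + p powi sqnorm N y * defect N s b y"
proof -
  define n where "n = steps b y j + 1"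
  define m where "m = psum y j"
  let ?I = "{1..<N} - {j}"
  let ?c = "raise_gap 1 j b" and ?y = "transfer j y"
  have y': "y \<in> pvecs N ?c" using y by (simp only: pvecs_up)
  have j1: "j \<ge> 1" using j by simp
  have gap': "?c (j - 1) - ?c j = b (j - 1) - b j + 2"
    by (simp only: raise_gap_gap[OF j1]) simp
  have nc: "steps ?c y j = n" by (simp only: n_def steps_up[OF j1]) simp
  have two_n: "2 * n = y j - y (j - 1) + (b (j - 1) - b j) + 2"
    using even_steps[OF y j] by (simp add: n_def)
  define X where "X = (\<Prod>i\<in>?I. qb (psum y i) (steps b y i)) * hermite (psum y N) s"
  define X' where "X' = rq_lim * (\<Prod>i\<in>?I. rq (steps b y i)) * of_bool (psum y N = s)"
  have split: "(\<Prod>i=1..<N. f i) = f j * (\<Prod>i\<in>?I. f i)" for f :: "nat \<Rightarrow> complex"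
    using j by (intro prod.remove) auto
  have st: "steps ?c y i = steps b y i" if "i \<in> ?I" for i
    using that by (subst steps_up) auto
  have ps: "psum ?y i = psum y i" if "i \<noteq> j" for i
    using that psum_transfer[OF j1, of y i] by simp
  have psN: "psum ?y N = psum y N" using j by (intro ps) auto
  have st': "steps (transfer j ?c) ?y i = steps ?c y i" for i by (rule steps_transfer)
  have P1: "(\<Prod>i\<in>?I. qb (psum y i) (steps ?c y i)) = (\<Prod>i\<in>?I. qb (psum y i) (steps b y i))"
    "(\<Prod>i\<in>?I. rq (steps ?c y i)) = (\<Prod>i\<in>?I. rq (steps b y i))"
    by (rule prod.cong[OF refl], simp only: st)+
  have P2: "(\<Prod>i\<in>?I. qb (psum ?y i) (steps ?c y i)) = (\<Prod>i\<in>?I. qb (psum y i) (steps ?c y i))"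
    by (rule prod.cong[OF refl]) (simp add: ps)
  have psj: "psum ?y j = psum y j - 1" using psum_transfer[OF j1, of y j] by simp
  have d1: "defect N s ?c y = qb m n * X - rq n * X'"
    unfolding defect_def nweight_def eweight_def split nc X_def X'_def m_def
    unfolding P1 by (simp only: mult_ac)
  have d2: "defect N s (transfer j ?c) ?y = qb (m - 1) n * X - rq n * X'"
    unfolding defect_def nweight_def eweight_def split nc X_def X'_def m_def st' psN
    unfolding P2 P1 psj by (simp only: mult_ac)
  have d3: "defect N s b y = qb m (n - 1) * X - rq (n - 1) * X'"
    unfolding defect_def nweight_def eweight_def split X_def X'_def m_def n_def
    by (simp only: mult_ac add_diff_cancel_right')
  have "2 * (b (j - 1) - b j + 1) + sqnorm N ?y = sqnorm N y + 4 * n"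
    unfolding sq_transfer[OF j] using two_n by simp
  hence pw: "p powi (2 * (b (j - 1) - b j + 1)) * p powi sqnorm N ?y = p powi sqnorm N y * q powi n"
    by (simp only: q_powi power_int_add[OF disjI1[OF p_nonzero], symmetric])
  \<comment> \<open>At the exceptional point \<open>(0, 0)\<close> the partial sums at
    \<open>j - 1\<close> and \<open>j + 1\<close> add up to \<open>y j - y (j - 1)\<close>, which is
    negative because \<open>n = 0\<close>. So one of them is negative, and the adjacent binomial, or
    \<open>hermite\<close> if \<open>Suc j = N\<close>, makes \<open>X\<close> vanish. The partial
    sum at 0 is never negative.\<close>
  have pascal: "qb m n * X = (q powi n * qb (m - 1) n + qb m (n - 1)) * X"
  proof (cases "(m, n) = (0, 0)")
    case True
    have sj: "psum y (Suc (j - 1)) = psum y (j - 1) + y (j - 1)" by (rule psum_Suc)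
    have "psum y (Suc j) + psum y (j - 1) = y j - y (j - 1)"
      using True j1 sj by (simp add: psum_Suc m_def)
    also have "\<dots> < 0" using two_n True gap by simp
    finally have "psum y (Suc j) < 0 \<or> psum y (j - 1) < 0" by linarith
    hence "X = 0"
    proof
      assume neg: "psum y (Suc j) < 0"
      show ?thesis
      proof (cases "Suc j = N")
        case True
        thus ?thesis using neg by (simp add: X_def hermite_neg)
      next
        case False
        have "(\<Prod>i\<in>?I. qb (psum y i) (steps b y i)) = 0"
          using j False neg by (intro prod_zero bexI[of _ "Suc j"]) (auto simp: qb_neg)
        thus ?thesis by (simp add: X_def)
      qed
    next
      assume neg: "psum y (j - 1) < 0"
      hence "j - 1 \<noteq> 0" by (metis less_irrefl psum_0)
      hence "(\<Prod>i\<in>?I. qb (psum y i) (steps b y i)) = 0"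
        using j neg by (intro prod_zero bexI[of _ "j - 1"]) (auto simp: qb_neg)
      thus ?thesis by (simp add: X_def)
    qed
    thus ?thesis by simp
  next
    case False
    show ?thesis by (subst qb_pascal[OF False]) (rule refl)
  qed
  have rqn: "rq n = q powi n * rq n + rq (n - 1)"
    by (simp add: rq_rec algebra_simps)
  have "p powi sqnorm N y * defect N s ?c y = p powi sqnorm N y *
      ((q powi n * qb (m - 1) n + qb m (n - 1)) * X - (q powi n * rq n + rq (n - 1)) * X')"
    unfolding d1 pascal by (simp only: rqn[symmetric])
  also have "\<dots> = (p powi sqnorm N y * q powi n) * (qb (m - 1) n * X - rq n * X')
      + p powi sqnorm N y * (qb m (n - 1) * X - rq (n - 1) * X')"
    by (simp only: algebra_simps)
  also have "\<dots> = p powi (2 * (b (j - 1) - b j + 1)) *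
      (p powi sqnorm N ?y * defect N s (transfer j ?c) ?y) + p powi sqnorm N y * defect N s b y"
    unfolding pw[symmetric] d2 d3 by (simp only: mult.assoc)
  finally show ?thesis .
qed

section \<open>Bounds uniform in \<open>b\<close>, and vanishing of the summed defect\<close>

lemma weights_bounded:
  obtains C where "C \<ge> 1" "\<And>b y. norm (nweight N b y) \<le> C" "\<And>b y. norm (eweight N b y) \<le> C"
proof -
  obtain C where C: "C \<ge> 1" "\<And>n. norm (rq n) \<le> C" "\<And>n. norm (1 / rq n) \<le> C" by (rule rq_bounded) (rule that)
  have C3: "C \<le> C * C * C" "1 \<le> C * C * C" using C(1) mult_mono[of 1 "C * C" 1 C] mult_mono[of 1 "C" 1 C] mult_mono[of 1 "C * C" C C] by auto
  have qb: "norm (qb m n) \<le> C * C * C" for m n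
    unfolding qb_def norm_divide norm_mult using C(2)[of m] C(2)[of n] C(3)[of "m + n"] C(1)
    using mult_mono[of "norm (rq m) * norm (rq n)" "C * C" "norm (1 / rq (m + n))" C]
      mult_mono[of "norm (rq m)" C "norm (rq n)" C] by (simp add: norm_divide)
  have *: "norm (\<Prod>j=1..<N. f j) \<le> (C * C * C) ^ (N - 1)" if "\<And>j. norm (f j) \<le> C * C * C" for f :: "nat \<Rightarrow> complex"
    using prod_mono[of "{1..<N}" "\<lambda>j. norm (f j)" "\<lambda>_. C * C * C"] that by (simp add: prod_norm)
  show thesis
  proof (rule that[of "(C * C * C) ^ (N - 1)"])
    show "1 \<le> (C * C * C) ^ (N - 1)" by (rule one_le_power[OF C3(2)])
    show "norm (nweight N b y) \<le> (C * C * C) ^ (N - 1)" for b y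
      unfolding nweight_def by (rule *, rule qb)
    show "norm (eweight N b y) \<le> (C * C * C) ^ (N - 1)" for b y
      unfolding eweight_def by (rule *, rule order_trans[OF C(2) C3(1)])
  qed
qed

lemma defect_bounded: obtains B where "B \<ge> 0" "\<And>b y. norm (defect N s b y) \<le> B"
proof -
  obtain C where C: "C \<ge> 1" "\<And>m s. norm (hermite m s) \<le> C" by (rule hermite_bounded) (rule that)
  obtain D where D: "D \<ge> 1" "\<And>b y. norm (nweight N b y) \<le> D" "\<And>b y. norm (eweight N b y) \<le> D"
    by (rule weights_bounded[of N]) (rule that)
  show thesis
  proof (rule that[of "D * C + norm rq_lim * D * 1"])
    fix b y
    show "norm (defect N s b y) \<le> D * C + norm rq_lim * D * 1"
      unfolding defect_def
    proof (rule order_trans[OF norm_triangle_ineq4], rule add_mono)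
      show "norm (nweight N b y * hermite (psum y N) s) \<le> D * C"
        unfolding norm_mult using C D by (intro mult_mono) auto
      show "norm (rq_lim * eweight N b y * of_bool (psum y N = s)) \<le> norm rq_lim * D * 1"
        unfolding norm_mult using C D by (intro mult_mono) auto
    qed
  next
    show "D * C + norm rq_lim * D * 1 \<ge> 0" using C D by auto
  qed
qed

text \<open>Each coordinate contributes at most the full theta series \<open>T\<close>, whatever its
  parity, so \<open>T ^ N\<close> works for all \<open>b\<close>.\<close>

lemma infsum_sq_bounded: obtains S where "S \<ge> 0" "\<And>b. (\<Sum>\<^sub>\<infinity>y\<in>pvecs N b. \<rho> powi sqnorm N y) \<le> S"
proof -
  define T where "T = (\<Sum>\<^sub>\<infinity>k::int. \<rho> powi (k\<^sup>2))"
  have T: "(\<Sum>\<^sub>\<infinity>k\<in>A. \<rho> powi (k\<^sup>2)) \<le> T" "T \<ge> 0" for A :: "int set"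
    unfolding T_def using summable_on_theta[of 0]
    by (auto intro!: infsum_mono_neutral infsum_nonneg)
  have "(\<Sum>\<^sub>\<infinity>y\<in>pvecs N b. \<rho> powi sqnorm N y) \<le> T ^ N" for b N
  proof (induction N)
    case 0
    show ?case by (simp add: pvecs_0 sqnorm_def)
  next
    case (Suc N)
    let ?P = "{k. even (k - b N)}"
    let ?u = "\<lambda>yk. (\<lambda>(y, k). y(N := k)) yk"
    have eq: "\<rho> powi sqnorm (Suc N) (?u yk) = (case yk of (y, k) \<Rightarrow> \<rho> powi sqnorm N y * \<rho> powi (k\<^sup>2))" for yk
      by (cases yk) (simp add: sq_upd power_int_add)
    have "(\<lambda>yk. \<rho> powi sqnorm (Suc N) (?u yk)) summable_on pvecs N b \<times> ?P"
      by (rule summable_on_reindex_bij_betw[OF bij_pvecs_Suc, THEN iffD2, OF summable_on_sq])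
    hence summ: "(\<lambda>(y, k). \<rho> powi sqnorm N y * \<rho> powi (k\<^sup>2)) summable_on pvecs N b \<times> ?P"
      by (simp only: eq case_prod_eta)
    have "(\<Sum>\<^sub>\<infinity>y\<in>pvecs (Suc N) b. \<rho> powi sqnorm (Suc N) y) = (\<Sum>\<^sub>\<infinity>yk\<in>pvecs N b \<times> ?P. \<rho> powi sqnorm (Suc N) (?u yk))"
      by (rule infsum_reindex_bij_betw[OF bij_pvecs_Suc, symmetric])
    also have "\<dots> = (\<Sum>\<^sub>\<infinity>(y, k)\<in>pvecs N b \<times> ?P. \<rho> powi sqnorm N y * \<rho> powi (k\<^sup>2))"
      by (simp only: eq case_prod_eta)
    also have "\<dots> = (\<Sum>\<^sub>\<infinity>y\<in>pvecs N b. \<Sum>\<^sub>\<infinity>k\<in>?P. \<rho> powi sqnorm N y * \<rho> powi (k\<^sup>2))"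
      by (rule infsum_Sigma'_banach[OF summ, symmetric])
    also have "\<dots> = (\<Sum>\<^sub>\<infinity>y\<in>pvecs N b. \<rho> powi sqnorm N y) * (\<Sum>\<^sub>\<infinity>k\<in>?P. \<rho> powi (k\<^sup>2))"
      by (simp only: infsum_cmult_right' infsum_cmult_left')
    also have "\<dots> \<le> T ^ N * T"
      using Suc T by (intro mult_mono) (auto intro!: infsum_nonneg)
    finally show ?case by (simp add: mult.commute)
  qed
  thus thesis using that[of "T ^ N"] T(2) by simp
qed

lemma infsum_defect_eq_0:
  assumes N: "N \<ge> 1" and b: "gaps_ge N 0 b"
  shows "(\<Sum>\<^sub>\<infinity>y\<in>pvecs N b. p powi sqnorm N y * defect N s b y) = 0"
proof -
  obtain B where B: "B \<ge> 0" "\<And>b y. norm (defect N s b y) \<le> B" by (rule defect_bounded[of N s]) (rule that)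
  obtain S where S: "S \<ge> 0" "\<And>b. (\<Sum>\<^sub>\<infinity>y\<in>pvecs N b. \<rho> powi sqnorm N y) \<le> S" by (rule infsum_sq_bounded[of N]) (rule that)
  have abs: "(\<lambda>y. norm (p powi sqnorm N y * defect N s c y)) summable_on pvecs N b" for b c
    by (rule abs_summable_on_sq[of _ _ B]) (use B in auto)
  note summ = abs_summable_summable[OF abs]
  show ?thesis
  proof (rule eq_zero_of_gap_recurrence[OF norm_p_less _ _ _ b, where B = "S * B" and
      D = "\<lambda>b. \<Sum>\<^sub>\<infinity>y\<in>pvecs N b. p powi sqnorm N y * defect N s b y"])
    show "norm (\<Sum>\<^sub>\<infinity>y\<in>pvecs N b. p powi sqnorm N y * defect N s b y) \<le> S * B" for b
    proof -
      have "norm (\<Sum>\<^sub>\<infinity>y\<in>pvecs N b. p powi sqnorm N y * defect N s b y) \<le> (\<Sum>\<^sub>\<infinity>y\<in>pvecs N b. norm (p powi sqnorm N y * defect N s b y))"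
        by (rule norm_infsum_bound[OF abs])
      also have "\<dots> \<le> (\<Sum>\<^sub>\<infinity>y\<in>pvecs N b. \<rho> powi sqnorm N y * B)"
        by (rule infsum_mono[OF abs summable_on_cmult_left[OF summable_on_sq]])
          (simp add: norm_mult norm_power_int mult_left_mono B)
      also have "\<dots> = (\<Sum>\<^sub>\<infinity>y\<in>pvecs N b. \<rho> powi sqnorm N y) * B" by (rule infsum_cmult_left')
      also have "\<dots> \<le> S * B" by (rule mult_right_mono[OF S(2) B(1)])
      finally show ?thesis .
    qed
    show "(\<Sum>\<^sub>\<infinity>y\<in>pvecs N (raise_gap 1 j b). p powi sqnorm N y * defect N s (raise_gap 1 j b) y) =
        p powi (2 * (b (j - 1) - b j + 1)) *
          (\<Sum>\<^sub>\<infinity>y\<in>pvecs N (transfer j (raise_gap 1 j b)). p powi sqnorm N y * defect N s (transfer j (raise_gap 1 j b)) y)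
        + (\<Sum>\<^sub>\<infinity>y\<in>pvecs N b. p powi sqnorm N y * defect N s b y)"
      if b: "gaps_ge N 0 b" and j: "j \<in> {1..<N}" for b j
    proof -
      let ?c = "raise_gap 1 j b"
      let ?f = "\<lambda>y. p powi sqnorm N y * defect N s (transfer j ?c) y"
      have bij: "bij_betw (transfer j) (pvecs N b) (pvecs N (transfer j ?c))"
        using bij_transfer[OF j, of ?c] by (simp only: pvecs_up)
      have "b (j - 1) - b j \<ge> 0" using b j by (auto simp: gaps_ge_def)
      hence gap: "b (j - 1) - b j \<ge> - 1" by linarith
      have f: "(\<lambda>y. ?f (transfer j y)) summable_on pvecs N b"
        by (rule summable_on_reindex_bij_betw[OF bij, THEN iffD2, OF summ])
      have "(\<Sum>\<^sub>\<infinity>y\<in>pvecs N ?c. p powi sqnorm N y * defect N s ?c y) =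
          (\<Sum>\<^sub>\<infinity>y\<in>pvecs N b. p powi (2 * (b (j - 1) - b j + 1)) * ?f (transfer j y) + p powi sqnorm N y * defect N s b y)"
        unfolding pvecs_up by (rule infsum_cong, rule defect_rec[OF _ j gap])
      also have "\<dots> = p powi (2 * (b (j - 1) - b j + 1)) * (\<Sum>\<^sub>\<infinity>y\<in>pvecs N b. ?f (transfer j y))
          + (\<Sum>\<^sub>\<infinity>y\<in>pvecs N b. p powi sqnorm N y * defect N s b y)"
        by (simp only: infsum_add[OF summable_on_cmult_right[OF f] summ] infsum_cmult_right')
      also have "(\<Sum>\<^sub>\<infinity>y\<in>pvecs N b. ?f (transfer j y)) = infsum ?f (pvecs N (transfer j ?c))"
        by (rule infsum_reindex_bij_betw[OF bij])
      finally show ?thesis .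
    qed
    show "(\<lambda>k. \<Sum>\<^sub>\<infinity>y\<in>pvecs N (\<lambda>i. b i + 2 * int k * int (N - 1 - i)).
        p powi sqnorm N y * defect N s (\<lambda>i. b i + 2 * int k * int (N - 1 - i)) y) \<longlonglongrightarrow> 0" for b
    proof -
      let ?b = "\<lambda>k i. b i + 2 * int k * int (N - 1 - i)"
      \<comment> \<open>The factor at \<open>j = 0\<close> is \<open>rq 0 = 1\<close>; including it
        gives the product that occurs in \<open>limit_identity\<close>.\<close>
      define F where "F y = (\<Prod>j<N. rq (psum y j))" for y
      have F: "F y = (\<Prod>j=1..<N. rq (psum y j))" for y
        unfolding F_def lessThan_atLeast0 using N by (subst prod.atLeast_Suc_lessThan) auto
      define L where "L y = F y * hermite (psum y N) s - rq_lim ^ N * of_bool (psum y N = s)" for y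
      have Yk: "pvecs N (?b k) = pvecs N b" for k by (auto simp: pvecs_def)
      have "(\<lambda>k. \<Sum>\<^sub>\<infinity>y\<in>pvecs N b. p powi sqnorm N y * defect N s (?b k) y) \<longlonglongrightarrow> (\<Sum>\<^sub>\<infinity>y\<in>pvecs N b. p powi sqnorm N y * L y)"
      proof (rule infsum_dominated_tendsto)
        show "norm (p powi sqnorm N y * defect N s (?b k) y) \<le> \<rho> powi sqnorm N y * B" for k y
          by (simp add: norm_mult norm_power_int mult_left_mono B)
        show "(\<lambda>y. \<rho> powi sqnorm N y * B) summable_on pvecs N b"
          by (rule summable_on_cmult_left[OF summable_on_sq])
        fix y assume "y \<in> pvecs N b"
        have st: "steps (?b k) y j = steps b y j + int k" if "j \<in> {1..<N}" for k j
        proof -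
          have "int (N - 1 - (j - 1)) = int (N - 1 - j) + 1" using that by auto
          hence "?b k (j - 1) - ?b k j = (b (j - 1) - b j) + 2 * int k" by (simp add: algebra_simps)
          hence "(y j - y (j - 1) + (?b k (j - 1) - ?b k j)) = y j - y (j - 1) + (b (j - 1) - b j) + int k * 2"
            by linarith
          thus ?thesis unfolding steps_def by (simp only: div_mult_self1 numeral_neq_zero zero_neq_numeral not_False_eq_True)
        qed
        have lim: "filterlim (\<lambda>k. steps (?b k) y j) at_top sequentially" if "j \<in> {1..<N}" for j
          unfolding st[OF that] filterlim_at_top
        proof
          fix Z :: int
          show "\<forall>\<^sub>F k in sequentially. Z \<le> steps b y j + int k"
            by (rule eventually_sequentiallyI[of "nat (Z - steps b y j)"]) auto
        qed
        have "(\<lambda>k. nweight N (?b k) y) \<longlonglongrightarrow> F y"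
          unfolding nweight_def F by (intro tendsto_prod qb_tendsto lim)
        moreover have "(\<lambda>k. eweight N (?b k) y) \<longlonglongrightarrow> (\<Prod>j=1..<N. rq_lim)"
          unfolding eweight_def by (intro tendsto_prod rq_tendsto lim)
        hence "(\<lambda>k. rq_lim * eweight N (?b k) y) \<longlonglongrightarrow> rq_lim * rq_lim ^ (N - 1)"
          by (intro tendsto_mult tendsto_const) simp
        moreover have "rq_lim * rq_lim ^ (N - 1) = rq_lim ^ N"
          using N by (simp flip: power_Suc)
        ultimately show "(\<lambda>k. p powi sqnorm N y * defect N s (?b k) y) \<longlonglongrightarrow> p powi sqnorm N y * L y"
          unfolding defect_def L_def by (intro tendsto_intros) simp_all
      qed
      also have "(\<Sum>\<^sub>\<infinity>y\<in>pvecs N b. p powi sqnorm N y * L y) =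
          (\<Sum>\<^sub>\<infinity>y\<in>pvecs N b. p powi sqnorm N y * (F y * hermite (psum y N) s)) -
          (\<Sum>\<^sub>\<infinity>y\<in>pvecs N b. rq_lim ^ N * (p powi sqnorm N y * of_bool (psum y N = s)))"
      proof -
        obtain C where C: "C \<ge> 1" "\<And>m s. norm (hermite m s) \<le> C" by (rule hermite_bounded) (rule that)
        obtain D where D: "D \<ge> 1" "\<And>n. norm (rq n) \<le> D" by (rule rq_bounded) (rule that)
        have "norm (F y) \<le> D ^ N" for y
          unfolding F_def prod_norm[symmetric]
          using prod_mono[of "{..<N}" "\<lambda>j. norm (rq (psum y j))" "\<lambda>_. D"] D(2) by simp
        hence "norm (F y * hermite (psum y N) s) \<le> D ^ N * C" for y
          unfolding norm_mult using C D by (intro mult_mono) auto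
        hence 1: "(\<lambda>y. p powi sqnorm N y * (F y * hermite (psum y N) s)) summable_on pvecs N b"
          by (intro summable_on_sq_mult) auto
        have 2: "(\<lambda>y. p powi sqnorm N y * of_bool (psum y N = s)) summable_on pvecs N b"
          by (rule summable_on_sq_mult[of _ _ 1]) auto
        show ?thesis
          by (subst infsum_diff[OF 1 summable_on_cmult_right[OF 2], symmetric])
            (simp add: L_def algebra_simps)
      qed
      also have "\<dots> = 0"
        using limit_identity[where N = N and b = b and s = s] by (simp add: F_def psum_def infsum_cmult_right')
      finally show ?thesis by (simp only: Yk)
    qed
  qed
qed

lemma conjugate_bailey_pair:
  assumes N: "N \<ge> 1" and b: "gaps_ge N 0 b"
  shows "(\<Sum>\<^sub>\<infinity>y\<in>pvecs N b. p powi sqnorm N y * (nweight N b y * hermite (psum y N) s)) =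
    rq_lim * (\<Sum>\<^sub>\<infinity>y\<in>{y\<in>pvecs N b. psum y N = s}. p powi sqnorm N y * eweight N b y)"
proof -
  obtain C where C: "C \<ge> 1" "\<And>m s. norm (hermite m s) \<le> C" by (rule hermite_bounded) (rule that)
  obtain D where D: "D \<ge> 1" "\<And>b y. norm (nweight N b y) \<le> D" "\<And>b y. norm (eweight N b y) \<le> D"
    by (rule weights_bounded[of N]) (rule that)
  have "norm (nweight N b y * hermite (psum y N) s) \<le> D * C" for y
    unfolding norm_mult using C D by (intro mult_mono) auto
  hence 1: "(\<lambda>y. p powi sqnorm N y * (nweight N b y * hermite (psum y N) s)) summable_on pvecs N b"
    by (intro summable_on_sq_mult) auto
  have e: "norm (eweight N b y * of_bool (psum y N = s)) \<le> D * 1" for y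
    unfolding norm_mult using D by (intro mult_mono) auto
  have 2: "(\<lambda>y. p powi sqnorm N y * (eweight N b y * of_bool (psum y N = s))) summable_on pvecs N b"
    by (rule summable_on_sq_mult[of _ _ "D * 1"], rule e, rule order_refl)
  have "(\<Sum>\<^sub>\<infinity>y\<in>pvecs N b. p powi sqnorm N y * (nweight N b y * hermite (psum y N) s)) -
      (\<Sum>\<^sub>\<infinity>y\<in>pvecs N b. rq_lim * (p powi sqnorm N y * (eweight N b y * of_bool (psum y N = s)))) = 0"
    unfolding infsum_defect_eq_0[OF N b, of s, symmetric]
    by (subst infsum_diff[OF 1 summable_on_cmult_right[OF 2], symmetric])
      (simp add: defect_def algebra_simps)
  hence "(\<Sum>\<^sub>\<infinity>y\<in>pvecs N b. p powi sqnorm N y * (nweight N b y * hermite (psum y N) s)) =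
      rq_lim * (\<Sum>\<^sub>\<infinity>y\<in>pvecs N b. p powi sqnorm N y * (eweight N b y * of_bool (psum y N = s)))"
    by (simp add: infsum_cmult_right')
  also have "(\<Sum>\<^sub>\<infinity>y\<in>pvecs N b. p powi sqnorm N y * (eweight N b y * of_bool (psum y N = s))) =
      (\<Sum>\<^sub>\<infinity>y\<in>{y\<in>pvecs N b. psum y N = s}. p powi sqnorm N y * eweight N b y)"
    by (rule infsum_cong_neutral) auto
  finally show ?thesis .
qed

end

section \<open>Interchange of the two summations\<close>

lemma exchange_tendsto:
  fixes u v \<alpha> :: "nat \<Rightarrow> complex" and f :: "nat \<Rightarrow> nat \<Rightarrow> complex" and x :: real
  assumes x: "0 < x" "x < 1"
    and v: "\<And>r. (\<lambda>L. u L * f L r) sums v r"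
    and f_zero: "\<And>L r. L < r \<Longrightarrow> f L r = 0"
    and f_bound: "\<And>L r. norm (f L r) \<le> F"
    and u_bound: "\<And>L. norm (u L) \<le> U * x ^ (L\<^sup>2 + l * L)"
    and \<alpha>_bound: "\<And>L. norm (\<alpha> L) * x ^ (L\<^sup>2 + l * L) \<le> A"
  shows "(\<lambda>K. (\<Sum>r<K. \<alpha> r * v r) - (\<Sum>L<K. u L * (\<Sum>r=0..L. \<alpha> r * f L r))) \<longlonglongrightarrow> 0"
proof -
  define G where "G = A * (U * F)"
  have F: "F \<ge> 0" using f_bound[of 0 0] norm_ge_zero order_trans by blast
  have U: "U \<ge> 0" using order_trans[OF norm_ge_zero u_bound[of 0]] by simp
  have A: "A \<ge> 0" using order_trans[OF norm_ge_zero, of "\<alpha> 0"] \<alpha>_bound[of 0] by simp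
  have G: "G \<ge> 0" using F U A by (simp add: G_def)
  have bound: "norm ((\<Sum>r<K. \<alpha> r * v r) - (\<Sum>L<K. u L * (\<Sum>r=0..L. \<alpha> r * f L r))) \<le> G * x ^ K / (1 - x)\<^sup>2"
    if K: "K \<ge> 1" for K
  proof -
    define t where "t = x ^ K"
    have t: "0 < t" "t \<le> x" using x K power_decreasing[of 1 K x] by (auto simp: t_def)
    hence t1: "t < 1" using x by simp
    have "(\<Sum>L<K. u L * (\<Sum>r=0..L. \<alpha> r * f L r)) = (\<Sum>L<K. \<Sum>r<K. u L * (\<alpha> r * f L r))"
    proof (rule sum.cong)
      fix L assume "L \<in> {..<K}"
      hence "(\<Sum>r=0..L. \<alpha> r * f L r) = (\<Sum>r<K. \<alpha> r * f L r)"
        by (intro sum.mono_neutral_left) (auto simp: f_zero)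
      thus "u L * (\<Sum>r=0..L. \<alpha> r * f L r) = (\<Sum>r<K. u L * (\<alpha> r * f L r))"
        by (simp add: sum_distrib_left)
    qed simp
    also have "\<dots> = (\<Sum>r<K. \<alpha> r * (\<Sum>L<K. u L * f L r))"
      by (subst sum.swap) (simp add: sum_distrib_left mult_ac)
    finally have "(\<Sum>r<K. \<alpha> r * v r) - (\<Sum>L<K. u L * (\<Sum>r=0..L. \<alpha> r * f L r))
        = (\<Sum>r<K. \<alpha> r * (v r - (\<Sum>L<K. u L * f L r)))"
      by (simp add: sum_subtractf right_diff_distrib)
    also have "norm \<dots> \<le> (\<Sum>r<K. G * (t ^ (K - r) / (1 - t)))"
    proof (rule sum_norm_le)
      fix r assume "r \<in> {..<K}"
      hence r: "r < K" by simp
      have tail: "(\<lambda>i. u (i + K) * f (i + K) r) sums (v r - (\<Sum>L<K. u L * f L r))"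
        using sums_iff_shift[of "\<lambda>L. u L * f L r" K "v r - (\<Sum>L<K. u L * f L r)"] v[of r] by simp
      have le: "norm (\<alpha> r * (u (i + K) * f (i + K) r)) \<le> G * t ^ (K - r) * t ^ i" for i
      proof -
        have "r\<^sup>2 + l * r + K * ((K - r) + i) \<le> (i + K)\<^sup>2 + l * (i + K)"
        proof -
          obtain d where d: "K = r + d" using r less_imp_add_positive by blast
          show ?thesis by (simp add: d power2_eq_square algebra_simps)
        qed
        hence "x ^ ((i + K)\<^sup>2 + l * (i + K)) \<le> x ^ (r\<^sup>2 + l * r + K * ((K - r) + i))"
          using x by (intro power_decreasing) auto
        also have "\<dots> = x ^ (r\<^sup>2 + l * r) * (t ^ (K - r) * t ^ i)"
          by (simp only: t_def power_add power_mult)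
        finally have xle: "x ^ ((i + K)\<^sup>2 + l * (i + K)) \<le> x ^ (r\<^sup>2 + l * r) * (t ^ (K - r) * t ^ i)" .
        have "norm (u (i + K)) * norm (f (i + K) r) \<le> (U * (x ^ (r\<^sup>2 + l * r) * (t ^ (K - r) * t ^ i))) * F"
          using U x t by (intro mult_mono f_bound order_trans[OF u_bound] mult_left_mono xle) auto
        hence "norm (\<alpha> r) * (norm (u (i + K)) * norm (f (i + K) r)) \<le>
            norm (\<alpha> r) * ((U * (x ^ (r\<^sup>2 + l * r) * (t ^ (K - r) * t ^ i))) * F)"
          by (rule mult_left_mono) simp
        also have "\<dots> = (norm (\<alpha> r) * x ^ (r\<^sup>2 + l * r)) * (U * F * (t ^ (K - r) * t ^ i))"
          by (simp only: mult_ac)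
        also have "\<dots> \<le> A * (U * F * (t ^ (K - r) * t ^ i))"
          using U F t by (intro mult_right_mono \<alpha>_bound) auto
        finally show ?thesis by (simp only: norm_mult G_def mult_ac)
      qed
      have geo: "(\<lambda>i. G * t ^ (K - r) * t ^ i) sums (G * t ^ (K - r) * (1 / (1 - t)))"
        using t t1 by (intro sums_mult geometric_sums) auto
      have "norm (\<Sum>i. \<alpha> r * (u (i + K) * f (i + K) r)) \<le> (\<Sum>i. G * t ^ (K - r) * t ^ i)"
        by (rule norm_suminf_le[OF le sums_summable[OF geo]])
      thus "norm (\<alpha> r * (v r - (\<Sum>L<K. u L * f L r))) \<le> G * (t ^ (K - r) / (1 - t))"
        using sums_unique[OF sums_mult[OF tail, of "\<alpha> r"]] sums_unique[OF geo] by simp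
    qed
    also have "\<dots> = G / (1 - t) * (\<Sum>r<K. t ^ (K - r))"
      by (simp add: sum_distrib_left sum_divide_distrib)
    also have "(\<Sum>r<K. t ^ (K - r)) = (\<Sum>r<K. t ^ Suc r)"
      by (rule sum.reindex_bij_witness[of _ "\<lambda>r. K - Suc r" "\<lambda>r. K - Suc r"])
        (auto simp: Suc_diff_Suc simp flip: power_Suc)
    also have "\<dots> = t * (\<Sum>r<K. t ^ r)" by (simp add: sum_distrib_left)
    also have "G / (1 - t) * (t * (\<Sum>r<K. t ^ r)) \<le> G / (1 - x) * (t * (1 / (1 - x)))"
    proof -
      have "(\<Sum>r<K. t ^ r) \<le> suminf (\<lambda>r. t ^ r)"
        using t t1 by (intro sum_le_suminf) auto
      also have "\<dots> = 1 / (1 - t)" using t t1 by (simp add: suminf_geometric)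
      also have "\<dots> \<le> 1 / (1 - x)" using t x by (intro divide_left_mono) auto
      finally have "(\<Sum>r<K. t ^ r) \<le> 1 / (1 - x)" .
      moreover have "G / (1 - t) \<le> G / (1 - x)" using t x G t1 by (intro divide_left_mono) auto
      ultimately show ?thesis
        using t x G t1 by (intro mult_mono) (auto intro!: sum_nonneg mult_nonneg_nonneg)
    qed
    also have "\<dots> = G * x ^ K / (1 - x)\<^sup>2" by (simp add: t_def power2_eq_square)
    finally show ?thesis .
  qed
  have "(\<lambda>K. G * x ^ K / (1 - x)\<^sup>2) \<longlonglongrightarrow> G * 0 / (1 - x)\<^sup>2"
    using x by (intro tendsto_intros LIMSEQ_realpow_zero) auto
  hence "(\<lambda>K. G * x ^ K / (1 - x)\<^sup>2) \<longlonglongrightarrow> 0" by simp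
  moreover have "\<forall>\<^sub>F K in sequentially. norm ((\<Sum>r<K. \<alpha> r * v r) - (\<Sum>L<K. u L * (\<Sum>r=0..L. \<alpha> r * f L r))) \<le> G * x ^ K / (1 - x)\<^sup>2"
    using bound by (intro eventually_sequentiallyI[of 1])
  ultimately show ?thesis by (rule Lim_null_comparison[rotated])
qed

section \<open>The change of summation variables\<close>

text \<open>Summation by parts. The inverse Cartan matrix has the entries
  \<open>min j k - j k / N\<close>, and \<open>k = min N k\<close> for the indices that occur, so
  this formula with \<open>j\<close> and with \<open>N\<close> handles both parts.\<close>

lemma sum_min_diff:
  fixes y :: "nat \<Rightarrow> int"
  assumes "j \<le> Suc N"
  shows "(\<Sum>k=1..<Suc N. int (min j k) * (y (k - 1) - y k)) = psum y j - int j * y N"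
  using assms
proof (induction N arbitrary: j)
  case 0
  thus ?case by (cases j) (auto simp: psum_Suc)
next
  case (Suc N)
  have split: "(\<Sum>k=1..<Suc (Suc N). f k) = (\<Sum>k=1..<Suc N. f k) + f (Suc N)" for f :: "nat \<Rightarrow> int"
    by simp
  show ?case
  proof (cases "j = Suc (Suc N)")
    case True
    have "(\<Sum>k=1..<Suc N. int (min j k) * (y (k - 1) - y k)) = (\<Sum>k=1..<Suc N. int (min (Suc N) k) * (y (k - 1) - y k))"
      by (rule sum.cong) (auto simp: True)
    thus ?thesis unfolding split using Suc.IH[of "Suc N"] by (simp add: True psum_Suc algebra_simps)
  next
    case False
    thus ?thesis unfolding split using Suc by (simp add: algebra_simps min_def)
  qed
qed

lemma sum_diff_psum:
  fixes y :: "nat \<Rightarrow> int"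
  shows "(\<Sum>j=1..<Suc N. (y (j - 1) - y j) * psum y j) = (\<Sum>i<Suc N. (y i)\<^sup>2) - y N * psum y (Suc N)"
proof (induction N)
  case 0
  show ?case by (simp add: psum_Suc power2_eq_square)
next
  case (Suc N)
  have split: "(\<Sum>k=1..<Suc (Suc N). f k) = (\<Sum>k=1..<Suc N. f k) + f (Suc N)" for f :: "nat \<Rightarrow> int"
    by simp
  show ?case unfolding split Suc by (simp add: psum_Suc algebra_simps power2_eq_square)
qed

text \<open>The index \<open>j = N\<close>, where both sides are 0, is included for the sake of
  \<open>N = 1\<close>: the restriction then refers to entry 1, which lies outside the
  support.\<close>

lemma cartan_inv_mult_diff:
  fixes y :: "nat \<Rightarrow> int"
  assumes "N \<ge> 1" "j \<in> {1..N}"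
  shows "cartan_inv_mult N (\<lambda>k. y (k - 1) - y k) j = of_int (psum y j) - real j * of_int (psum y N) / real N"
proof (cases "j = N")
  case True
  thus ?thesis using assms by (simp add: cartan_inv_mult_def cartan_inv_eq)
next
  case False
  obtain N' where N: "N = Suc N'" using assms by (cases N) auto
  have "cartan_inv_mult N (\<lambda>k. y (k - 1) - y k) j =
      (\<Sum>k=1..<N. of_int (int (min j k) * (y (k - 1) - y k))
        - real j / real N * of_int (int (min N k) * (y (k - 1) - y k)))"
    unfolding cartan_inv_mult_def
    by (rule sum.cong) (use assms False in \<open>auto simp: cartan_inv_eq algebra_simps\<close>)
  also have "\<dots> = of_int (\<Sum>k=1..<N. int (min j k) * (y (k - 1) - y k))
      - real j / real N * of_int (\<Sum>k=1..<N. int (min N k) * (y (k - 1) - y k))"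
    by (simp add: sum_subtractf sum_distrib_left)
  also have "\<dots> = of_int (psum y j - int j * y N') - real j / real N * of_int (psum y N - int N * y N')"
    using assms unfolding N by (subst (1 2) sum_min_diff) auto
  also have "\<dots> = of_int (psum y j) - real j * of_int (psum y N) / real N"
    by (simp add: N field_simps)
  finally show ?thesis .
qed

lemma cartan_inv_form_diff:
  fixes y :: "nat \<Rightarrow> int"
  assumes "N \<ge> 1"
  defines "g \<equiv> \<lambda>k. y (k - 1) - y k"
  shows "cartan_inv_form N g g = of_int (\<Sum>i<N. (y i)\<^sup>2) - (of_int (psum y N))\<^sup>2 / real N"
proof -
  obtain N' where N: "N = Suc N'" using assms by (cases N) auto
  define M where "M = psum y N"
  have "cartan_inv_form N g g = (\<Sum>j=1..<N. of_int (g j) * cartan_inv_mult N g j)"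
    by (simp add: cartan_inv_form_def cartan_inv_mult_def sum_distrib_left mult.assoc)
  also have "\<dots> = (\<Sum>j=1..<N. of_int (g j * psum y j) - of_int M / real N * of_int (int (min N j) * g j))"
    by (rule sum.cong[OF refl], unfold g_def, subst cartan_inv_mult_diff[OF assms(1)])
      (auto simp: M_def algebra_simps diff_divide_distrib)
  also have "\<dots> = of_int (\<Sum>j=1..<N. g j * psum y j) - of_int M / real N * of_int (\<Sum>j=1..<N. int (min N j) * g j)"
    by (simp add: sum_subtractf sum_distrib_left)
  also have "(\<Sum>j=1..<N. g j * psum y j) = (\<Sum>i<N. (y i)\<^sup>2) - y N' * M"
    unfolding g_def N M_def by (rule sum_diff_psum)
  also have "(\<Sum>j=1..<N. int (min N j) * g j) = M - int N * y N'"
    unfolding g_def N M_def by (rule sum_min_diff) simp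
  also have "of_int ((\<Sum>i<N. (y i)\<^sup>2) - y N' * M) - of_int M / real N * of_int (M - int N * y N')
      = of_int (\<Sum>i<N. (y i)\<^sup>2) - (of_int M)\<^sup>2 / real N"
    by (simp add: N field_simps power2_eq_square)
  finally show ?thesis by (simp add: M_def)
qed

lemma cartan_inv_sym: "cartan_inv N j k = cartan_inv N k j"
  by (auto simp: cartan_inv_eq min.commute mult.commute)

text \<open>Completing the square: \<open>n = (\<pi> - g) / 2\<close> turns the form into a difference of squares.\<close>

lemma cartan_inv_form_complete_square:
  fixes n g \<pi> :: "nat \<Rightarrow> int"
  assumes "\<And>j. j \<in> {1..<N} \<Longrightarrow> 2 * n j = \<pi> j - g j"
  shows "cartan_inv_form N n (\<lambda>k. n k - \<pi> k) = (cartan_inv_form N g g - cartan_inv_form N \<pi> \<pi>) / 4"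
proof -
  let ?c = "cartan_inv N"
  have "cartan_inv_form N n (\<lambda>k. n k - \<pi> k) =
      (\<Sum>j=1..<N. \<Sum>k=1..<N. (of_int (g j) * ?c j k * of_int (g k) - of_int (\<pi> j) * ?c j k * of_int (\<pi> k)) / 4
        + (of_int (g j) * ?c j k * of_int (\<pi> k) - of_int (g k) * ?c j k * of_int (\<pi> j)) / 4)"
    unfolding cartan_inv_form_def
  proof (intro sum.cong refl)
    fix j k assume "j \<in> {1..<N}" "k \<in> {1..<N}"
    hence "real_of_int (2 * n j) = real_of_int (\<pi> j - g j)" "real_of_int (2 * n k) = real_of_int (\<pi> k - g k)"
      by (simp_all only: assms)
    hence n: "real_of_int (n j) = (of_int (\<pi> j) - of_int (g j)) / 2" "real_of_int (n k) = (of_int (\<pi> k) - of_int (g k)) / 2"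
      by simp_all
    show "of_int (n j) * ?c j k * of_int (n k - \<pi> k) =
        (of_int (g j) * ?c j k * of_int (g k) - of_int (\<pi> j) * ?c j k * of_int (\<pi> k)) / 4
        + (of_int (g j) * ?c j k * of_int (\<pi> k) - of_int (g k) * ?c j k * of_int (\<pi> j)) / 4"
      unfolding of_int_diff n by (simp add: field_simps)
  qed
  also have "\<dots> = (cartan_inv_form N g g - cartan_inv_form N \<pi> \<pi>) / 4
      + ((\<Sum>j=1..<N. \<Sum>k=1..<N. of_int (g j) * ?c j k * of_int (\<pi> k))
        - (\<Sum>j=1..<N. \<Sum>k=1..<N. of_int (g k) * ?c j k * of_int (\<pi> j))) / 4"
    by (simp add: cartan_inv_form_def sum.distrib sum_subtractf diff_divide_distrib sum_divide_distrib)
  also have "(\<Sum>j=1..<N. \<Sum>k=1..<N. of_int (g k) * ?c j k * of_int (\<pi> j)) =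
      (\<Sum>j=1..<N. \<Sum>k=1..<N. of_int (g j) * ?c j k * of_int (\<pi> k))"
    by (subst sum.swap) (simp add: cartan_inv_sym)
  finally show ?thesis by simp
qed

text \<open>The gaps are to be the multiplicities of the parts of \<open>lam\<close>. If all parts
  are less than \<open>N\<close>, entry \<open>i\<close> is thus \<open>\<sigma>\<close> plus the
  number of parts greater than \<open>i\<close>: the conjugate partition shifted by
  \<open>\<sigma>\<close>. The last entry is \<open>\<sigma>\<close>, which carries the parity of
  the restricted sums.\<close>

definition bvec :: "nat \<Rightarrow> nat multiset \<Rightarrow> nat \<Rightarrow> nat \<Rightarrow> int" where
  "bvec N lam \<sigma> i = int \<sigma> + (\<Sum>j=i + 1..<N. part_vector N lam j)"

definition nvec :: "nat \<Rightarrow> (nat \<Rightarrow> int) \<Rightarrow> (nat \<Rightarrow> int) \<Rightarrow> nat \<Rightarrow> int" where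
  "nvec N b y = (\<lambda>j. if j \<in> {1..<N} then steps b y j else 0)"

lemma bvec_gap: "bvec N lam \<sigma> (j - 1) - bvec N lam \<sigma> j = part_vector N lam j" if "j \<in> {1..<N}"
proof -
  have "(\<Sum>i=j..<N. part_vector N lam i) = part_vector N lam j + (\<Sum>i=Suc j..<N. part_vector N lam i)"
    using that by (intro sum.atLeast_Suc_lessThan) auto
  thus ?thesis using that by (simp add: bvec_def)
qed

lemma part_vector_nonneg: "part_vector N lam k \<ge> 0"
proof (induction lam)
  case (add p lam)
  have "unit_vector N p k \<ge> 0" by (simp add: unit_vector_def)
  with add show ?case by (simp add: part_vector_def)
qed (simp add: part_vector_def)

lemma gaps_ge_bvec: "gaps_ge N 0 (bvec N lam \<sigma>)"
  using part_vector_nonneg by (auto simp: gaps_ge_def bvec_gap simp del: One_nat_def)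

lemma cartan_inv_mult_combine:
  "cartan_inv_mult N (\<lambda>k. c * u k + v k) j = of_int c * cartan_inv_mult N u j + cartan_inv_mult N v j"
  by (simp add: cartan_inv_mult_def sum.distrib sum_distrib_left algebra_simps)

lemma cartan_inv_mult_cong:
  "(\<And>k. k \<in> {1..<N} \<Longrightarrow> u k = v k) \<Longrightarrow> cartan_inv_mult N u j = cartan_inv_mult N v j"
  by (simp add: cartan_inv_mult_def)

lemma cartan_inv_mult_part_vector:
  assumes "N \<ge> 1" and lam: "\<forall>p\<in>#lam. 1 \<le> p \<and> p \<le> N - 1"
  shows "cartan_inv_mult N (part_vector N lam) 1 =
    of_int (\<Sum>k=1..<N. part_vector N lam k) - real (\<Sum>\<^sub># lam) / real N"
proof (cases "N = 1")
  case True
  hence "lam = {#}" using lam by (metis diff_self_eq_0 le_zero_eq multiset_nonemptyE not_one_le_zero)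
  thus ?thesis using True by (simp add: cartan_inv_mult_def)
next
  case False
  hence "1 \<in> {1..<N}" using assms by auto
  hence "cartan_inv_mult N (part_vector N lam) 1 =
      (\<Sum>k=1..<N. of_int (part_vector N lam k) - of_int (int k * part_vector N lam k) / real N)"
    unfolding cartan_inv_mult_def
    by (intro sum.cong) (auto simp: cartan_inv_eq min_def algebra_simps)
  also have "\<dots> = of_int (\<Sum>k=1..<N. part_vector N lam k) - of_int (\<Sum>k=1..<N. int k * part_vector N lam k) / real N"
    by (simp add: sum_subtractf sum_divide_distrib)
  also have "\<dots> = of_int (\<Sum>k=1..<N. part_vector N lam k) - real (\<Sum>\<^sub># lam) / real N"
    by (simp only: sum_part_vector[OF lam] of_int_of_nat_eq)
  finally show ?thesis .
qed

lemma cartan_inv_mult_unit: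
  assumes "j \<in> {1..<N}"
  shows "cartan_inv_mult N (unit_vector N (N - 1)) j = real j / real N"
proof -
  have "cartan_inv_mult N (unit_vector N (N - 1)) j = (\<Sum>k=1..<N. if k = N - 1 then cartan_inv N j k else 0)"
    unfolding cartan_inv_mult_def by (rule sum.cong) (use assms in \<open>auto simp: unit_vector_def\<close>)
  also have "\<dots> = cartan_inv N j (N - 1)"
    using assms by (subst sum.delta) auto
  also have "\<dots> = real j / real N"
    using assms by (auto simp: cartan_inv_eq of_nat_diff min_def field_simps)
  finally show ?thesis .
qed

context theta_base
begin

text \<open>A vector \<open>y\<close> with \<open>psum y N = 2 * L + l\<close> encodes the summation index \<open>n = nvec N b y\<close>: the
  restriction is a parity condition on \<open>y\<close>, the vector \<open>m\<close> has entries \<open>psum y j\<close>, and the quadratic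
  form becomes a sum of squares.\<close>

context
  fixes N l \<sigma> :: nat and lam :: "nat multiset" and b :: "nat \<Rightarrow> int"
  assumes N: "N \<ge> 1" and lam: "\<forall>p\<in>#lam. 1 \<le> p \<and> p \<le> N - 1"
  defines "b \<equiv> bvec N lam \<sigma>"
begin

abbreviation (input) g :: "(nat \<Rightarrow> int) \<Rightarrow> nat \<Rightarrow> int" where "g y \<equiv> \<lambda>k. y (k - 1) - y k"

lemma b_0: "b 0 = int \<sigma> + (\<Sum>k=1..<N. part_vector N lam k)"
  by (simp add: b_def bvec_def)

lemma nvec_double: "2 * nvec N b y j = part_vector N lam j - g y j" if "y \<in> pvecs N b" "j \<in> {1..<N}"
  using even_steps[OF that] bvec_gap[OF that(2), of lam \<sigma>] that(2) by (simp add: nvec_def b_def)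

text \<open>No total is imposed on \<open>y\<close>, so the formula can be read in two ways. If the
  total is \<open>2 L + l\<close>, the restriction is the parity of \<open>y 0 - b 0\<close>; if
  \<open>y 0\<close> is chosen by the restriction, the total is forced to be
  \<open>2 L + l\<close>.\<close>

lemma restriction_value:
  assumes n: "\<And>j. j \<in> {1..<N} \<Longrightarrow> 2 * n j = part_vector N lam j - g y j"
  shows "(real L + (real l - real (\<Sum>\<^sub># lam)) / 2) / real N - cartan_inv_mult N n 1 =
    (of_int (y 0 - b 0) + real \<sigma>) / 2 + (of_int (2 * int L + int l - psum y N)) / (2 * real N)"
proof -
  have "2 * cartan_inv_mult N n 1 = cartan_inv_mult N (\<lambda>k. 2 * n k + 0) 1"
    by (subst cartan_inv_mult_combine) (simp add: cartan_inv_mult_def)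
  also have "\<dots> = cartan_inv_mult N (\<lambda>k. (- 1) * g y k + part_vector N lam k) 1"
    by (rule cartan_inv_mult_cong) (simp add: n del: One_nat_def)
  also have "\<dots> = - cartan_inv_mult N (g y) 1 + cartan_inv_mult N (part_vector N lam) 1"
    by (subst cartan_inv_mult_combine) simp
  also have "cartan_inv_mult N (g y) 1 = of_int (y 0) - of_int (psum y N) / real N"
    using N psum_Suc[of y 0] by (subst cartan_inv_mult_diff) auto
  also have "cartan_inv_mult N (part_vector N lam) 1 = of_int (b 0 - int \<sigma>) - real (\<Sum>\<^sub># lam) / real N"
    by (subst cartan_inv_mult_part_vector[OF N lam]) (simp add: b_0)
  finally have "cartan_inv_mult N n 1 =
      (- (of_int (y 0) - of_int (psum y N) / real N) + (of_int (b 0 - int \<sigma>) - real (\<Sum>\<^sub># lam) / real N)) / 2"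
    by simp
  thus ?thesis using N by (simp add: field_simps)
qed

text \<open>The vector \<open>n\<close> fixes the consecutive differences of \<open>y\<close>, hence
  \<open>y\<close> up to a constant, and the total fixes the constant.\<close>

lemma bij_nvec:
  "bij_betw (nvec N b) {y \<in> pvecs N b. psum y N = 2 * int L + int l} (restricted N l lam \<sigma> L)"
proof (rule bij_betwI')
  fix y y' assume y: "y \<in> {y \<in> pvecs N b. psum y N = 2 * int L + int l}" and y': "y' \<in> {y \<in> pvecs N b. psum y N = 2 * int L + int l}"
  show "nvec N b y = nvec N b y' \<longleftrightarrow> y = y'"
  proof
    assume eq: "nvec N b y = nvec N b y'"
    have d: "y i - y' i = y 0 - y' 0" if "i < N" for i
      using that
    proof (induction i)
      case (Suc i)
      hence "y i - y (Suc i) = y' i - y' (Suc i)"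
        using nvec_double[of y "Suc i"] nvec_double[of y' "Suc i"] y y' eq by simp
      thus ?case using Suc by simp
    qed simp
    have "psum y N - psum y' N = (\<Sum>i<N. y i - y' i)"
      by (simp add: psum_def sum_subtractf)
    also have "\<dots> = (\<Sum>i<N. y 0 - y' 0)"
      by (rule sum.cong[OF refl]) (rule d, simp)
    also have "\<dots> = int N * (y 0 - y' 0)" by simp
    finally have "y 0 = y' 0" using y y' N by simp
    hence "y i = y' i" for i
      using d[of i] y y' by (cases "i < N") (auto simp: pvecs_def)
    thus "y = y'" by blast
  qed simp
next
  fix y assume y: "y \<in> {y \<in> pvecs N b. psum y N = 2 * int L + int l}"
  have "even (y 0 - b 0)" using y N by (auto simp: pvecs_def)
  then obtain z where z: "y 0 - b 0 = 2 * z" by (elim evenE)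
  have "nvec N b y \<in> int_vectors N" by (auto simp: nvec_def int_vectors_def)
  moreover have nd: "2 * nvec N b y j = part_vector N lam j - g y j" if "j \<in> {1..<N}" for j
    by (rule nvec_double[OF _ that]) (use y in simp)
  have "(real L + (real l - real (\<Sum>\<^sub># lam)) / 2) / real N - cartan_inv_mult N (nvec N b y) 1
      = of_int z + real \<sigma> / 2"
    by (subst restriction_value, rule nd, assumption) (use y in \<open>simp add: z field_simps\<close>)
  ultimately show "nvec N b y \<in> restricted N l lam \<sigma> L"
    unfolding restricted_def by blast
next
  fix n assume "n \<in> restricted N l lam \<sigma> L"
  then obtain z where n: "n \<in> int_vectors N"
    and z: "(real L + (real l - real (\<Sum>\<^sub># lam)) / 2) / real N - cartan_inv_mult N n 1 = of_int z + real \<sigma> / 2"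
    by (auto simp: restricted_def)
  \<comment> \<open>The integer \<open>z\<close> of the restriction is half of
    \<open>y 0 - b 0\<close>; the other entries are forced by the differences.\<close>
  define y where "y i = (if i < N then b 0 + 2 * z - (\<Sum>k=1..i. part_vector N lam k - 2 * n k) else 0)" for i
  have g: "y (j - 1) - y j = part_vector N lam j - 2 * n j" if "j \<in> {1..<N}" for j
  proof -
    have j: "j \<in> {1..<N}" by fact
    then obtain j' where "j = Suc j'" by (cases j) auto
    thus ?thesis using j by (simp add: y_def)
  qed
  have b_diff: "b 0 - b i = (\<Sum>k=1..i. part_vector N lam k)" if "i < N" for i
    using that
  proof (induction i)
    case (Suc i)
    have "b i - b (Suc i) = part_vector N lam (Suc i)"
      using bvec_gap[of "Suc i" N lam \<sigma>] Suc.prems by (simp add: b_def)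
    with Suc show ?case by simp
  qed simp
  have Yy: "y \<in> pvecs N b"
  proof -
    have "y i - b i = 2 * (z + (\<Sum>k=1..i. n k))" if "i < N" for i
      using b_diff[OF that] that by (simp add: y_def sum_subtractf sum_distrib_left)
    hence "even (y i - b i)" if "i < N" for i using that by (metis dvd_triv_left)
    moreover have "y i = 0" if "i \<ge> N" for i using that by (simp add: y_def)
    ultimately show ?thesis unfolding pvecs_def by blast
  qed
  have ny: "nvec N b y = n"
  proof
    fix j
    show "nvec N b y j = n j"
    proof (cases "j \<in> {1..<N}")
      case True
      thus ?thesis using nvec_double[OF Yy True] g[OF True] by linarith
    next
      case False
      thus ?thesis using n unfolding nvec_def int_vectors_def by auto
    qed
  qed
  have y0: "y 0 - b 0 = 2 * z" using N by (simp add: y_def)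
  have nd: "2 * n j = part_vector N lam j - (y (j - 1) - y j)" if "j \<in> {1..<N}" for j
    using g[OF that] by simp
  have "(of_int (y 0 - b 0) + real \<sigma>) / 2 + of_int (2 * int L + int l - psum y N) / (2 * real N) = of_int z + real \<sigma> / 2"
    by (subst restriction_value[symmetric, of n y L]) (rule nd, assumption, rule z)
  hence "of_int (2 * int L + int l - psum y N) / (2 * real N) = (0 :: real)"
    unfolding y0 by (simp add: add_divide_distrib)
  hence "psum y N = 2 * int L + int l" using N by (simp flip: of_int_diff of_int_add)
  thus "\<exists>y\<in>{y \<in> pvecs N b. psum y N = 2 * int L + int l}. n = nvec N b y"
    using Yy ny by blast
qed

lemma m_vector_nvec:
  assumes y: "y \<in> pvecs N b" "psum y N = 2 * int L + int l" and j: "j \<in> {1..<N}"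
  shows "m_vector N l lam L (nvec N b y) j = psum y j"
proof -
  have "cartan_inv_mult N (\<lambda>k. (2 * int L + int l) * unit_vector N (N - 1) k + part_vector N lam k - 2 * nvec N b y k) j
      = cartan_inv_mult N (\<lambda>k. psum y N * unit_vector N (N - 1) k + g y k) j"
    by (rule cartan_inv_mult_cong) (use nvec_double[OF y(1)] y(2) in simp)
  also have "\<dots> = of_int (psum y j)"
    using j N by (simp only: cartan_inv_mult_combine cartan_inv_mult_unit) (subst cartan_inv_mult_diff, auto)
  finally show ?thesis unfolding m_vector_def by (simp only: floor_of_int)
qed

text \<open>The form contains \<open>-(2 L + l)^2 / (4 N)\<close>, that is
  \<open>-(L^2 + l L) / N - l^2 / (4 N)\<close>. The prefactor \<open>a^(L/N) q^(L^2/N)\<close>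
  cancels exactly its dependence on \<open>L\<close>, leaving a constant and a quarter of the sum of
  squares.\<close>

lemma cartan_inv_form_nvec:
  assumes y: "y \<in> pvecs N b" "psum y N = 2 * int L + int l"
  shows "real (l * L) / real N + real (L\<^sup>2) / real N
      + cartan_inv_form N (nvec N b y) (\<lambda>k. nvec N b y k - part_vector N lam k) =
    (- (real l)\<^sup>2 / (4 * real N) - cartan_inv_form N (part_vector N lam) (part_vector N lam) / 4)
      + of_int (sqnorm N y) / 4"
proof -
  have form: "cartan_inv_form N (nvec N b y) (\<lambda>k. nvec N b y k - part_vector N lam k) =
      (of_int (sqnorm N y) - (2 * real L + real l)\<^sup>2 / real N - cartan_inv_form N (part_vector N lam) (part_vector N lam)) / 4"
    by (subst cartan_inv_form_complete_square[OF nvec_double[OF y(1)]], assumption)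
      (simp only: cartan_inv_form_diff[OF N] y(2) sqnorm_def, simp)
  show ?thesis unfolding form using N by (simp add: field_simps power2_eq_square)
qed

end

end

section \<open>From the conjugate Bailey pair to the Bailey lemma\<close>

lemma qpow_add: "qpow w (s + t) = qpow w s * qpow w t"
  by (simp add: qpow_def distrib_right exp_add)

lemma norm_qpow: "norm (qpow w s) = exp (s * Re w)"
  by (simp add: qpow_def)

context theta_base
begin

definition nsum :: "nat \<Rightarrow> (nat \<Rightarrow> int) \<Rightarrow> int \<Rightarrow> complex" where
  "nsum N b M = (\<Sum>\<^sub>\<infinity>y\<in>{y \<in> pvecs N b. psum y N = M}. p powi sqnorm N y * nweight N b y)"

definition esum :: "nat \<Rightarrow> (nat \<Rightarrow> int) \<Rightarrow> int \<Rightarrow> complex" where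
  "esum N b M = (\<Sum>\<^sub>\<infinity>y\<in>{y \<in> pvecs N b. psum y N = M}. p powi sqnorm N y * eweight N b y)"

text \<open>For \<open>a = q^l\<close> this is the Bailey kernel times \<open>rq l\<close>, by
  \<open>qpoch_a\<close>.\<close>

lemma hermite_shifted: "hermite (2 * int L + int l) (2 * int r + int l) = rq (int L - int r) * rq (int L + int r + int l)"
proof -
  have "2 * int L + int l - (2 * int r + int l) = 2 * (int L - int r)"
    "2 * int L + int l + (2 * int r + int l) = 2 * (int L + int r + int l)" by auto
  thus ?thesis by (simp add: hermite_def ac_simps)
qed

text \<open>The conjugate identity with its terms grouped by the total of \<open>y\<close>.
  \<open>hermite\<close> vanishes unless the total is at least \<open>s = 2 r + l\<close> and of the
  same parity, so only totals \<open>2 L + l\<close> with a natural number \<open>L\<close>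
  occur.\<close>

lemma nsum_sums_esum:
  assumes N: "N \<ge> 1" and b: "gaps_ge N 0 b"
  shows "(\<lambda>L. nsum N b (2 * int L + int l) * (rq (int L - int r) * rq (int L + int r + int l))) sums
    (rq_lim * esum N b (2 * int r + int l))"
proof -
  let ?s = "2 * int r + int l"
  define F where "F y = p powi sqnorm N y * (nweight N b y * hermite (psum y N) ?s)" for y
  define A where "A L = {y \<in> pvecs N b. psum y N = 2 * int L + int l}" for L :: nat
  obtain C where C: "C \<ge> 1" "\<And>m s. norm (hermite m s) \<le> C" by (rule hermite_bounded) (rule that)
  obtain D where D: "D \<ge> 1" "\<And>b y. norm (nweight N b y) \<le> D" "\<And>b y. norm (eweight N b y) \<le> D"
    by (rule weights_bounded[of N]) (rule that)
  have e: "norm (nweight N b y * hermite (psum y N) ?s) \<le> D * C" for y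
    unfolding norm_mult using C D by (intro mult_mono) auto
  have "F summable_on pvecs N b"
    unfolding F_def by (rule summable_on_sq_mult[of _ _ "D * C"], rule e, rule order_refl)
  hence "(F has_sum infsum F (pvecs N b)) (pvecs N b)" by (rule has_sum_infsum)
  moreover have "infsum F (pvecs N b) = rq_lim * esum N b ?s"
    unfolding F_def esum_def by (rule conjugate_bailey_pair[OF N b])
  ultimately have "(F has_sum (rq_lim * esum N b ?s)) (pvecs N b)" by (simp only:)
  also have "?this \<longleftrightarrow> (F has_sum (rq_lim * esum N b ?s)) (\<Union>L. A L)"
  proof (rule has_sum_cong_neutral)
    fix y assume "y \<in> pvecs N b - (\<Union>L. A L)"
    hence y: "y \<in> pvecs N b" "\<And>L. psum y N \<noteq> 2 * int L + int l" by (auto simp: A_def)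
    have "hermite (psum y N) ?s = 0"
    proof (cases "even (psum y N - ?s)")
      case True
      then obtain d where d: "psum y N - ?s = 2 * d" by (elim evenE)
      have "d < 0"
      proof (rule ccontr)
        assume "\<not> d < 0"
        hence "psum y N = 2 * int (nat (int r + d)) + int l" using d by simp
        thus False using y(2) by blast
      qed
      thus ?thesis using d by (simp add: hermite_def rq_neg)
    qed (simp add: hermite_def)
    thus "F y = 0" by (simp add: F_def)
  qed (auto simp: A_def)
  also have "\<dots> \<longleftrightarrow> ((\<lambda>Ly. F (snd Ly)) has_sum (rq_lim * esum N b ?s)) (Sigma UNIV A)"
  proof (rule has_sum_reindex_bij_betw[symmetric])
    show "bij_betw snd (Sigma UNIV A) (\<Union>L. A L)"
      by (auto simp: bij_betw_def inj_on_def A_def image_iff)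
  qed
  finally have "((\<lambda>Ly. F (snd Ly)) has_sum (rq_lim * esum N b ?s)) (Sigma UNIV A)" .
  hence "((\<lambda>L. nsum N b (2 * int L + int l) * hermite (2 * int L + int l) ?s) has_sum (rq_lim * esum N b ?s)) UNIV"
  proof (rule has_sum_SigmaD)
    fix L :: nat
    have "(\<lambda>y. p powi sqnorm N y * nweight N b y) summable_on A L"
      by (rule summable_on_sq_mult[of _ _ D], rule D) (auto simp: A_def)
    hence "((\<lambda>y. p powi sqnorm N y * nweight N b y * hermite (2 * int L + int l) ?s) has_sum
        (nsum N b (2 * int L + int l) * hermite (2 * int L + int l) ?s)) (A L)"
      unfolding nsum_def A_def[symmetric] by (intro has_sum_cmult_left has_sum_infsum)
    also have "?this \<longleftrightarrow> ((\<lambda>y. F (snd (L, y))) has_sum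
        (nsum N b (2 * int L + int l) * hermite (2 * int L + int l) ?s)) (A L)"
      by (rule has_sum_cong) (simp add: F_def A_def)
    finally show "((\<lambda>y. F (snd (L, y))) has_sum
        (nsum N b (2 * int L + int l) * hermite (2 * int L + int l) ?s)) (A L)" .
  qed
  thus ?thesis unfolding hermite_shifted by (rule has_sum_imp_sums)
qed

text \<open>The inequality \<open>sqnorm N y >= M^2 / N\<close> alone would leave nothing to sum.
  Subtracting \<open>t = M div N\<close> from every entry gives
  \<open>sqnorm N y = sqnorm N (sh y) + M^2 / N - r^2 / N\<close> with \<open>0 <= r < N\<close>. Up
  to the factor \<open>\<rho>^(-N)\<close> the decay in \<open>M\<close> splits off, and the
  remaining theta sum is bounded uniformly in the parities.\<close>

lemma nsum_bounded:
  assumes N: "N \<ge> 1"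
  obtains C where "\<And>M. norm (nsum N b M) \<le> C * \<rho> powr ((of_int M)\<^sup>2 / N)"
proof -
  obtain D where D: "D \<ge> 1" "\<And>b y. norm (nweight N b y) \<le> D" "\<And>b y. norm (eweight N b y) \<le> D"
    by (rule weights_bounded[of N]) (rule that)
  obtain S where S: "S \<ge> 0" "\<And>b. (\<Sum>\<^sub>\<infinity>y\<in>pvecs N b. \<rho> powi sqnorm N y) \<le> S"
    by (rule infsum_sq_bounded[of N]) (rule that)
  have "norm (nsum N b M) \<le> (D * \<rho> powr (- N) * S) * \<rho> powr ((of_int M)\<^sup>2 / N)" for M
  proof -
    define A where "A = {y \<in> pvecs N b. psum y N = M}"
    define t where "t = M div int N"
    define r where "r = M mod int N"
    have M: "M = r + int N * t" by (simp add: t_def r_def)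
    have r: "0 \<le> r" "r < int N" using N by (auto simp: r_def)
    define sh where "sh y = (\<lambda>i. if i < N then y i - t else 0)" for y :: "nat \<Rightarrow> int"
    have inj: "inj_on sh A"
    proof (rule inj_onI)
      fix y y' assume "y \<in> A" "y' \<in> A" and eq: "sh y = sh y'"
      hence z: "y i = 0 \<and> y' i = 0" if "i \<ge> N" for i using that by (auto simp: A_def pvecs_def)
      have "y i = y' i" if "i < N" for i using fun_cong[OF eq, of i] that by (simp add: sh_def)
      with z show "y = y'" by (metis ext not_le)
    qed
    have sub: "sh ` A \<subseteq> pvecs N (\<lambda>i. b i - t)"
      by (auto simp: A_def pvecs_def sh_def)
    have sqnorm: "real_of_int (sqnorm N y) \<ge> of_int (sqnorm N (sh y)) + ((of_int M)\<^sup>2 / N - N)" if y: "y \<in> A" for y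
    proof -
      have ps: "psum (sh y) N = M - int N * t"
        using y by (simp add: A_def psum_def sh_def sum_subtractf)
      have "sqnorm N y = (\<Sum>i<N. (sh y i)\<^sup>2 + 2 * t * sh y i + t\<^sup>2)"
        unfolding sqnorm_def by (rule sum.cong) (auto simp: sh_def power2_eq_square algebra_simps)
      also have "\<dots> = sqnorm N (sh y) + 2 * t * psum (sh y) N + int N * t\<^sup>2"
        by (simp add: sqnorm_def psum_def sum.distrib sum_distrib_left)
      finally have "sqnorm N y = sqnorm N (sh y) + 2 * t * r + int N * t\<^sup>2"
        unfolding ps by (simp add: M)
      hence "real_of_int (sqnorm N y) = real_of_int (sqnorm N (sh y)) + 2 * real_of_int t * real_of_int r + real N * (real_of_int t)\<^sup>2"
        by (simp only: of_int_add of_int_mult of_int_power of_int_numeral of_int_of_nat_eq)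
      moreover have "(real_of_int M)\<^sup>2 / real N =
          (real_of_int r)\<^sup>2 / real N + 2 * real_of_int t * real_of_int r + real N * (real_of_int t)\<^sup>2"
        using N unfolding M by (simp add: field_simps power2_eq_square)
      moreover have "(real_of_int r)\<^sup>2 / real N \<le> real N"
      proof -
        have "real_of_int r \<le> real_of_int (int N)" using r(2) by (simp only: of_int_le_iff)
        moreover have "0 \<le> real_of_int r" using r(1) by simp
        ultimately have "(real_of_int r)\<^sup>2 \<le> (real N)\<^sup>2" by (intro power_mono) simp_all
        thus ?thesis using N by (simp add: field_simps power2_eq_square)
      qed
      ultimately show ?thesis by linarith
    qed
    have powi: "\<rho> powi k = \<rho> powr (of_int k)" for k by (simp add: powr_real_of_int')
    let ?c = "\<rho> powr ((of_int M)\<^sup>2 / N - N)"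
    have le: "\<rho> powi sqnorm N y \<le> ?c * \<rho> powi sqnorm N (sh y)" if "y \<in> A" for y
    proof -
      have "\<rho> powr (of_int (sqnorm N y)) \<le> \<rho> powr (((of_int M)\<^sup>2 / N - N) + of_int (sqnorm N (sh y)))"
        using sqnorm[OF that] norm_p_less by (intro powr_mono') auto
      thus ?thesis unfolding powi by (simp only: powr_add)
    qed
    have sA: "(\<lambda>y. \<rho> powi sqnorm N y) summable_on A"
      by (rule summable_on_subset[OF summable_on_sq]) (auto simp: A_def)
    have sS: "(\<lambda>y. \<rho> powi sqnorm N y) summable_on sh ` A"
      by (rule summable_on_subset[OF summable_on_sq sub])
    have sS': "(\<lambda>y. \<rho> powi sqnorm N (sh y)) summable_on A"
      using sS by (simp add: summable_on_reindex[OF inj] o_def)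
    have abs: "(\<lambda>y. norm (p powi sqnorm N y * nweight N b y)) summable_on A"
      by (rule abs_summable_on_sq[of _ _ D N b], rule D) (auto simp: A_def)
    have "norm (nsum N b M) \<le> (\<Sum>\<^sub>\<infinity>y\<in>A. norm (p powi sqnorm N y * nweight N b y))"
      unfolding nsum_def A_def[symmetric] by (rule norm_infsum_bound[OF abs])
    also have "\<dots> \<le> (\<Sum>\<^sub>\<infinity>y\<in>A. D * (?c * \<rho> powi sqnorm N (sh y)))"
    proof (rule infsum_mono[OF abs])
      show "(\<lambda>y. D * (?c * \<rho> powi sqnorm N (sh y))) summable_on A"
        by (intro summable_on_cmult_right sS')
      fix y assume "y \<in> A"
      have "norm (nweight N b y) * \<rho> powi sqnorm N y \<le> D * (?c * \<rho> powi sqnorm N (sh y))"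
        using D \<open>y \<in> A\<close> by (intro mult_mono le) auto
      thus "norm (p powi sqnorm N y * nweight N b y) \<le> D * (?c * \<rho> powi sqnorm N (sh y))"
        by (simp add: norm_mult norm_power_int mult.commute)
    qed
    also have "\<dots> = D * ?c * (\<Sum>\<^sub>\<infinity>y\<in>A. \<rho> powi sqnorm N (sh y))"
      by (simp only: infsum_cmult_right' mult.assoc)
    also have "(\<Sum>\<^sub>\<infinity>y\<in>A. \<rho> powi sqnorm N (sh y)) = (\<Sum>\<^sub>\<infinity>y\<in>sh ` A. \<rho> powi sqnorm N y)"
      by (simp add: infsum_reindex[OF inj] o_def)
    also have "D * ?c * (\<Sum>\<^sub>\<infinity>y\<in>sh ` A. \<rho> powi sqnorm N y) \<le> D * ?c * S"
    proof (rule mult_left_mono)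
      have "(\<Sum>\<^sub>\<infinity>y\<in>sh ` A. \<rho> powi sqnorm N y) \<le> (\<Sum>\<^sub>\<infinity>y\<in>pvecs N (\<lambda>i. b i - t). \<rho> powi sqnorm N y)"
        by (rule infsum_mono_neutral[OF sS summable_on_sq]) (use sub in auto)
      also have "\<dots> \<le> S" by (rule S)
      finally show "(\<Sum>\<^sub>\<infinity>y\<in>sh ` A. \<rho> powi sqnorm N y) \<le> S" .
    qed (use D in auto)
    also have "\<dots> = (D * \<rho> powr (- N) * S) * \<rho> powr ((of_int M)\<^sup>2 / N)"
      by (simp add: powr_diff powr_minus field_simps)
    finally show ?thesis .
  qed
  thus thesis by (rule that)
qed

lemma qpoch_a:
  "1 / qpoch q (q ^ l * q) (int n) = rq (int n + int l) / rq (int l)"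
  "1 / qpoch_inf q (q ^ l * q) = rq_lim / rq (int l)"
proof -
  have 1: "q powi (int l + 1) = q ^ l * q"
    by (simp add: power_int_add)
  have 2: "q powi (int n + int l + 1) = q ^ l * q * q ^ n"
    by (simp add: power_int_add)
  show "1 / qpoch q (q ^ l * q) (int n) = rq (int n + int l) / rq (int l)"
    using rq_lim_nonzero unfolding rq_eq 1 2 by (simp add: qpoch_def)
  show "1 / qpoch_inf q (q ^ l * q) = rq_lim / rq (int l)"
    using rq_lim_nonzero unfolding rq_eq 1 by simp
qed

text \<open>\<open>\<kappa>\<close> collects the constants left by completing the square in
  \<open>2 L + l\<close> and in the vector of \<open>lam\<close>. It is independent of
  \<open>L\<close> and the same for both sums.\<close>

lemma
  fixes N l \<sigma> L :: nat and lam :: "nat multiset" and w :: complex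
  assumes N: "N \<ge> 1" and lam: "\<forall>p\<in>#lam. 1 \<le> p \<and> p \<le> N - 1" and w: "p = qpow w (1 / 4)"
  defines "b \<equiv> bvec N lam \<sigma>"
    and "\<kappa> \<equiv> qpow w (- (real l)\<^sup>2 / (4 * real N) - cartan_inv_form N (part_vector N lam) (part_vector N lam) / 4)"
  shows n_sum_eq: "qpow w (l * L / N) * qpow w (L\<^sup>2 / N) * n_sum N l lam \<sigma> q w L = \<kappa> * nsum N b (2 * int L + int l)"
    and eta_sum_eq: "qpow w (l * L / N) * qpow w (L\<^sup>2 / N) * eta_sum N l lam \<sigma> q w L = \<kappa> * esum N b (2 * int L + int l)"
proof -
  define A where "A = {y \<in> pvecs N b. psum y N = 2 * int L + int l}"
  define \<Phi> where "\<Phi> n = qpow w (cartan_inv_form N n (\<lambda>k. n k - part_vector N lam k))" for n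
  have p_powi: "p powi k = qpow w (of_int k / 4)" for k
    unfolding w qpow_def by (simp add: exp_power_int)
  have bij: "bij_betw (nvec N b) A (restricted N l lam \<sigma> L)"
    unfolding A_def b_def by (rule bij_nvec[OF N lam])
  have weight: "qpow w (l * L / N) * qpow w (L\<^sup>2 / N) * \<Phi> (nvec N b y) = \<kappa> * p powi sqnorm N y" if "y \<in> A" for y
  proof -
    have y: "y \<in> pvecs N (bvec N lam \<sigma>)" "psum y N = 2 * int L + int l"
      using that by (auto simp: A_def b_def)
    show ?thesis
      unfolding \<Phi>_def \<kappa>_def b_def p_powi qpow_add[symmetric]
      using cartan_inv_form_nvec[OF N lam y] by (simp only: of_nat_mult of_nat_power)
  qed
  have "n_sum N l lam \<sigma> q w L = (\<Sum>\<^sub>\<infinity>y\<in>A. \<Phi> (nvec N b y) *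
      (\<Prod>j=1..<N. qbinom q (m_vector N l lam L (nvec N b y) j) (nvec N b y j)))"
    unfolding n_sum_def \<Phi>_def by (rule infsum_reindex_bij_betw[OF bij, symmetric])
  also have "\<dots> = (\<Sum>\<^sub>\<infinity>y\<in>A. \<Phi> (nvec N b y) * nweight N b y)"
  proof (rule infsum_cong)
    fix y assume "y \<in> A"
    hence y: "y \<in> pvecs N (bvec N lam \<sigma>)" "psum y N = 2 * int L + int l" by (auto simp: A_def b_def)
    have "(\<Prod>j=1..<N. qbinom q (m_vector N l lam L (nvec N b y) j) (nvec N b y j)) = nweight N b y"
      unfolding nweight_def
    proof (rule prod.cong)
      fix j assume j: "j \<in> {1..<N}"
      show "qbinom q (m_vector N l lam L (nvec N b y) j) (nvec N b y j) = qb (psum y j) (steps b y j)"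
        using m_vector_nvec[OF N lam y j] j by (simp add: qbinom_eq nvec_def b_def)
    qed simp
    thus "\<Phi> (nvec N b y) * (\<Prod>j=1..<N. qbinom q (m_vector N l lam L (nvec N b y) j) (nvec N b y j)) =
        \<Phi> (nvec N b y) * nweight N b y" by simp
  qed
  finally have n: "n_sum N l lam \<sigma> q w L = (\<Sum>\<^sub>\<infinity>y\<in>A. \<Phi> (nvec N b y) * nweight N b y)" .
  have "eta_sum N l lam \<sigma> q w L = (\<Sum>\<^sub>\<infinity>y\<in>A. \<Phi> (nvec N b y) / (\<Prod>j=1..<N. qpoch q q (nvec N b y j)))"
    unfolding eta_sum_def \<Phi>_def by (rule infsum_reindex_bij_betw[OF bij, symmetric])
  also have "\<dots> = (\<Sum>\<^sub>\<infinity>y\<in>A. \<Phi> (nvec N b y) * eweight N b y)"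
  proof (rule infsum_cong)
    fix y
    have "eweight N b y = 1 / (\<Prod>j=1..<N. qpoch q q (nvec N b y j))"
      unfolding eweight_def rq_def by (simp add: prod_dividef nvec_def)
    thus "\<Phi> (nvec N b y) / (\<Prod>j=1..<N. qpoch q q (nvec N b y j)) = \<Phi> (nvec N b y) * eweight N b y"
      by simp
  qed
  finally have e: "eta_sum N l lam \<sigma> q w L = (\<Sum>\<^sub>\<infinity>y\<in>A. \<Phi> (nvec N b y) * eweight N b y)" .
  have sum: "qpow w (l * L / N) * qpow w (L\<^sup>2 / N) * (\<Sum>\<^sub>\<infinity>y\<in>A. \<Phi> (nvec N b y) * f y) =
      \<kappa> * (\<Sum>\<^sub>\<infinity>y\<in>A. p powi sqnorm N y * f y)" for f
    unfolding infsum_cmult_right'[symmetric]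
    by (rule infsum_cong) (simp only: mult.assoc[symmetric] weight)
  show "qpow w (l * L / N) * qpow w (L\<^sup>2 / N) * n_sum N l lam \<sigma> q w L = \<kappa> * nsum N b (2 * int L + int l)"
    unfolding n sum by (simp only: nsum_def A_def)
  show "qpow w (l * L / N) * qpow w (L\<^sup>2 / N) * eta_sum N l lam \<sigma> q w L = \<kappa> * esum N b (2 * int L + int l)"
    unfolding e sum by (simp only: esum_def A_def)
qed

end

text \<open>Convergence, implicit in the informal statement, is made explicit. Boundedness of
  \<open>a^(L/N) q^(L^2/N) \<alpha> L\<close> makes the difference of the partial sums of the two
  sides tend to 0, so convergence of either series carries over to the other with the same value.
  The logarithm \<open>w\<close> fixes the branch of all fractional powers of
  \<open>q\<close>.\<close>

theorem corollary1:
  fixes N l \<sigma> :: nat and lam :: "nat multiset"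
    and q w :: complex and \<alpha> \<beta> :: "nat \<Rightarrow> complex"
  assumes "N \<ge> 1"
    and "\<forall>p\<in>#lam. 1 \<le> p \<and> p \<le> N - 1"
    and "\<sigma> \<in> {0, 1}"
    and "even (l + \<Sum>\<^sub># lam + \<sigma> * N)"
    and "exp w = q" and "norm q < 1"
    and "bailey_pair q (q ^ l) \<alpha> \<beta>"
    and "Bseq (\<lambda>L. qpow w (l * L / N) * qpow w (L\<^sup>2 / N) * \<alpha> L)"
    and "summable (\<lambda>L. qpow w (l * L / N) * qpow w (L\<^sup>2 / N) * \<alpha> L * eta_sum N l lam \<sigma> q w L) \<or>
         summable (\<lambda>L. qpow w (l * L / N) * qpow w (L\<^sup>2 / N) * \<beta> L * n_sum N l lam \<sigma> q w L)"
  shows "summable (\<lambda>L. qpow w (l * L / N) * qpow w (L\<^sup>2 / N) * \<alpha> L * eta_sum N l lam \<sigma> q w L) \<and>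
         summable (\<lambda>L. qpow w (l * L / N) * qpow w (L\<^sup>2 / N) * \<beta> L * n_sum N l lam \<sigma> q w L) \<and>
         1 / qpoch_inf q (q ^ l * q) *
           (\<Sum>L. qpow w (l * L / N) * qpow w (L\<^sup>2 / N) * \<alpha> L * eta_sum N l lam \<sigma> q w L) =
         (\<Sum>L. qpow w (l * L / N) * qpow w (L\<^sup>2 / N) * \<beta> L * n_sum N l lam \<sigma> q w L)"
proof -
  note N = assms(1) and lam = assms(2)
  define p where "p = qpow w (1 / 4)"
  have p4: "p ^ 4 = q"
    using assms(5) by (simp add: p_def qpow_def flip: exp_of_nat_mult)
  have "norm p ^ 4 < 1 ^ 4" using assms(6) by (simp add: norm_power flip: p4)
  hence "norm p < 1" using power_less_imp_less_base[of "norm p" 4 1] by simp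
  then interpret theta_base p by unfold_locales (simp_all add: p_def qpow_def)
  have q: "theta_base.q p = q" by (simp add: q_def p4)
  define b where "b = bvec N lam \<sigma>"
  define \<kappa> where "\<kappa> = qpow w (- (real l)\<^sup>2 / (4 * real N) - cartan_inv_form N (part_vector N lam) (part_vector N lam) / 4)"
  define W where "W L = qpow w (l * L / N) * qpow w (L\<^sup>2 / N)" for L :: nat
  define u where "u L = W L * n_sum N l lam \<sigma> q w L" for L
  define c where "c = 1 / qpoch_inf q (q ^ l * q)"
  define v where "v r = c * (W r * eta_sum N l lam \<sigma> q w r)" for r
  define f where "f L r = 1 / (qpoch q q (int L - int r) * qpoch q (q ^ l * q) (int L + int r))" for L r :: nat
  \<comment> \<open>This is \<open>norm q\<close> to the power \<open>1 / N\<close>. It is the rate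
    of the prefactor, \<open>norm (W L) = x^(L^2 + l L)\<close>, and also of the bound on
    \<open>nsum\<close>, since \<open>(2 L + l)^2 / N\<close> is \<open>4 (L^2 + l L) / N\<close>
    plus a constant.\<close>
  define x where "x = \<rho> powr (4 / N)"
  have x: "0 < x" "x < 1" using N norm_p_less powr_less_mono2[of "4 / N" \<rho> 1] by (simp_all add: x_def)
  have b: "gaps_ge N 0 b" unfolding b_def by (rule gaps_ge_bvec)
  have u: "u L = \<kappa> * nsum N b (2 * int L + int l)" for L
    using n_sum_eq[OF N lam p_def, of l L \<sigma>] by (simp only: u_def W_def q \<kappa>_def b_def)
  have e: "W r * eta_sum N l lam \<sigma> q w r = \<kappa> * esum N b (2 * int r + int l)" for r
    using eta_sum_eq[OF N lam p_def, of l r \<sigma>] by (simp only: W_def q \<kappa>_def b_def)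
  have f: "f L r = rq (int L - int r) * rq (int L + int r + int l) / rq (int l)" for L r
  proof -
    have "f L r = 1 / qpoch q q (int L - int r) * (1 / qpoch q (q ^ l * q) (int (L + r)))"
      by (simp add: f_def)
    also have "\<dots> = rq (int L - int r) * (rq (int (L + r) + int l) / rq (int l))"
      using qpoch_a(1)[of l "L + r"] unfolding q by (simp only: rq_def q)
    finally show ?thesis by simp
  qed
  have c: "c = rq_lim / rq (int l)" using qpoch_a(2)[of l] unfolding q by (simp add: c_def)
  have c0: "c \<noteq> 0" using rq_lim_nonzero rq_nonzero[of "int l"] by (simp add: c)
  have pow: "\<rho> powr ((real_of_int (2 * int L + int l))\<^sup>2 / N) = x ^ (L\<^sup>2 + l * L) * \<rho> powr ((real l)\<^sup>2 / N)" for L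
  proof -
    have "x ^ (L\<^sup>2 + l * L) = \<rho> powr (4 / N * real (L\<^sup>2 + l * L))"
      using x by (simp add: x_def powr_powr flip: powr_realpow)
    moreover have "(real_of_int (2 * int L + int l))\<^sup>2 / N = 4 / N * real (L\<^sup>2 + l * L) + (real l)\<^sup>2 / N"
      by (simp add: power2_eq_square add_divide_distrib algebra_simps)
    ultimately show ?thesis by (simp only: powr_add)
  qed
  have normW: "norm (W L) = x ^ (L\<^sup>2 + l * L)" for L
  proof -
    have "x = exp (Re w / N)" by (simp add: x_def p_def norm_qpow powr_def)
    thus ?thesis
      by (simp add: W_def norm_mult norm_qpow flip: exp_add exp_of_nat_mult) (simp add: add_divide_distrib algebra_simps)
  qed
  obtain C where C: "\<And>M. norm (nsum N b M) \<le> C * \<rho> powr ((of_int M)\<^sup>2 / N)"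
    by (rule nsum_bounded[OF N]) (rule that)
  obtain D where D: "D \<ge> 1" "\<And>n. norm (rq n) \<le> D" by (rule rq_bounded) (rule that)
  obtain A where A: "\<And>L. norm (W L * \<alpha> L) \<le> A"
    using assms(8) unfolding Bseq_def W_def by blast
  have "(\<lambda>K. (\<Sum>r<K. \<alpha> r * v r) - (\<Sum>L<K. u L * (\<Sum>r=0..L. \<alpha> r * f L r))) \<longlonglongrightarrow> 0"
  proof (rule exchange_tendsto[OF x])
    show "(\<lambda>L. u L * f L r) sums v r" for r
      using sums_mult[OF nsum_sums_esum[OF N b, of l r], of "\<kappa> / rq (int l)"]
      by (simp add: u f v_def e c mult_ac)
    show "f L r = 0" if "L < r" for L r
      using that by (simp add: f rq_neg)
    show "norm (f L r) \<le> D * D / norm (rq (int l))" for L r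
      unfolding f norm_divide norm_mult using D by (intro divide_right_mono mult_mono) auto
    show "norm (u L) \<le> norm \<kappa> * C * \<rho> powr ((real l)\<^sup>2 / N) * x ^ (L\<^sup>2 + l * L)" for L
    proof -
      have "norm \<kappa> * norm (nsum N b (2 * int L + int l)) \<le> norm \<kappa> * (C * (x ^ (L\<^sup>2 + l * L) * \<rho> powr ((real l)\<^sup>2 / N)))"
        using C[of "2 * int L + int l"] unfolding pow by (rule mult_left_mono) simp
      thus ?thesis by (simp add: u norm_mult mult_ac)
    qed
    show "norm (\<alpha> L) * x ^ (L\<^sup>2 + l * L) \<le> A" for L
      using A[of L] by (simp add: norm_mult normW mult.commute)
  qed
  moreover have \<beta>: "\<beta> L = (\<Sum>r=0..L. \<alpha> r * f L r)" for L
    using assms(7) by (simp add: bailey_pair_def f_def)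
  define E where "E r = qpow w (l * r / N) * qpow w (r\<^sup>2 / N) * \<alpha> r * eta_sum N l lam \<sigma> q w r" for r :: nat
  define B where "B L = qpow w (l * L / N) * qpow w (L\<^sup>2 / N) * \<beta> L * n_sum N l lam \<sigma> q w L" for L :: nat
  have "\<alpha> r * v r = c * E r" for r by (simp add: v_def E_def W_def)
  moreover have "u L * (\<Sum>r=0..L. \<alpha> r * f L r) = B L" for L
    unfolding \<beta>[symmetric] by (simp add: u_def B_def W_def)
  ultimately have lim: "(\<lambda>K. (\<Sum>r<K. c * E r) - (\<Sum>L<K. B L)) \<longlonglongrightarrow> 0" by simp
  have "summable E \<or> summable B" using assms(9) unfolding E_def B_def .
  hence "\<exists>s. (\<lambda>r. c * E r) sums s \<and> B sums s"
  proof
    assume "summable E"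
    hence s: "(\<lambda>r. c * E r) sums (c * suminf E)" by (intro sums_mult summable_sums)
    hence "B sums (c * suminf E - 0)"
      using tendsto_diff[OF s[unfolded sums_def] lim] by (simp add: sums_def)
    with s show ?thesis by auto
  next
    assume "summable B"
    hence s: "B sums suminf B" by (rule summable_sums)
    hence "(\<lambda>r. c * E r) sums (0 + suminf B)"
      using tendsto_add[OF lim s[unfolded sums_def]] by (simp add: sums_def)
    with s show ?thesis by auto
  qed
  then obtain s where s: "(\<lambda>r. c * E r) sums s" "B sums s" by blast
  have "(\<lambda>r. inverse c * (c * E r)) sums (inverse c * s)" by (rule sums_mult[OF s(1)])
  hence E: "E sums (inverse c * s)" using c0 by (simp flip: mult.assoc)
  have "suminf E = inverse c * s" "suminf B = s"
    using sums_unique[OF E] sums_unique[OF s(2)] by simp_all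
  hence "summable E \<and> summable B \<and> c * suminf E = suminf B"
    using sums_summable[OF E] sums_summable[OF s(2)] c0 by simp
  thus ?thesis unfolding E_def B_def c_def .
qed

end
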